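(* Let $C$ be a clutter with finite vertex set $X$, let $\Bbbk$ be a field, and let $W_1,\dots,W_n$ be the minimal vertex covers of $C$. For every $s\in\mathbb{N}$, $$\mathcal{P}_s(I(C))=\bigcap_{k=1}^n\langle\mathcal{J}_s(W_k)\rangle$$ is the irredundant primary decomposition of the ideal $\mathcal{P}_s(I(C))$ of $\Bbbk[\mathcal{J}_s(X)]$.
   Context: $\mathbb{N}$ includes $0$. A clutter $C$ with vertex set $X$ is a family $E(C)$ of subsets of $X$ (edges), none of which is contained in another. $\Bbbk[X]$ is the polynomial ring with the elements of $X$ as variables; the edge ideal $I(C)\subseteq\Bbbk[X]$ is generated by the monomials $x_1\cdots x_r$ with $\{x_1,\dots,x_r\}\in E(C)$. A vertex cover of $C$ is a subset of $X$ meeting every edge; it is minimal if no proper subset is a vertex cover. For a set $Y$ and $s\in\mathbb{N}$ let $\mathcal{J}_s(Y)=\bigcup_{y\in Y}\{y_0,\dots,y_s\}$ (new distinct variables). Let $\phi_s\colon\Bbbk[X]\to\Bbbk[\mathcal{J}_s(X)][t]/\langle t^{s+1}\rangle$ be the $\Bbbk$-algebra homomorphism with $\phi_s(x)=\sum_{j=0}^s x_jt^j$. For an ideal $I=\langle f_1,\dots,f_r\rangle$ of $\Bbbk[X]$, the ideal of $s$-jets $\mathcal{J}_s(I)\subseteq\Bbbk[\mathcal{J}_s(X)]$ is generated by the $f_{i,j}$ determined by $\phi_s(f_i)=\sum_{j=0}^s f_{i,j}t^j$. Ideal of principal $s$-jets: for an ideal $I$ of $\Bbbk[X]$, let $Z$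 be the vanishing locus of $I$ in $\mathbb{A}^{|X|}_\Bbbk=\operatorname{Spec}\Bbbk[X]$ with its reduced structure, $Z_{\text{sing}}$ its singular locus, and write $\mathbb{I}(\cdot)$ for the ideal of polynomials vanishing on a subset of affine space (so $\mathbb{I}(Z)=\sqrt I$). The jet scheme $\mathcal{J}_s(\mathbb{A}^{|X|}_\Bbbk)$ is $\operatorname{Spec}\Bbbk[\mathcal{J}_s(X)]$, $\mathcal{J}_s(Z)$ is the vanishing locus in it of $\mathcal{J}_s(\mathbb{I}(Z))$, and $\pi_s\colon\mathcal{J}_s(\mathbb{A}^{|X|}_\Bbbk)\to\mathbb{A}^{|X|}_\Bbbk$ is the projection corresponding to $x\mapsto x_0$. Then $$\mathcal{P}_s(I)=\mathbb{I}\Bigl(\overline{\mathcal{J}_s(Z)\setminus\pi_s^{-1}(Z_{\text{sing}})}\Bigr)\subseteq\Bbbk[\mathcal{J}_s(X)],$$ the bar denoting Zariski closure. *)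

theory Defs
  imports
    "HOL-Library.Poly_Mapping"
    "HOL-Library.Extended_Nat"
    "HOL-Computational_Algebra.Polynomial"
    "HOL-Algebra.Ring_Divisibility"
    "HOL-Analysis.Abstract_Topology"
begin

section \<open>Polynomial rings\<close>

type_synonym ('x, 'k) mpol = "('x \<Rightarrow>\<^sub>0 nat) \<Rightarrow>\<^sub>0 'k"

definition mpoly_ring :: "'x set \<Rightarrow> ('x, 'k::field) mpol ring" where
  "mpoly_ring X = \<lparr>carrier = {f. \<forall>m\<in>Poly_Mapping.keys f. Poly_Mapping.keys m \<subseteq> X},
     mult = (*), one = 1, zero = 0, add = (+)\<rparr>"

definition mvar :: "'x \<Rightarrow> ('x, 'k::field) mpol" where
  "mvar x = Poly_Mapping.single (Poly_Mapping.single x 1) 1"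

definition mconst :: "'k::field \<Rightarrow> ('x, 'k) mpol" where
  "mconst a = Poly_Mapping.single 0 a"

text \<open>The evaluation homomorphism given by \<open>c\<close> on coefficients and \<open>v\<close> on variables.\<close>
definition mpoly_eval ::
  "('k::field \<Rightarrow> 'b::comm_ring_1) \<Rightarrow> ('x \<Rightarrow> 'b) \<Rightarrow> ('x, 'k) mpol \<Rightarrow> 'b" where
  "mpoly_eval c v f =
     (\<Sum>m\<in>Poly_Mapping.keys f. c (Poly_Mapping.lookup f m) *
        (\<Prod>x\<in>Poly_Mapping.keys m. v x ^ Poly_Mapping.lookup m x))"


section \<open>Clutters\<close>

definition clutter :: "'x set \<Rightarrow> 'x set set \<Rightarrow> bool" where
  "clutter X E \<longleftrightarrow> E \<subseteq> Pow X \<and> (\<forall>e\<in>E. \<forall>f\<in>E. e \<subseteq> f \<longrightarrow> e = f)"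

definition edge_ideal :: "'x set \<Rightarrow> 'x set set \<Rightarrow> ('x, 'k::field) mpol set" where
  "edge_ideal X E = Idl\<^bsub>mpoly_ring X\<^esub> ((\<lambda>e. \<Prod>x\<in>e. mvar x) ` E)"

definition vertex_cover :: "'x set \<Rightarrow> 'x set set \<Rightarrow> 'x set \<Rightarrow> bool" where
  "vertex_cover X E U \<longleftrightarrow> U \<subseteq> X \<and> (\<forall>e\<in>E. U \<inter> e \<noteq> {})"

definition minimal_vertex_cover :: "'x set \<Rightarrow> 'x set set \<Rightarrow> 'x set \<Rightarrow> bool" where
  "minimal_vertex_cover X E U \<longleftrightarrow>
     vertex_cover X E U \<and> (\<forall>V. V \<subset> U \<longrightarrow> \<not> vertex_cover X E V)"


section \<open>Spectra\<close>

definition Spec :: "('a, 'b) ring_scheme \<Rightarrow> 'a set set" where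
  "Spec R = {P. primeideal P R}"

definition vanishing_locus :: "('a, 'b) ring_scheme \<Rightarrow> 'a set \<Rightarrow> 'a set set" where
  "vanishing_locus R A = {P \<in> Spec R. A \<subseteq> P}"

definition zariski :: "('a, 'b) ring_scheme \<Rightarrow> 'a set topology" where
  "zariski R = topology (\<lambda>U. \<exists>A \<subseteq> carrier R. U = Spec R - vanishing_locus R A)"

text \<open>An element \<open>f\<close> vanishes at the point \<open>P\<close> iff its image in the residue field of \<open>P\<close> is
  zero, that is, iff \<open>f \<in> P\<close>. For \<open>S = {}\<close> this gives the whole ring.\<close>
definition vanishing_ideal :: "('a, 'b) ring_scheme \<Rightarrow> 'a set set \<Rightarrow> 'a set" where
  "vanishing_ideal R S = {f \<in> carrier R. \<forall>P\<in>S. f \<in> P}"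

lemma istopology_zariski:
  "istopology (\<lambda>U. \<exists>A \<subseteq> carrier R. U = Spec R - vanishing_locus R A)"
  unfolding istopology_def
proof (intro conjI allI impI)
  fix S T
  assume "\<exists>A \<subseteq> carrier R. S = Spec R - vanishing_locus R A"
    and "\<exists>A \<subseteq> carrier R. T = Spec R - vanishing_locus R A"
  then obtain A B where A: "A \<subseteq> carrier R" "S = Spec R - vanishing_locus R A"
    and B: "B \<subseteq> carrier R" "T = Spec R - vanishing_locus R B" by blast
  define C where "C = {a \<otimes>\<^bsub>R\<^esub> b | a b. a \<in> A \<and> b \<in> B}"
  have C_iff: "C \<subseteq> P \<longleftrightarrow> A \<subseteq> P \<or> B \<subseteq> P" if "primeideal P R" for P
  proof -
    interpret primeideal P R by fact
    show ?thesis
    proof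
      assume C: "C \<subseteq> P"
      show "A \<subseteq> P \<or> B \<subseteq> P"
      proof (rule ccontr)
        assume "\<not> (A \<subseteq> P \<or> B \<subseteq> P)"
        then obtain a b where ab: "a \<in> A" "a \<notin> P" "b \<in> B" "b \<notin> P" by blast
        then have "a \<otimes>\<^bsub>R\<^esub> b \<in> P" using C unfolding C_def by blast
        with ab A(1) B(1) show False using I_prime by blast
      qed
    next
      assume "A \<subseteq> P \<or> B \<subseteq> P"
      with A(1) B(1) show "C \<subseteq> P" unfolding C_def using I_l_closed I_r_closed by blast
    qed
  qed
  have "S \<inter> T = Spec R - vanishing_locus R C"
    unfolding A B vanishing_locus_def Spec_def using C_iff by blast
  moreover have "C \<subseteq> carrier R" if "Spec R \<noteq> {}"
  proof -
    from that obtain P where "primeideal P R" unfolding Spec_def by blast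
    then interpret primeideal P R .
    show ?thesis using A(1) B(1) unfolding C_def by auto
  qed
  ultimately show "\<exists>A \<subseteq> carrier R. S \<inter> T = Spec R - vanishing_locus R A"
    by (cases "Spec R = {}") auto
next
  fix K
  assume "\<forall>U\<in>K. \<exists>A \<subseteq> carrier R. U = Spec R - vanishing_locus R A"
  then obtain f where f: "\<And>U. U \<in> K \<Longrightarrow> f U \<subseteq> carrier R \<and> U = Spec R - vanishing_locus R (f U)"
    by metis
  have "\<Union>K = Spec R - vanishing_locus R (\<Union>U\<in>K. f U)"
    using f unfolding vanishing_locus_def by blast
  then show "\<exists>A \<subseteq> carrier R. \<Union>K = Spec R - vanishing_locus R A"
    using f by (metis (no_types, lifting) UN_least)
qed

lemma openin_zariski:
  "openin (zariski R) U \<longleftrightarrow> (\<exists>A \<subseteq> carrier R. U = Spec R - vanishing_locus R A)"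
  unfolding zariski_def by (simp add: istopology_zariski)


section \<open>Local rings and singular loci\<close>

text \<open>Localization of \<open>R\<close> at the prime ideal \<open>P\<close>: \<open>frac R P a s\<close> is the fraction \<open>a / s\<close>, the
  class of \<open>(a, s)\<close> for the relation \<open>(a, s) \<sim> (b, t) \<longleftrightarrow> u (a t - b s) = 0\<close> for some
  \<open>u \<notin> P\<close>.\<close>
definition frac_rel :: "('a, 'b) ring_scheme \<Rightarrow> 'a set \<Rightarrow> (('a \<times> 'a) \<times> ('a \<times> 'a)) set" where
  "frac_rel R P = {((a, s), (b, t)).
     a \<in> carrier R \<and> s \<in> carrier R - P \<and> b \<in> carrier R \<and> t \<in> carrier R - P \<and>
     (\<exists>u \<in> carrier R - P. u \<otimes>\<^bsub>R\<^esub> (a \<otimes>\<^bsub>R\<^esub> t \<ominus>\<^bsub>R\<^esub> b \<otimes>\<^bsub>R\<^esub> s) = \<zero>\<^bsub>R\<^esub>)}"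

definition frac :: "('a, 'b) ring_scheme \<Rightarrow> 'a set \<Rightarrow> 'a \<Rightarrow> 'a \<Rightarrow> ('a \<times> 'a) set" where
  "frac R P a s = frac_rel R P `` {(a, s)}"

definition localization :: "('a, 'b) ring_scheme \<Rightarrow> 'a set \<Rightarrow> ('a \<times> 'a) set ring" where
  "localization R P = \<lparr>
     carrier = (carrier R \<times> (carrier R - P)) // frac_rel R P,
     mult = (\<lambda>p q. \<Union>(a, s)\<in>p. \<Union>(b, t)\<in>q. frac R P (a \<otimes>\<^bsub>R\<^esub> b) (s \<otimes>\<^bsub>R\<^esub> t)),
     one = frac R P \<one>\<^bsub>R\<^esub> \<one>\<^bsub>R\<^esub>,
     zero = frac R P \<zero>\<^bsub>R\<^esub> \<one>\<^bsub>R\<^esub>,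
     add = (\<lambda>p q. \<Union>(a, s)\<in>p. \<Union>(b, t)\<in>q.
              frac R P (a \<otimes>\<^bsub>R\<^esub> t \<oplus>\<^bsub>R\<^esub> b \<otimes>\<^bsub>R\<^esub> s) (s \<otimes>\<^bsub>R\<^esub> t))\<rparr>"

text \<open>The supremum of the lengths \<open>n\<close> of chains \<open>c 0 \<subset> \<dots> \<subset> c n\<close> of prime ideals.\<close>
definition krull_dim :: "('a, 'b) ring_scheme \<Rightarrow> enat" where
  "krull_dim R = Sup {enat n | n. \<exists>c :: nat \<Rightarrow> 'a set.
     (\<forall>i\<le>n. primeideal (c i) R) \<and> (\<forall>i<n. c i \<subset> c (Suc i))}"

text \<open>A Noetherian local ring is regular if its maximal ideal can be generated by as many
  elements as the dimension of the ring.\<close>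
definition regular_local_ring :: "('a, 'b) ring_scheme \<Rightarrow> bool" where
  "regular_local_ring R \<longleftrightarrow> cring R \<and> noetherian_ring R \<and>
     (\<exists>m. maximalideal m R \<and> (\<forall>m'. maximalideal m' R \<longrightarrow> m' = m) \<and>
       (\<exists>G \<subseteq> carrier R. finite G \<and> enat (card G) = krull_dim R \<and> m = Idl\<^bsub>R\<^esub> G))"

text \<open>A closed subset \<open>Z\<close> of \<open>Spec R\<close> with its reduced structure is the spectrum of \<open>R / J\<close>
  for \<open>J\<close> the vanishing ideal of \<open>Z\<close>; the point of this spectrum that corresponds to \<open>P \<in> Z\<close>
  is \<open>P / J\<close>.\<close>
definition reduced_local_ring ::
  "('a, 'b) ring_scheme \<Rightarrow> 'a set set \<Rightarrow> 'a set \<Rightarrow> ('a set \<times> 'a set) set ring" where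
  "reduced_local_ring R Z P =
     (let J = vanishing_ideal R Z in localization (R Quot J) ((\<lambda>a. J +>\<^bsub>R\<^esub> a) ` P))"

definition singular_locus :: "('a, 'b) ring_scheme \<Rightarrow> 'a set set \<Rightarrow> 'a set set" where
  "singular_locus R Z = {P \<in> Z. \<not> regular_local_ring (reduced_local_ring R Z P)}"


section \<open>Jets\<close>

text \<open>The variable \<open>y\<^sub>j\<close> is the pair \<open>(y, j)\<close>.\<close>
definition jet_vars :: "nat \<Rightarrow> 'y set \<Rightarrow> ('y \<times> nat) set" where
  "jet_vars s Y = Y \<times> {0..s}"

text \<open>A lift to \<open>\<k>[\<J>\<^sub>s(X)][t]\<close> of the homomorphism to \<open>\<k>[\<J>\<^sub>s(X)][t] / \<langle>t\<^bsup>s+1\<^esup>\<rangle>\<close> sending \<open>x\<close>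
  to \<open>\<Sum>j\<le>s. x\<^sub>j t\<^sup>j\<close>. A class modulo \<open>t\<^bsup>s+1\<^esup>\<close> amounts to its coefficients of degree at
  most \<open>s\<close>; see \<open>jet_coeff_unique\<close> below.\<close>
definition jet_hom :: "nat \<Rightarrow> ('x, 'k::field) mpol \<Rightarrow> ('x \<times> nat, 'k) mpol poly" where
  "jet_hom s = mpoly_eval (\<lambda>a. [:mconst a:]) (\<lambda>x. \<Sum>j\<le>s. Polynomial.monom (mvar (x, j)) j)"

definition jet_coeff :: "nat \<Rightarrow> ('x, 'k::field) mpol \<Rightarrow> nat \<Rightarrow> ('x \<times> nat, 'k) mpol" where
  "jet_coeff s f j = Polynomial.coeff (jet_hom s f) j"

text \<open>The ideal of \<open>s\<close>-jets of the ideal generated by \<open>F\<close>. By \<open>jet_ideal_genideal\<close> below it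
  depends only on that ideal, so \<open>F\<close> may also be the ideal itself.\<close>
definition jet_ideal :: "'x set \<Rightarrow> nat \<Rightarrow> ('x, 'k::field) mpol set \<Rightarrow> ('x \<times> nat, 'k) mpol set" where
  "jet_ideal X s F = Idl\<^bsub>mpoly_ring (jet_vars s X)\<^esub> {jet_coeff s f j | f j. f \<in> F \<and> j \<le> s}"

text \<open>The projection \<open>\<pi>\<^sub>s\<close> on spectra, which takes preimages under \<open>x \<mapsto> x\<^sub>0\<close>.\<close>
definition jet_proj ::
  "'x set \<Rightarrow> ('x \<times> nat, 'k::field) mpol set \<Rightarrow> ('x, 'k) mpol set" where
  "jet_proj X Q = {f \<in> carrier (mpoly_ring X). mpoly_eval mconst (\<lambda>x. mvar (x, 0)) f \<in> Q}"

definition principal_jet_ideal ::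
  "'x set \<Rightarrow> nat \<Rightarrow> ('x, 'k::field) mpol set \<Rightarrow> ('x \<times> nat, 'k) mpol set" where
  "principal_jet_ideal X s I =
     (let R = mpoly_ring X; R\<^sub>s = mpoly_ring (jet_vars s X);
          Z = vanishing_locus R I;
          JZ = vanishing_locus R\<^sub>s (jet_ideal X s (vanishing_ideal R Z))
      in vanishing_ideal R\<^sub>s
           (zariski R\<^sub>s closure_of (JZ - {Q \<in> Spec R\<^sub>s. jet_proj X Q \<in> singular_locus R Z})))"


section \<open>Primary decompositions\<close>

definition radical :: "('a, 'b) ring_scheme \<Rightarrow> 'a set \<Rightarrow> 'a set" where
  "radical R I = {a \<in> carrier R. \<exists>n::nat. a [^]\<^bsub>R\<^esub> n \<in> I}"

definition primary_ideal :: "'a set \<Rightarrow> ('a, 'b) ring_scheme \<Rightarrow> bool" where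
  "primary_ideal Q R \<longleftrightarrow> ideal Q R \<and> Q \<noteq> carrier R \<and>
     (\<forall>a\<in>carrier R. \<forall>b\<in>carrier R. a \<otimes>\<^bsub>R\<^esub> b \<in> Q \<longrightarrow> a \<in> Q \<or> b \<in> radical R Q)"

text \<open>The intersection with the carrier matters for the empty family, whose intersection is the
  unit ideal.\<close>
definition irredundant_primary_decomposition ::
  "('a, 'b) ring_scheme \<Rightarrow> 'a set \<Rightarrow> 'i set \<Rightarrow> ('i \<Rightarrow> 'a set) \<Rightarrow> bool" where
  "irredundant_primary_decomposition R I K Q \<longleftrightarrow>
     finite K \<and> (\<forall>k\<in>K. primary_ideal (Q k) R) \<and>
     I = carrier R \<inter> (\<Inter>k\<in>K. Q k) \<and>
     inj_on (\<lambda>k. radical R (Q k)) K \<and>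
     (\<forall>k\<in>K. carrier R \<inter> (\<Inter>l\<in>K - {k}. Q l) \<noteq> I)"


section \<open>Well-definedness of localizations\<close>

context primeideal
begin

lemma compl_mult_closed: "s \<in> carrier R - I \<Longrightarrow> t \<in> carrier R - I \<Longrightarrow> s \<otimes> t \<in> carrier R - I"
  using I_prime by auto

lemma one_compl: "\<one> \<in> carrier R - I"
  using I_notcarr one_imp_carrier by auto

lemma equiv_frac_rel: "equiv (carrier R \<times> (carrier R - I)) (frac_rel R I)"
proof (rule equivI)
  show "frac_rel R I \<subseteq> (carrier R \<times> (carrier R - I)) \<times> (carrier R \<times> (carrier R - I))"
    by (auto simp: frac_rel_def)
  show "refl_on (carrier R \<times> (carrier R - I)) (frac_rel R I)"
    using one_compl by (auto simp: refl_on_def frac_rel_def a_minus_def r_neg intro!: bexI[of _ \<one>])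
  show "sym (frac_rel R I)"
  proof (rule symI, clarsimp simp: frac_rel_def)
    fix a s b t u
    assume *: "a \<in> carrier R" "s \<in> carrier R" "b \<in> carrier R" "t \<in> carrier R"
      "u \<otimes> (a \<otimes> t \<ominus> b \<otimes> s) = \<zero>" "u \<in> carrier R" "u \<notin> I"
    have "u \<otimes> (b \<otimes> s \<ominus> a \<otimes> t) = \<ominus> (u \<otimes> (a \<otimes> t \<ominus> b \<otimes> s))"
      using *(1-4,6) by algebra
    with * show "\<exists>u\<in>carrier R - I. u \<otimes> (b \<otimes> s \<ominus> a \<otimes> t) = \<zero>" by auto
  qed
  show "trans (frac_rel R I)"
  proof (rule transI, clarsimp simp: frac_rel_def)
    fix a s b t c w u v
    assume *: "a \<in> carrier R" "s \<in> carrier R" "b \<in> carrier R" "t \<in> carrier R"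
      "c \<in> carrier R" "w \<in> carrier R" "u \<in> carrier R" "v \<in> carrier R"
      "t \<notin> I" "u \<notin> I" "v \<notin> I"
      and e: "u \<otimes> (a \<otimes> t \<ominus> b \<otimes> s) = \<zero>" "v \<otimes> (b \<otimes> w \<ominus> c \<otimes> t) = \<zero>"
    have "(u \<otimes> v \<otimes> t) \<otimes> (a \<otimes> w \<ominus> c \<otimes> s) =
      (v \<otimes> w) \<otimes> (u \<otimes> (a \<otimes> t \<ominus> b \<otimes> s)) \<oplus> (u \<otimes> s) \<otimes> (v \<otimes> (b \<otimes> w \<ominus> c \<otimes> t))"
      using *(1-8) by algebra
    moreover have "u \<otimes> v \<otimes> t \<in> carrier R - I" using * compl_mult_closed by auto
    ultimately show "\<exists>u\<in>carrier R - I. u \<otimes> (a \<otimes> w \<ominus> c \<otimes> s) = \<zero>"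
      using e * by (intro bexI[of _ "u \<otimes> v \<otimes> t"]) simp_all
  qed
qed

lemma frac_eq_iff:
  assumes "a \<in> carrier R" "s \<in> carrier R - I" "b \<in> carrier R" "t \<in> carrier R - I"
  shows "frac R I a s = frac R I b t \<longleftrightarrow> (\<exists>u\<in>carrier R - I. u \<otimes> (a \<otimes> t \<ominus> b \<otimes> s) = \<zero>)"
  unfolding frac_def using assms
  by (subst eq_equiv_class_iff[OF equiv_frac_rel]) (auto simp: frac_rel_def)

lemma frac_mult:
  assumes "a \<in> carrier R" "s \<in> carrier R - I" "b \<in> carrier R" "t \<in> carrier R - I"
  shows "frac R I a s \<otimes>\<^bsub>localization R I\<^esub> frac R I b t = frac R I (a \<otimes> b) (s \<otimes> t)"
proof -
  have "congruent2 (frac_rel R I) (frac_rel R I)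
     (\<lambda>(a, s) (b, t). frac R I (a \<otimes> b) (s \<otimes> t))"
  proof (rule congruent2I', clarsimp)
    fix a s a' s' b t b' t'
    assume "((a, s), (a', s')) \<in> frac_rel R I" "((b, t), (b', t')) \<in> frac_rel R I"
    then obtain u v where *: "a \<in> carrier R" "s \<in> carrier R - I" "a' \<in> carrier R" "s' \<in> carrier R - I"
      "b \<in> carrier R" "t \<in> carrier R - I" "b' \<in> carrier R" "t' \<in> carrier R - I" "u \<in> carrier R - I" "v \<in> carrier R - I"
      and e: "u \<otimes> (a \<otimes> s' \<ominus> a' \<otimes> s) = \<zero>" "v \<otimes> (b \<otimes> t' \<ominus> b' \<otimes> t) = \<zero>"
      unfolding frac_rel_def by blast
    have c: "a \<in> carrier R" "s \<in> carrier R" "a' \<in> carrier R" "s' \<in> carrier R"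
      "b \<in> carrier R" "t \<in> carrier R" "b' \<in> carrier R" "t' \<in> carrier R" "u \<in> carrier R" "v \<in> carrier R"
      using * by auto
    have "(u \<otimes> v) \<otimes> ((a \<otimes> b) \<otimes> (s' \<otimes> t') \<ominus> (a' \<otimes> b') \<otimes> (s \<otimes> t)) =
      (v \<otimes> b \<otimes> t') \<otimes> (u \<otimes> (a \<otimes> s' \<ominus> a' \<otimes> s)) \<oplus> (u \<otimes> a' \<otimes> s) \<otimes> (v \<otimes> (b \<otimes> t' \<ominus> b' \<otimes> t))"
      using c by algebra
    also have "\<dots> = \<zero>" using e c by simp
    finally show "frac R I (a \<otimes> b) (s \<otimes> t) = frac R I (a' \<otimes> b') (s' \<otimes> t')"
      using * c compl_mult_closed by (subst frac_eq_iff) (auto intro!: bexI[of _ "u \<otimes> v"])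
  qed
  from UN_equiv_class2[OF equiv_frac_rel equiv_frac_rel this, of "(a,s)" "(b,t)"] assms
  show ?thesis by (simp add: localization_def frac_def[of R I a s] frac_def[of R I b t] split_def)
qed

lemma frac_add:
  assumes "a \<in> carrier R" "s \<in> carrier R - I" "b \<in> carrier R" "t \<in> carrier R - I"
  shows "frac R I a s \<oplus>\<^bsub>localization R I\<^esub> frac R I b t = frac R I (a \<otimes> t \<oplus> b \<otimes> s) (s \<otimes> t)"
proof -
  have "congruent2 (frac_rel R I) (frac_rel R I)
     (\<lambda>(a, s) (b, t). frac R I (a \<otimes> t \<oplus> b \<otimes> s) (s \<otimes> t))"
  proof (rule congruent2I', clarsimp)
    fix a s a' s' b t b' t'
    assume "((a, s), (a', s')) \<in> frac_rel R I" "((b, t), (b', t')) \<in> frac_rel R I"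
    then obtain u v where *: "a \<in> carrier R" "s \<in> carrier R - I" "a' \<in> carrier R" "s' \<in> carrier R - I"
      "b \<in> carrier R" "t \<in> carrier R - I" "b' \<in> carrier R" "t' \<in> carrier R - I" "u \<in> carrier R - I" "v \<in> carrier R - I"
      and e: "u \<otimes> (a \<otimes> s' \<ominus> a' \<otimes> s) = \<zero>" "v \<otimes> (b \<otimes> t' \<ominus> b' \<otimes> t) = \<zero>"
      unfolding frac_rel_def by blast
    have c: "a \<in> carrier R" "s \<in> carrier R" "a' \<in> carrier R" "s' \<in> carrier R"
      "b \<in> carrier R" "t \<in> carrier R" "b' \<in> carrier R" "t' \<in> carrier R" "u \<in> carrier R" "v \<in> carrier R"
      using * by auto
    have "(u \<otimes> v) \<otimes> ((a \<otimes> t \<oplus> b \<otimes> s) \<otimes> (s' \<otimes> t') \<ominus> (a' \<otimes> t' \<oplus> b' \<otimes> s') \<otimes> (s \<otimes> t)) =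
      (v \<otimes> t \<otimes> t') \<otimes> (u \<otimes> (a \<otimes> s' \<ominus> a' \<otimes> s)) \<oplus> (u \<otimes> s \<otimes> s') \<otimes> (v \<otimes> (b \<otimes> t' \<ominus> b' \<otimes> t))"
      using c by algebra
    also have "\<dots> = \<zero>" using e c by simp
    finally show "frac R I (a \<otimes> t \<oplus> b \<otimes> s) (s \<otimes> t) = frac R I (a' \<otimes> t' \<oplus> b' \<otimes> s') (s' \<otimes> t')"
      using * c compl_mult_closed by (subst frac_eq_iff) (auto intro!: bexI[of _ "u \<otimes> v"])
  qed
  from UN_equiv_class2[OF equiv_frac_rel equiv_frac_rel this, of "(a,s)" "(b,t)"] assms
  show ?thesis by (simp add: localization_def frac_def[of R I a s] frac_def[of R I b t] split_def)
qed

lemma localization_cases: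
  assumes "p \<in> carrier (localization R I)"
  obtains a s where "a \<in> carrier R" "s \<in> carrier R - I" "p = frac R I a s"
  using assms unfolding localization_def frac_def by (auto elim!: quotientE)

lemma frac_closed: "a \<in> carrier R \<Longrightarrow> s \<in> carrier R - I \<Longrightarrow> frac R I a s \<in> carrier (localization R I)"
  unfolding localization_def frac_def by (auto intro!: quotientI)

end


section \<open>Well-definedness of jets\<close>

context
  fixes c :: "'k::field \<Rightarrow> 'b::comm_ring_1" and v :: "'x \<Rightarrow> 'b"
  assumes c0: "c 0 = 0" and c1: "c 1 = 1"
    and c_add: "\<And>a b. c (a + b) = c a + c b" and c_mult: "\<And>a b. c (a * b) = c a * c b"
begin

lemma mpoly_eval_superset:
  assumes "finite S" "Poly_Mapping.keys f \<subseteq> S"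
  shows "mpoly_eval c v f =
    (\<Sum>m\<in>S. c (Poly_Mapping.lookup f m) *
       (\<Prod>x\<in>Poly_Mapping.keys m. v x ^ Poly_Mapping.lookup m x))"
  unfolding mpoly_eval_def using assms
  by (intro sum.mono_neutral_left) (auto simp: c0 in_keys_iff)

lemma mpoly_eval_zero: "mpoly_eval c v 0 = 0"
  by (simp add: mpoly_eval_def)

lemma mpoly_eval_add: "mpoly_eval c v (f + g) = mpoly_eval c v f + mpoly_eval c v g"
proof -
  let ?S = "Poly_Mapping.keys f \<union> Poly_Mapping.keys g"
  have "finite ?S" by simp
  note eval = mpoly_eval_superset[OF this]
  have "Poly_Mapping.keys (f + g) \<subseteq> ?S" by (rule Poly_Mapping.keys_add)
  then show ?thesis
    by (simp add: eval lookup_add c_add distrib_right sum.distrib)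
qed

lemma mpoly_eval_monomial_mult:
  "(\<Prod>x\<in>Poly_Mapping.keys (m + n). v x ^ Poly_Mapping.lookup (m + n) x) =
   (\<Prod>x\<in>Poly_Mapping.keys m. v x ^ Poly_Mapping.lookup m x) *
   (\<Prod>x\<in>Poly_Mapping.keys n. v x ^ Poly_Mapping.lookup n x)"
proof -
  let ?S = "Poly_Mapping.keys m \<union> Poly_Mapping.keys n"
  have *: "(\<Prod>x\<in>Poly_Mapping.keys q. v x ^ Poly_Mapping.lookup q x) =
      (\<Prod>x\<in>?S. v x ^ Poly_Mapping.lookup q x)" if "Poly_Mapping.keys q \<subseteq> ?S" for q :: "'x \<Rightarrow>\<^sub>0 nat"
    using that by (intro prod.mono_neutral_left) (auto simp: in_keys_iff)
  show ?thesis
    unfolding *[OF Poly_Mapping.keys_add] *[of m, OF Un_upper1] *[of n, OF Un_upper2]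
    by (simp only: lookup_add power_add prod.distrib)
qed

lemma mpoly_eval_single:
  "mpoly_eval c v (Poly_Mapping.single m a) =
     c a * (\<Prod>x\<in>Poly_Mapping.keys m. v x ^ Poly_Mapping.lookup m x)"
  by (subst mpoly_eval_superset[of "{m}"]) auto

lemma mpoly_induct [case_names single add]:
  fixes f :: "('x, 'k) mpol"
  assumes single: "\<And>m a. P (Poly_Mapping.single m a)"
    and add: "\<And>f g. P f \<Longrightarrow> P g \<Longrightarrow> P (f + g)"
  shows "P f"
proof (induction f rule: update_induct)
  case const
  show ?case using single[of 0 0] by simp
next
  case (update f m a)
  have "Poly_Mapping.update m a f = f + Poly_Mapping.single m a"
    using update(1) by (intro poly_mapping_eqI)
      (auto simp: lookup_update lookup_add lookup_single when_def in_keys_iff)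
  then show ?case using update single add by simp
qed

lemma mpoly_eval_mult: "mpoly_eval c v (f * g) = mpoly_eval c v f * mpoly_eval c v g"
proof (induction f rule: mpoly_induct)
  case (single m a)
  show ?case
    by (induction g rule: mpoly_induct)
      (simp_all add: mult_single mpoly_eval_single mpoly_eval_monomial_mult c_mult
         mpoly_eval_add ring_distribs mult_ac)
next
  case (add f1 f2)
  then show ?case by (simp add: distrib_right mpoly_eval_add)
qed

end

lemma jet_hom_scalars:
  "[:mconst (0::'k::field):] = 0" "[:mconst (1::'k):] = 1"
  "[:mconst (a + b :: 'k):] = [:mconst a:] + [:mconst b:]"
  "[:mconst (a * b :: 'k):] = [:mconst a:] * [:mconst b:]"
  by (simp_all add: mconst_def single_add one_pCons mult_single mult.commute)

lemma jet_hom_zero: "jet_hom s 0 = 0"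
  unfolding jet_hom_def by (simp add: mpoly_eval_def)

lemma jet_hom_const: "jet_hom s (mconst a) = [:mconst a:]"
  unfolding jet_hom_def
  by (subst mconst_def, subst mpoly_eval_single) (simp_all only: jet_hom_scalars, simp)

lemma jet_hom_mvar: "jet_hom s (mvar x) = (\<Sum>j\<le>s. Polynomial.monom (mvar (x, j)) j)"
  unfolding jet_hom_def
  by (subst mvar_def, subst mpoly_eval_single) (simp_all only: jet_hom_scalars, simp)

lemma jet_hom_add: "jet_hom s (f + g) = jet_hom s f + jet_hom s g"
  unfolding jet_hom_def by (rule mpoly_eval_add) (rule jet_hom_scalars)+

lemma jet_hom_mult: "jet_hom s (f * g) = jet_hom s f * jet_hom s g"
  unfolding jet_hom_def by (rule mpoly_eval_mult) (rule jet_hom_scalars)+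

lemma jet_coeff_unique:
  "(\<forall>j\<le>s. g j = jet_coeff s f j) \<longleftrightarrow>
   [:0, 1:] ^ Suc s dvd jet_hom s f - (\<Sum>j\<le>s. Polynomial.monom (g j) j)"
proof -
  have "[:0, 1:] ^ Suc s dvd jet_hom s f - (\<Sum>j\<le>s. Polynomial.monom (g j) j) \<longleftrightarrow>
      (\<forall>i<Suc s. Polynomial.coeff (jet_hom s f - (\<Sum>j\<le>s. Polynomial.monom (g j) j)) i = 0)"
    by (subst monom_altdef[of 1, simplified, symmetric]) (rule monom_1_dvd_iff')
  also have "\<dots> \<longleftrightarrow> (\<forall>i\<le>s. g i = jet_coeff s f i)"
    by (auto simp: less_Suc_eq_le Polynomial.coeff_sum jet_coeff_def if_distrib sum.delta
        cong: if_cong)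
  finally show ?thesis by simp
qed


lemma keys_mult_mpoly:
  fixes f g :: "('x, 'k::field) mpol"
  assumes "\<forall>m\<in>Poly_Mapping.keys f. Poly_Mapping.keys m \<subseteq> X"
    and "\<forall>m\<in>Poly_Mapping.keys g. Poly_Mapping.keys m \<subseteq> X"
  shows "\<forall>m\<in>Poly_Mapping.keys (f * g). Poly_Mapping.keys m \<subseteq> X"
proof
  fix m assume "m \<in> Poly_Mapping.keys (f * g)"
  with Poly_Mapping.keys_mult[of f g] obtain a b where
    "m = a + b" "a \<in> Poly_Mapping.keys f" "b \<in> Poly_Mapping.keys g" by blast
  with assms Poly_Mapping.keys_add[of a b] show "Poly_Mapping.keys m \<subseteq> X" by blast
qed

lemma cring_mpoly_ring: "cring (mpoly_ring X :: ('x, 'k::field) mpol ring)"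
proof (rule cringI)
  show "abelian_group (mpoly_ring X :: ('x, 'k) mpol ring)"
  proof (rule abelian_groupI)
    fix f assume "f \<in> carrier (mpoly_ring X)"
    then show "\<exists>g\<in>carrier (mpoly_ring X). g \<oplus>\<^bsub>mpoly_ring X\<^esub> f = \<zero>\<^bsub>mpoly_ring X\<^esub>"
      by (intro bexI[of _ "- f"]) (auto simp: mpoly_ring_def in_keys_iff)
  qed (use Poly_Mapping.keys_add in \<open>fastforce simp: mpoly_ring_def add_ac\<close>)+
  show "comm_monoid (mpoly_ring X :: ('x, 'k) mpol ring)"
  proof (rule comm_monoidI)
    fix f g :: "('x, 'k) mpol"
    assume "f \<in> carrier (mpoly_ring X)" "g \<in> carrier (mpoly_ring X)"
    then show "f \<otimes>\<^bsub>mpoly_ring X\<^esub> g \<in> carrier (mpoly_ring X)"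
      using keys_mult_mpoly[of f X g] by (simp add: mpoly_ring_def)
  qed (auto simp: mpoly_ring_def mult_ac)
qed (auto simp: mpoly_ring_def ring_distribs)

lemma jet_coeff_mult:
  "jet_coeff s (f * g) j = (\<Sum>i\<le>j. jet_coeff s f i * jet_coeff s g (j - i))"
  by (simp add: jet_coeff_def jet_hom_mult Polynomial.coeff_mult)

lemma sum_mem_closed:
  assumes "0 \<in> A" "\<And>a b. a \<in> A \<Longrightarrow> b \<in> A \<Longrightarrow> a + b \<in> A" "\<And>i. i \<in> S \<Longrightarrow> f i \<in> A"
  shows "sum f S \<in> (A :: 'a::comm_monoid_add set)"
  using assms by (induction S rule: infinite_finite_induct) auto

lemma jet_coeff_closed:
  assumes "f \<in> carrier (mpoly_ring X)"
  shows "jet_coeff s f j \<in> carrier (mpoly_ring (jet_vars s X) :: ('x \<times> nat, 'k::field) mpol ring)"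
proof -
  let ?C = "carrier (mpoly_ring (jet_vars s X) :: ('x \<times> nat, 'k::field) mpol ring)"
  interpret cring "mpoly_ring (jet_vars s X) :: ('x \<times> nat, 'k::field) mpol ring"
    by (rule cring_mpoly_ring)
  let ?D = "{p. \<forall>i. Polynomial.coeff p i \<in> ?C}"
  have zero: "0 \<in> ?C" and one: "1 \<in> ?C"
    using zero_closed one_closed by (simp_all add: mpoly_ring_def)
  have add: "a + b \<in> ?C" and mult: "a * b \<in> ?C" if "a \<in> ?C" "b \<in> ?C" for a b
    using a_closed[OF that] m_closed[OF that] by (simp_all add: mpoly_ring_def)
  have D_one: "1 \<in> ?D"
    using zero one by (simp add: one_pCons coeff_pCons split: nat.split)
  have D_mult: "p * q \<in> ?D" if "p \<in> ?D" "q \<in> ?D" for p q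
    using that by (auto simp: Polynomial.coeff_mult intro!: sum_mem_closed zero add mult)
  have D_power: "p ^ n \<in> ?D" if "p \<in> ?D" for p n
    using D_mult[OF that] D_one by (induction n) (auto simp del: mem_Collect_eq)
  have D_prod: "prod g S \<in> ?D" if "\<And>i. i \<in> S \<Longrightarrow> g i \<in> ?D" for g and S :: "'x set"
    using that D_mult D_one by (induction S rule: infinite_finite_induct) (auto simp del: mem_Collect_eq)
  have D_sum: "sum g S \<in> ?D" if "\<And>i. i \<in> S \<Longrightarrow> g i \<in> ?D" for g and S :: "'z set"
    using that by (auto simp: Polynomial.coeff_sum intro!: sum_mem_closed zero add)
  have D_const: "[:mconst a:] \<in> ?D" for a
    using zero by (auto simp: coeff_pCons mconst_def mpoly_ring_def split: nat.split)
  have D_var: "(\<Sum>j\<le>s. Polynomial.monom (mvar (x, j)) j) \<in> ?D" if "x \<in> X" for x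
    using that zero
    by (auto simp: Polynomial.coeff_sum mvar_def mpoly_ring_def jet_vars_def intro!: sum_mem_closed add)
  have "jet_hom s f \<in> ?D"
    unfolding jet_hom_def mpoly_eval_def
    by (intro D_sum D_mult D_prod D_power D_const D_var) (use assms in \<open>auto simp: mpoly_ring_def\<close>)
  then show ?thesis by (simp add: jet_coeff_def)
qed

lemma jet_ideal_genideal:
  assumes F: "F \<subseteq> carrier (mpoly_ring X :: ('x, 'k::field) mpol ring)"
  shows "jet_ideal X s (Idl\<^bsub>mpoly_ring X\<^esub> F) = jet_ideal X s F"
proof -
  let ?R = "mpoly_ring X :: ('x, 'k) mpol ring"
  let ?S = "mpoly_ring (jet_vars s X) :: ('x \<times> nat, 'k) mpol ring"
  interpret R: cring ?R by (rule cring_mpoly_ring)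
  interpret S: cring ?S by (rule cring_mpoly_ring)
  let ?J = "jet_ideal X s F" and ?G = "\<lambda>F. {jet_coeff s f j | f j. f \<in> F \<and> j \<le> s}"
  have G_closed: "?G F \<subseteq> carrier ?S" if "F \<subseteq> carrier ?R" for F
    using that jet_coeff_closed by blast
  interpret J: ideal ?J ?S
    unfolding jet_ideal_def by (rule S.genideal_ideal[OF G_closed[OF F]])
  have J_zero: "0 \<in> ?J" and J_add: "\<And>a b. a \<in> ?J \<Longrightarrow> b \<in> ?J \<Longrightarrow> a + b \<in> ?J"
    and J_mult: "\<And>a b. a \<in> carrier ?S \<Longrightarrow> b \<in> ?J \<Longrightarrow> a * b \<in> ?J"
    using J.zero_closed J.a_closed J.I_l_closed by (auto simp: mpoly_ring_def)
  define K where "K = {f \<in> carrier ?R. \<forall>j\<le>s. jet_coeff s f j \<in> ?J}"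
  have K_mult: "g * f \<in> K" if "f \<in> K" "g \<in> carrier ?R" for f g
  proof -
    have "jet_coeff s (g * f) j \<in> ?J" if "j \<le> s" for j
      unfolding jet_coeff_mult using \<open>f \<in> K\<close> \<open>g \<in> carrier ?R\<close> that
      by (intro sum_mem_closed J_zero J_add J_mult jet_coeff_closed) (auto simp: K_def)
    moreover have "g * f \<in> carrier ?R"
      using R.m_closed[of g f] that by (simp add: K_def mpoly_ring_def)
    ultimately show ?thesis by (simp add: K_def)
  qed
  have minus: "\<ominus>\<^bsub>?R\<^esub> f = (- 1) * f" if "f \<in> carrier ?R" for f
    by (rule R.minus_equality)
      (use that in \<open>auto simp: mpoly_ring_def in_keys_iff\<close>)
  have "ideal K ?R"
  proof (rule idealI)
    show "ring ?R" by (rule R.ring_axioms)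
    show "subgroup K (add_monoid ?R)"
    proof
      show "K \<subseteq> carrier (add_monoid ?R)" by (auto simp: K_def)
      show "\<one>\<^bsub>add_monoid ?R\<^esub> \<in> K"
        using R.zero_closed by (simp add: K_def mpoly_ring_def jet_coeff_def jet_hom_zero J_zero)
      fix f g assume fg: "f \<in> K" "g \<in> K"
      then have "f + g \<in> carrier ?R" using R.a_closed[of f g] by (simp add: K_def mpoly_ring_def)
      then show "f \<otimes>\<^bsub>add_monoid ?R\<^esub> g \<in> K"
        using fg J_add by (auto simp: K_def jet_coeff_def jet_hom_add mpoly_ring_def)
    next
      fix f assume f: "f \<in> K"
      then have "f \<in> carrier ?R" by (simp add: K_def)
      moreover have "(- 1) \<in> carrier ?R" by (simp add: mpoly_ring_def)
      ultimately show "inv\<^bsub>add_monoid ?R\<^esub> f \<in> K"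
        using K_mult[OF f, of "- 1"] minus[of f] by (simp add: a_inv_def)
    qed
    show "g \<otimes>\<^bsub>?R\<^esub> f \<in> K" and "f \<otimes>\<^bsub>?R\<^esub> g \<in> K" if "f \<in> K" "g \<in> carrier ?R" for f g
      using K_mult[OF that] by (simp_all add: mpoly_ring_def mult.commute)
  qed
  moreover have "F \<subseteq> K"
    using F S.genideal_self[OF G_closed[OF F]] unfolding K_def jet_ideal_def by blast
  ultimately have "Idl\<^bsub>?R\<^esub> F \<subseteq> K" by (rule R.genideal_minimal)
  then have "?G (Idl\<^bsub>?R\<^esub> F) \<subseteq> ?J" by (auto simp: K_def)
  then have "jet_ideal X s (Idl\<^bsub>?R\<^esub> F) \<subseteq> ?J"
    unfolding jet_ideal_def[of X s "Idl\<^bsub>?R\<^esub> F"]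
    by (rule S.genideal_minimal[OF J.is_ideal])
  moreover have "?J \<subseteq> jet_ideal X s (Idl\<^bsub>?R\<^esub> F)"
    unfolding jet_ideal_def using R.genideal_self[OF F] R.genideal_ideal[OF F]
    by (intro S.subset_Idl_subset G_closed ideal.Icarr) (auto dest: ideal.Icarr)
  ultimately show ?thesis by blast
qed

end

theory Submission
  imports Defs
begin

text \<open>
  A prime that contains the edge ideal contains the ideal \<open>\<langle>W\<^sub>k\<rangle>\<close> of some minimal vertex cover, so the
  ideal of \<open>Z\<close> is the intersection of the \<open>\<langle>W\<^sub>k\<rangle>\<close>. The point is that a nonsingular prime \<open>P\<close> of \<open>Z\<close>
  contains only one of them. Modulo \<open>P\<^sup>2\<close> the ideal of \<open>Z\<close> is generated by the variables common to
  all covers in \<open>P\<close>, so regularity gives few generators of \<open>P\<close> locally, fewer than the height of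
  \<open>P\<close> if there are two covers. That the height is at most the number of generators is proved without
  Krull's theorem: for a set \<open>B\<close> of variables maximal with \<open>P \<inter> \<k>[B] = 0\<close>, a chain of primes
  below \<open>P\<close> has length at most \<open>card (X - B)\<close> by counting algebraically independent elements, and
  adjoining the variables outside \<open>B\<close> one by one gives \<open>card (X - B)\<close> elements of \<open>P\<close> that are
  independent modulo \<open>P\<^sup>2\<close>.

  If a jet \<open>Q\<close> lies over \<open>P\<close> and \<open>W\<^sub>k\<close> is the only cover in \<open>P\<close>, then some \<open>u\<close> outside \<open>P\<close> has
  \<open>u x\<close> in the ideal of \<open>Z\<close> for all \<open>x\<close> in \<open>W\<^sub>k\<close>, and the jets of \<open>u x\<close> show inductively that all
  \<open>x\<^sub>j\<close> lie in \<open>Q\<close>. Conversely \<open>\<langle>\<J>\<^sub>s(W\<^sub>k)\<rangle>\<close> is itself such a jet, as it lies over the generic point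
  \<open>\<langle>W\<^sub>k\<rangle>\<close>, where the local ring is a field.
\<close>

text \<open>Points of the spectrum are arbitrary primes over an arbitrary field, so residue fields
  may be inseparable and cotangent vectors are not counted with derivatives. Regularity enters
  through its definition, as an equality between a number of generators and the length of a chain of
  primes. It is played against the inequality between the length of a chain below \<open>P\<close>
  and the number of generators of \<open>P\<close> modulo its square. The set \<open>B\<close> is a
  transcendence basis modulo \<open>P\<close>, and \<open>card (X - B)\<close> separates the two
  sides: it is at least the length of every chain and at most the dimension of the cotangent space.
  Both estimates are made inside the polynomial ring. Elements outside \<open>P\<close> serve as
  denominators, and linear algebra over the residue field becomes elimination modulo
  \<open>P\<close> without division. The count succeeds because a product of two variables of
  \<open>P\<close> vanishes in the cotangent space: a monomial that meets two covers in
  \<open>P\<close> in different variables contributes no linear form there.\<close>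

section \<open>Ideals of subrings\<close>

text \<open>Rings are subsets of one type rather than carriers of records, so that the polynomial
  rings in different sets of variables compare by inclusion and a prime is restricted to fewer
  variables by intersection.\<close>

locale subring_in =
  fixes A :: "'a::comm_ring_1 set"
  assumes zero_in [simp]: "0 \<in> A" and one_in [simp]: "1 \<in> A"
    and add_in: "a \<in> A \<Longrightarrow> b \<in> A \<Longrightarrow> a + b \<in> A"
    and mult_in: "a \<in> A \<Longrightarrow> b \<in> A \<Longrightarrow> a * b \<in> A"
    and uminus_in: "a \<in> A \<Longrightarrow> - a \<in> A"
begin

lemma diff_in: "a \<in> A \<Longrightarrow> b \<in> A \<Longrightarrow> a - b \<in> A"
  using add_in[OF _ uminus_in, of a b] by simp

lemma power_in: "a \<in> A \<Longrightarrow> a ^ n \<in> A"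
  by (induction n) (auto intro: mult_in)

lemma sum_in: "(\<And>i. i \<in> I \<Longrightarrow> f i \<in> A) \<Longrightarrow> sum f I \<in> A"
  by (rule sum_mem_closed) (auto intro: add_in)

lemma prod_in: "(\<And>i. i \<in> I \<Longrightarrow> f i \<in> A) \<Longrightarrow> prod f I \<in> A"
  by (induction I rule: infinite_finite_induct) (auto intro: mult_in)

lemmas closed = add_in mult_in uminus_in diff_in power_in sum_in

end

locale ideal_in = subring_in A for A :: "'a::comm_ring_1 set" +
  fixes P :: "'a set"
  assumes sub: "P \<subseteq> A" and zero: "0 \<in> P"
    and add: "a \<in> P \<Longrightarrow> b \<in> P \<Longrightarrow> a + b \<in> P"
    and absorb: "a \<in> A \<Longrightarrow> b \<in> P \<Longrightarrow> a * b \<in> P"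
begin

lemma absorb2: "b \<in> A \<Longrightarrow> a \<in> P \<Longrightarrow> a * b \<in> P"
  using absorb[of b a] by (simp add: mult.commute)

lemma uminus: "a \<in> P \<Longrightarrow> - a \<in> P"
  using absorb[of "- 1" a] uminus_in[OF one_in] by simp

lemma diff: "a \<in> P \<Longrightarrow> b \<in> P \<Longrightarrow> a - b \<in> P"
  using add[OF _ uminus, of a b] by simp

lemma sum: "(\<And>i. i \<in> I \<Longrightarrow> f i \<in> P) \<Longrightarrow> sum f I \<in> P"
  by (rule sum_mem_closed) (auto intro: zero add)

lemma in_ring: "a \<in> P \<Longrightarrow> a \<in> A"
  using sub by blast

lemma prod:
  assumes "finite I" "i \<in> I" "f i \<in> P" "\<And>i. i \<in> I \<Longrightarrow> f i \<in> A"
  shows "prod f I \<in> P"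
  using assms by (subst prod.remove) (auto intro!: absorb2 prod_in)

end

locale prime_in = ideal_in +
  assumes one_notin: "1 \<notin> P"
    and prime: "a \<in> A \<Longrightarrow> b \<in> A \<Longrightarrow> a * b \<in> P \<Longrightarrow> a \<in> P \<or> b \<in> P"
begin

lemma power_notin: "a \<in> A \<Longrightarrow> a \<notin> P \<Longrightarrow> a ^ n \<notin> P"
  by (induction n) (use one_notin prime power_in in auto)

lemma prod_notin:
  "(\<And>i. i \<in> I \<Longrightarrow> f i \<in> A) \<Longrightarrow> (\<And>i. i \<in> I \<Longrightarrow> f i \<notin> P) \<Longrightarrow> prod f I \<notin> P"
proof (induction I rule: infinite_finite_induct)
  case (insert i I)
  then show ?case using prime[of "f i" "prod f I"] prod_in[of I f] by auto
qed (use one_notin in auto)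

text \<open>Gaussian elimination over the domain \<open>A / P\<close>: a homogeneous system with
  fewer equations than unknowns has a nonzero solution. Pivots are multiplied through, as they have
  no inverses in \<open>A\<close>.\<close>

lemma elimination:
  assumes "finite J" "finite I" "card J < card I" "\<And>i j. i \<in> I \<Longrightarrow> j \<in> J \<Longrightarrow> b i j \<in> A"
  shows "\<exists>a. (\<forall>i\<in>I. a i \<in> A) \<and> (\<exists>i\<in>I. a i \<notin> P) \<and> (\<forall>j\<in>J. (\<Sum>i\<in>I. a i * b i j) \<in> P)"
  using assms
proof (induction J arbitrary: I b rule: finite_induct)
  case empty
  then have "I \<noteq> {}" by auto
  then show ?case using one_notin by (intro exI[of _ "\<lambda>_. 1"]) auto
next
  case (insert j0 J)
  show ?case
  proof (cases "\<forall>i\<in>I. b i j0 \<in> P")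
    case True
    obtain a where "\<forall>i\<in>I. a i \<in> A" "\<exists>i\<in>I. a i \<notin> P" "\<forall>j\<in>J. (\<Sum>i\<in>I. a i * b i j) \<in> P"
      using insert.IH[of I b] insert.prems insert.hyps by auto
    then show ?thesis using True by (intro exI[of _ a]) (auto intro!: sum absorb)
  next
    case False
    then obtain i0 where i0: "i0 \<in> I" "b i0 j0 \<notin> P" by blast
    define I' where "I' = I - {i0}"
    \<comment> \<open>The unknown \<open>i0\<close> is eliminated with the equation
      \<open>j0\<close>, whose coefficient \<open>b i0 j0\<close> is nonzero modulo
      \<open>P\<close>, after multiplying by this pivot.\<close>
    define b' where "b' i j = b i0 j0 * b i j - b i j0 * b i0 j" for i j
    have "card J < card I'" "finite I'"
      using insert.prems insert.hyps i0 by (auto simp: I'_def)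
    moreover have "b' i j \<in> A" if "i \<in> I'" "j \<in> J" for i j
      unfolding b'_def using that i0 by (intro closed insert.prems) (auto simp: I'_def)
    ultimately obtain a where a: "\<forall>i\<in>I'. a i \<in> A" "\<exists>i\<in>I'. a i \<notin> P"
      "\<forall>j\<in>J. (\<Sum>i\<in>I'. a i * b' i j) \<in> P"
      using insert.IH[of I' b'] by blast
    \<comment> \<open>Back substitution: \<open>c i0\<close> makes equation \<open>j0\<close> hold
      exactly, and the common factor \<open>b i0 j0\<close>, being outside the prime
      \<open>P\<close>, preserves nontriviality.\<close>
    define c where "c i = (if i = i0 then - (\<Sum>i\<in>I'. a i * b i j0) else b i0 j0 * a i)" for i
    have c_sum: "(\<Sum>i\<in>I. c i * b i j) = (\<Sum>i\<in>I'. a i * b' i j)" for j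
    proof -
      have "(\<Sum>i\<in>I. c i * b i j) = c i0 * b i0 j + (\<Sum>i\<in>I'. c i * b i j)"
        unfolding I'_def using insert.prems i0 by (intro sum.remove) auto
      also have "(\<Sum>i\<in>I'. c i * b i j) = (\<Sum>i\<in>I'. b i0 j0 * a i * b i j)"
        by (intro sum.cong) (auto simp: c_def I'_def)
      also have "c i0 * b i0 j = - (\<Sum>i\<in>I'. a i * b i j0 * b i0 j)"
        by (simp add: c_def sum_distrib_right)
      finally show ?thesis
        by (simp add: b'_def sum_negf[symmetric] sum.distrib[symmetric] algebra_simps)
    qed
    have "(\<Sum>i\<in>I. c i * b i j) \<in> P" if "j \<in> insert j0 J" for j
    proof (cases "j = j0")
      case True
      then show ?thesis unfolding c_sum by (simp add: b'_def zero)
    next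
      case False
      then show ?thesis using that a(3) unfolding c_sum by auto
    qed
    moreover have "\<exists>i\<in>I. c i \<notin> P"
    proof -
      from a(2) obtain i where i: "i \<in> I'" "a i \<notin> P" by blast
      then have "b i0 j0 * a i \<notin> P"
        using prime[of "b i0 j0" "a i"] a(1) i0 insert.prems by auto
      then show ?thesis using i by (intro bexI[of _ i]) (auto simp: c_def I'_def)
    qed
    moreover have "\<forall>i\<in>I. c i \<in> A"
      unfolding c_def using a(1) i0 insert.prems
      by (auto simp: I'_def intro!: closed)
    ultimately show ?thesis by blast
  qed
qed

end

text \<open>The finite sums of products. The inductive form lets decompositions of elements of a
  square be built and lifted one product at a time.\<close>

inductive_set ideal_square :: "'a::comm_ring_1 set \<Rightarrow> 'a set" for P where
  zero: "0 \<in> ideal_square P"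
| step: "u \<in> P \<Longrightarrow> v \<in> P \<Longrightarrow> f \<in> ideal_square P \<Longrightarrow> u * v + f \<in> ideal_square P"

lemma mult_in_ideal_square: "u \<in> P \<Longrightarrow> v \<in> P \<Longrightarrow> u * v \<in> ideal_square P"
  using ideal_square.step[OF _ _ ideal_square.zero] by fastforce

context ideal_in
begin

lemma ideal_square_subset: "ideal_square P \<subseteq> P"
proof
  fix f assume "f \<in> ideal_square P"
  then show "f \<in> P" by induction (auto intro: zero add absorb in_ring)
qed

lemma ideal_in_ideal_square: "ideal_in A (ideal_square P)"
proof
  show "ideal_square P \<subseteq> A" using ideal_square_subset sub by blast
  show "a + b \<in> ideal_square P" if "a \<in> ideal_square P" "b \<in> ideal_square P" for a b
    using that by (induction a) (auto intro: ideal_square.intros simp: add.assoc)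
  show "a * b \<in> ideal_square P" if "a \<in> A" "b \<in> ideal_square P" for a b
    using that(2)
  proof induction
    case zero then show ?case by (simp add: ideal_square.zero)
  next
    case (step u v f)
    then have "(a * u) * v + a * f \<in> ideal_square P"
      using that(1) by (intro ideal_square.step absorb)
    then show ?case by (simp add: algebra_simps)
  qed
qed (rule ideal_square.zero)

end

section \<open>Polynomials in one variable over a subring\<close>

definition polys_over :: "'a::comm_ring_1 set \<Rightarrow> 'a poly set" where
  "polys_over A = {q. \<forall>i. Polynomial.coeff q i \<in> A}"

context subring_in
begin

lemma subring_in_polys_over: "subring_in (polys_over A)"
proof
  show "1 \<in> polys_over A"
    by (simp add: polys_over_def one_pCons coeff_pCons split: nat.split)
qed (auto simp: polys_over_def Polynomial.coeff_mult intro!: closed)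

lemma const_polys_over: "[:a:] \<in> polys_over A \<longleftrightarrow> a \<in> A"
  by (auto simp: polys_over_def coeff_pCons split: nat.split)

lemma monom_polys_over: "a \<in> A \<Longrightarrow> Polynomial.monom a n \<in> polys_over A"
  by (auto simp: polys_over_def)

end

context ideal_in
begin

lemma ideal_in_polys_over: "ideal_in (polys_over A) (polys_over P)"
proof -
  interpret p: subring_in "polys_over A" by (rule subring_in_polys_over)
  show ?thesis
  proof
    show "polys_over P \<subseteq> polys_over A" using sub by (auto simp: polys_over_def)
  qed (auto simp: polys_over_def Polynomial.coeff_mult zero intro!: add sum absorb)
qed

text \<open>The remainder \<open>r\<close> does not reach the top coefficient of
  \<open>s * h\<close>, so the top coefficient of \<open>s\<close> times that of \<open>h\<close>
  lies in \<open>P\<close>, and the degree of \<open>s\<close> can be lowered. This is also applied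
  to the square of a prime, modulo which a factor outside the prime cannot simply be cancelled;
  hence the power of the leading coefficient.\<close>

lemma cancel_leading_coeff:
  assumes h: "h \<in> polys_over A"
    and "s \<in> polys_over A" "r \<in> polys_over A" "degree r < degree h" "s * h + r \<in> polys_over P"
  shows "\<exists>N. Polynomial.smult (lead_coeff h ^ N) s \<in> polys_over P"
proof -
  interpret p: ideal_in "polys_over A" "polys_over P" by (rule ideal_in_polys_over)
  define l where "l = lead_coeff h"
  have l: "l \<in> A" using h by (auto simp: l_def polys_over_def)
  have smult_in: "Polynomial.smult a q \<in> polys_over P" if "a \<in> A" "q \<in> polys_over P" for a q
    using that absorb by (auto simp: polys_over_def)
  have smult_inA: "Polynomial.smult a q \<in> polys_over A" if "a \<in> A" "q \<in> polys_over A" for a q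
    using that by (auto simp: polys_over_def intro: mult_in)
  have "\<exists>N. Polynomial.smult (l ^ N) s \<in> polys_over P"
    if "\<forall>i\<ge>n. Polynomial.coeff s i = 0" "s \<in> polys_over A" "r \<in> polys_over A" "degree r < degree h"
      "s * h + r \<in> polys_over P" for n s r
    using that
  proof (induction n arbitrary: s r)
    case 0
    then have "s = 0" by (simp add: poly_eq_iff)
    then show ?case using p.zero by simp
  next
    case (Suc n)
    define c where "c = Polynomial.coeff s n"
    define s' where "s' = s - Polynomial.monom c n"
    have c: "c \<in> A" using Suc.prems by (auto simp: c_def polys_over_def)
    have s': "s' \<in> polys_over A"
      unfolding s'_def using c Suc.prems by (intro p.diff_in monom_polys_over) auto
    have s'_hi: "\<forall>i\<ge>n. Polynomial.coeff s' i = 0"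
      using Suc.prems(1) by (auto simp: s'_def c_def Suc_le_eq)
    have s_eq: "s = s' + Polynomial.monom c n" by (simp add: s'_def)
    have "Polynomial.coeff (s' * h) (n + degree h) = 0"
    proof (cases "s' = 0")
      case False
      then have "degree s' < n" using s'_hi by (meson leading_coeff_0_iff not_le)
      then show ?thesis using degree_mult_le[of s' h] by (intro coeff_eq_0) auto
    qed simp
    moreover have "Polynomial.coeff r (n + degree h) = 0"
      using Suc.prems(4) by (intro coeff_eq_0) auto
    ultimately have "Polynomial.coeff (s * h + r) (n + degree h) = c * l"
      by (simp add: s_eq distrib_right coeff_monom_mult l_def)
    then have cl: "c * l \<in> P" using Suc.prems(5) by (auto simp: polys_over_def) metis
    have mcl: "Polynomial.monom (c * l) n \<in> polys_over P"
      using cl zero by (auto simp: polys_over_def)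
    \<comment> \<open>After multiplication by \<open>l\<close> the top term of \<open>s\<close> has
      its coefficient in \<open>P\<close>, so its product with \<open>h\<close> can be
      subtracted.\<close>
    have "Polynomial.monom (c * l) n * h = Polynomial.smult l (Polynomial.monom c n * h)"
      by (metis mult.commute mult_smult_left smult_monom)
    then have "Polynomial.smult l s' * h + Polynomial.smult l r = Polynomial.smult l (s * h + r) - Polynomial.monom (c * l) n * h"
      by (simp add: s_eq distrib_right smult_add_right)
    also have "\<dots> \<in> polys_over P"
      using Suc.prems l mcl h by (intro p.diff smult_in p.absorb2) auto
    finally have *: "Polynomial.smult l s' * h + Polynomial.smult l r \<in> polys_over P" .
    have "\<exists>N. Polynomial.smult (l ^ N) (Polynomial.smult l s') \<in> polys_over P"
    proof (rule Suc.IH[OF _ _ _ _ *])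
      show "\<forall>i\<ge>n. Polynomial.coeff (Polynomial.smult l s') i = 0" using s'_hi by simp
      show "degree (Polynomial.smult l r) < degree h"
        using Suc.prems(4) degree_smult_le[of l r] by linarith
    qed (use l s' Suc.prems smult_inA in auto)
    then obtain N where N: "Polynomial.smult (l ^ N) (Polynomial.smult l s') \<in> polys_over P" by blast
    have "Polynomial.smult (l ^ Suc N) s = Polynomial.smult (l ^ N) (Polynomial.smult l s') + Polynomial.smult (l ^ N) (Polynomial.monom (c * l) n)"
      by (simp add: s_eq smult_add_right smult_monom mult_ac)
    also have "\<dots> \<in> polys_over P"
      using N smult_in[OF power_in[OF l] mcl] by (rule p.add)
    finally show ?case by blast
  qed
  from this[of "Suc (degree s)" s r] assms show ?thesis
    by (auto simp: l_def coeff_eq_0)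
qed

end

lemma (in subring_in) pseudo_division:
  assumes h: "h \<in> polys_over A" "0 < degree h" and f: "f \<in> polys_over A"
  shows "\<exists>N. \<exists>q\<in>polys_over A. \<exists>r\<in>polys_over A.
    Polynomial.smult (lead_coeff h ^ N) f = q * h + r \<and> degree r < degree h"
proof -
  interpret p: subring_in "polys_over A" by (rule subring_in_polys_over)
  define l where "l = lead_coeff h"
  define D where "D = degree h"
  have l: "l \<in> A" using h by (auto simp: l_def polys_over_def)
  have "\<exists>N. \<exists>q\<in>polys_over A. \<exists>r\<in>polys_over A. Polynomial.smult (l ^ N) f = q * h + r \<and> degree r < D"
    if "\<forall>i\<ge>n. Polynomial.coeff f i = 0" "f \<in> polys_over A" for n f
    using that
  proof (induction n arbitrary: f)
    case 0
    then have "f = 0" by (simp add: poly_eq_iff)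
    then show ?case using h(2) unfolding D_def
      by (intro exI[of _ 0] bexI[of _ 0]) auto
  next
    case (Suc n)
    show ?case
    proof (cases "n < D")
      case True
      then have "degree f < D"
        using Suc.prems(1) h(2) unfolding D_def by (cases "f = 0") (auto simp: not_less_eq_eq[symmetric] intro: le_less_trans dest: leading_coeff_0_iff[THEN iffD1, rotated])
      then show ?thesis using Suc.prems(2)
        by (intro exI[of _ 0] bexI[of _ 0] bexI[of _ f]) auto
    next
      case False
      define c where "c = Polynomial.coeff f n"
      \<comment> \<open>Each reduction costs one factor \<open>l\<close>, since the top coefficient
        of \<open>f\<close> need not be divisible by it.\<close>
      define f1 where "f1 = Polynomial.smult l f - Polynomial.monom c (n - D) * h"
      have c: "c \<in> A" using Suc.prems by (auto simp: c_def polys_over_def)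
      have lf: "Polynomial.smult l f \<in> polys_over A" using l Suc.prems by (auto simp: polys_over_def mult_in)
      have f1: "f1 \<in> polys_over A"
        unfolding f1_def using c lf h by (intro p.diff_in p.mult_in monom_polys_over) auto
      have "Polynomial.coeff f1 i = 0" if "i \<ge> n" for i
      proof (cases "i = n")
        case True
        then show ?thesis using False by (simp add: f1_def coeff_monom_mult c_def l_def D_def mult.commute[of "Polynomial.coeff f n"])
      next
        case i: False
        then have "Polynomial.coeff f i = 0" using Suc.prems(1) that by auto
        moreover have "Polynomial.coeff h (i - (n - D)) = 0"
          using i that False by (intro coeff_eq_0) (auto simp: D_def)
        ultimately show ?thesis by (simp add: f1_def coeff_monom_mult)
      qed
      then obtain N q r where qr: "q \<in> polys_over A" "r \<in> polys_over A"
        "Polynomial.smult (l ^ N) f1 = q * h + r" "degree r < D"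
        using Suc.IH[of f1] f1 by blast
      have "Polynomial.smult (l ^ Suc N) f = Polynomial.smult (l ^ N) f1 + Polynomial.smult (l ^ N) (Polynomial.monom c (n - D) * h)"
        by (simp add: f1_def smult_diff_right mult.commute)
      also have "\<dots> = (q + Polynomial.monom (l ^ N * c) (n - D)) * h + r"
        by (simp add: qr(3) distrib_right smult_monom flip: mult_smult_left)
      finally show ?thesis using qr(2,4)
        by (intro exI[of _ "Suc N"] bexI[OF _ p.add_in[OF qr(1) monom_polys_over]] bexI[of _ r])
          (auto intro: l c closed)
    qed
  qed
  from this[of "Suc (degree f)" f] f show ?thesis by (auto simp: l_def D_def coeff_eq_0)
qed

lemma smult_sum_right: "Polynomial.smult a (\<Sum>i\<in>I. f i) = (\<Sum>i\<in>I. Polynomial.smult a (f i))"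
  by (induction I rule: infinite_finite_induct) (auto simp: smult_add_right)

text \<open>The hypothesis \<open>indep\<close> says that the \<open>g i\<close> are linearly independent in the cotangent space
  \<open>p / p\<^sup>2\<close>. They stay so over the larger prime \<open>P\<close>, and if \<open>P\<close> is not generated by \<open>p\<close>, then an
  element \<open>h\<close> of \<open>P\<close> of smallest degree outside \<open>p[x]\<close> extends them: its leading coefficient is a
  unit locally at \<open>P\<close>, so that one can divide by \<open>h\<close>.\<close>
lemma exists_independent_extension:
  fixes A p :: "'a::comm_ring_1 set" and P :: "'a poly set" and g :: "'i \<Rightarrow> 'a"
  assumes "prime_in A p" "prime_in (polys_over A) P"
    and const: "\<And>a. a \<in> A \<Longrightarrow> [:a:] \<in> P \<longleftrightarrow> a \<in> p"
    and f0: "f0 \<in> P" "f0 \<notin> polys_over p"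
    and g: "\<And>i. i \<in> I \<Longrightarrow> g i \<in> p" and "finite I"
    and indep: "\<And>a. (\<And>i. i \<in> I \<Longrightarrow> a i \<in> A) \<Longrightarrow> (\<Sum>i\<in>I. a i * g i) \<in> ideal_square p \<Longrightarrow>
      \<forall>i\<in>I. a i \<in> p"
  obtains h where "h \<in> P"
    and "\<And>a b. (\<And>i. i \<in> I \<Longrightarrow> a i \<in> polys_over A) \<Longrightarrow> b \<in> polys_over A \<Longrightarrow>
      (\<Sum>i\<in>I. a i * [:g i:]) + b * h \<in> ideal_square P \<Longrightarrow> (\<forall>i\<in>I. a i \<in> P) \<and> b \<in> P"
proof -
  interpret p: prime_in A p by fact
  interpret P: prime_in "polys_over A" P by fact
  interpret p1: ideal_in "polys_over A" "polys_over p" by (rule p.ideal_in_polys_over)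
  interpret sp: ideal_in A "ideal_square p" by (rule p.ideal_in_ideal_square)
  interpret sp1: ideal_in "polys_over A" "polys_over (ideal_square p)" by (rule sp.ideal_in_polys_over)
  interpret sP: ideal_in "polys_over A" "ideal_square P" by (rule P.ideal_in_ideal_square)
  have p1_P: "polys_over p \<subseteq> P"
  proof
    fix f assume f: "f \<in> polys_over p"
    have "f = (\<Sum>i\<le>degree f. Polynomial.monom (Polynomial.coeff f i) i)"
      by (rule poly_as_sum_of_monoms[symmetric])
    also have "\<dots> = (\<Sum>i\<le>degree f. [:Polynomial.coeff f i:] * Polynomial.monom 1 i)"
      by (simp add: smult_monom)
    also have "\<dots> \<in> P"
      using f p.sub by (intro P.sum P.absorb2 p.monom_polys_over) (auto simp: const polys_over_def subset_iff)
    finally show "f \<in> P" .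
  qed
  define h where "h = arg_min degree (\<lambda>f. f \<in> P \<and> f \<notin> polys_over p)"
  have h: "h \<in> P" "h \<notin> polys_over p"
    and min: "\<And>f. f \<in> P \<Longrightarrow> f \<notin> polys_over p \<Longrightarrow> degree h \<le> degree f"
    using arg_min_nat_lemma[of "\<lambda>f. f \<in> P \<and> f \<notin> polys_over p" f0 degree] f0 by (auto simp: h_def)
  have hA: "h \<in> polys_over A" using h P.sub by blast
  define l where "l = lead_coeff h"
  have l: "l \<in> A" using hA by (auto simp: l_def polys_over_def)
  \<comment> \<open>Otherwise deleting the leading term of \<open>h\<close> would leave an element
    of \<open>P\<close> outside \<open>p[x]\<close> of smaller degree.\<close>
  have lp: "l \<notin> p"
  proof
    assume lp: "l \<in> p"
    define h' where "h' = h - Polynomial.monom l (degree h)"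
    have m: "Polynomial.monom l (degree h) \<in> polys_over p"
      using lp p.zero by (auto simp: polys_over_def)
    then have "h' \<in> P" unfolding h'_def using h p1_P by (intro P.diff) auto
    moreover have "h' \<notin> polys_over p"
      using p1.add[OF _ m, of h'] h by (auto simp: h'_def)
    ultimately have "degree h \<le> degree h'" and "h' \<noteq> 0" using min p1.zero by auto
    moreover have "Polynomial.coeff h' i = 0" if "i \<ge> degree h" for i
      using that by (cases "i = degree h") (auto simp: h'_def l_def coeff_eq_0)
    ultimately show False by (metis leading_coeff_0_iff)
  qed
  have deg: "0 < degree h"
  proof (rule ccontr)
    assume "\<not> 0 < degree h"
    then have "h = [:l:]" by (simp add: l_def degree_0_id)
    then show False using h(1) const l lp by simp
  qed
  \<comment> \<open>Powers of \<open>l\<close> stay outside \<open>P\<close> and act as units there.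
    Every later division by \<open>h\<close> is made up to such powers.\<close>
  have smult_P: "f \<in> P" if "Polynomial.smult (l ^ N) f \<in> P" "f \<in> polys_over A" for f N
  proof -
    have "[:l ^ N:] * f \<in> P" using that by simp
    moreover have "[:l ^ N:] \<notin> P" using const[of "l ^ N"] l lp p.power_notin p.power_in by auto
    ultimately show ?thesis
      using that P.prime[of "[:l ^ N:]" f] p.const_polys_over[of "l ^ N"] l p.power_in by auto
  qed
  have smult_in: "Polynomial.smult (l ^ N) f \<in> polys_over S" if "ideal_in A S" "f \<in> polys_over S" for N f S
    using that ideal_in.absorb[OF that(1)] p.power_in[OF l] by (auto simp: polys_over_def)
  have smult_inA: "Polynomial.smult (l ^ N) f \<in> polys_over A" if "f \<in> polys_over A" for N f
    using that p.power_in[OF l] by (auto simp: polys_over_def intro: p.mult_in)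
  have low: "r \<in> polys_over p" if "r \<in> P" "degree r < degree h" for r
    using min[OF that(1)] that(2) by force
  have decomp: "\<exists>N. \<exists>q\<in>polys_over A. \<exists>r\<in>polys_over p. Polynomial.smult (l ^ N) f = q * h + r"
    if "f \<in> P" for f
  proof -
    have fA: "f \<in> polys_over A" using that P.sub by blast
    obtain N q r where *: "q \<in> polys_over A" "r \<in> polys_over A"
      "Polynomial.smult (l ^ N) f = q * h + r" "degree r < degree h"
      using p.pseudo_division[OF hA deg fA] unfolding l_def by blast
    have "r = [:l ^ N:] * f - q * h" using *(3) by simp
    also have "\<dots> \<in> P"
      using that h *(1) l by (intro P.diff P.absorb) (auto simp: p.const_polys_over p.power_in)
    finally have "r \<in> polys_over p" using *(4) by (rule low)
    then show ?thesis using * by blast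
  qed
  \<comment> \<open>Up to powers of \<open>l\<close>, \<open>P\<close> is \<open>p[x] + (h)\<close>
    by \<open>decomp\<close>. Multiplying two such sums sorts an element of the square by powers of
    \<open>h\<close>.\<close>
  have square: "\<exists>N. \<exists>s\<in>polys_over (ideal_square p). \<exists>t\<in>polys_over p. \<exists>w\<in>polys_over A.
      Polynomial.smult (l ^ N) f = s + t * h + w * h * h" if "f \<in> ideal_square P" for f
    using that
  proof induction
    case zero
    show ?case using sp1.zero p1.zero
      by (intro exI[of _ 0] bexI[of _ 0]) auto
  next
    case (step u v f)
    obtain N1 q1 r1 where 1: "q1 \<in> polys_over A" "r1 \<in> polys_over p"
      "Polynomial.smult (l ^ N1) u = q1 * h + r1" using decomp[OF step(1)] by blast
    obtain N2 q2 r2 where 2: "q2 \<in> polys_over A" "r2 \<in> polys_over p"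
      "Polynomial.smult (l ^ N2) v = q2 * h + r2" using decomp[OF step(2)] by blast
    obtain N3 s t w where 3: "s \<in> polys_over (ideal_square p)" "t \<in> polys_over p" "w \<in> polys_over A"
      "Polynomial.smult (l ^ N3) f = s + t * h + w * h * h" using step.IH by blast
    have r12: "r1 * r2 \<in> polys_over (ideal_square p)"
      using 1(2) 2(2)
      by (auto simp: polys_over_def Polynomial.coeff_mult intro!: sp.sum mult_in_ideal_square)
    define L M where "L = [:l ^ N3:]" and "M = [:l ^ (N1 + N2):]"
    have LM: "L \<in> polys_over A" "M \<in> polys_over A"
      using l by (auto simp: L_def M_def p.const_polys_over intro: p.power_in)
    have "Polynomial.smult (l ^ (N1 + N2 + N3)) (u * v + f) =
      L * (Polynomial.smult (l ^ N1) u * Polynomial.smult (l ^ N2) v) + M * Polynomial.smult (l ^ N3) f"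
      by (simp add: L_def M_def power_add smult_add_right mult_ac)
    also have "\<dots> = (L * (r1 * r2) + M * s) + (L * (q1 * r2 + q2 * r1) + M * t) * h +
        (L * (q1 * q2) + M * w) * h * h"
      unfolding 1(3) 2(3) 3(4) by (simp add: algebra_simps)
    finally show ?case
      using LM r12 1 2 3
      by (intro exI[of _ "N1 + N2 + N3"] bexI[of _ "L * (r1 * r2) + M * s"]
          bexI[of _ "L * (q1 * r2 + q2 * r1) + M * t"] bexI[of _ "L * (q1 * q2) + M * w"])
        (auto intro!: sp1.add sp1.absorb p1.absorb P.add_in P.mult_in p1.add)
  qed
  show ?thesis
  proof (rule that[OF h(1)])
    fix a b
    assume a: "\<And>i. i \<in> I \<Longrightarrow> a i \<in> polys_over A" and b: "b \<in> polys_over A"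
      and ab: "(\<Sum>i\<in>I. a i * [:g i:]) + b * h \<in> ideal_square P"
    have gp: "[:g i:] \<in> polys_over p" if "i \<in> I" for i
      using g[OF that] p.zero by (auto simp: polys_over_def coeff_pCons split: nat.split)
    have gA: "[:g i:] \<in> polys_over A" if "i \<in> I" for i
      using gp[OF that] p1.sub by blast
    obtain N s t w where stw: "s \<in> polys_over (ideal_square p)" "t \<in> polys_over p" "w \<in> polys_over A"
      "Polynomial.smult (l ^ N) ((\<Sum>i\<in>I. a i * [:g i:]) + b * h) = s + t * h + w * h * h"
      using square[OF ab] by blast
    have sA: "s \<in> polys_over A" and s_p: "s \<in> polys_over p" and tA: "t \<in> polys_over A"
      using stw(1,2) sp1.sub p1.sub p.ideal_square_subset by (auto simp: polys_over_def)
    have stw': "(\<Sum>i\<in>I. Polynomial.smult (l ^ N) (a i) * [:g i:]) + Polynomial.smult (l ^ N) b * h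
      = s + t * h + w * h * h"
      using stw(4) by (simp add: smult_add_right smult_sum_right smult_smult mult_ac)
    have bP: "b \<in> P"
    proof -
      \<comment> \<open>Modulo \<open>p[x]\<close> the relation reads \<open>z * h = 0\<close>,
        since all \<open>g i\<close> lie in \<open>p\<close>; cancelling \<open>h\<close> puts
        \<open>z\<close> into \<open>p[x]\<close> up to a power of \<open>l\<close>.\<close>
      define z where "z = Polynomial.smult (l ^ N) b - w * h"
      have zA: "z \<in> polys_over A"
        unfolding z_def using b stw hA by (intro P.diff_in smult_inA P.mult_in)
      have "z * h + 0 = s + t * h - (\<Sum>i\<in>I. Polynomial.smult (l ^ N) (a i) * [:g i:])"
        using stw' by (simp add: z_def algebra_simps)
      also have "\<dots> \<in> polys_over p"
        using s_p stw(2) a gp hA by (intro p1.diff p1.add p1.absorb2 p1.sum p1.absorb smult_inA) auto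
      finally obtain N' where "Polynomial.smult (l ^ N') z \<in> polys_over p"
        using p.cancel_leading_coeff[OF hA zA P.zero_in] deg unfolding l_def by auto
      then have "z \<in> P" using smult_P zA p1_P by blast
      then have "z + w * h \<in> P" using h stw by (intro P.add P.absorb) auto
      then have "Polynomial.smult (l ^ N) b \<in> P" by (simp add: z_def)
      then show ?thesis by (rule smult_P) (rule b)
    qed
    have "\<forall>i\<in>I. \<exists>n q r. q \<in> polys_over A \<and> r \<in> polys_over A \<and>
        Polynomial.smult (l ^ n) (a i) = q * h + r \<and> degree r < degree h"
      using p.pseudo_division[OF hA deg a] unfolding l_def by blast
    then obtain n q r where qr: "\<And>i. i \<in> I \<Longrightarrow> q i \<in> polys_over A" "\<And>i. i \<in> I \<Longrightarrow> r i \<in> polys_over A"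
      "\<And>i. i \<in> I \<Longrightarrow> Polynomial.smult (l ^ n i) (a i) = q i * h + r i"
      "\<And>i. i \<in> I \<Longrightarrow> degree (r i) < degree h" by metis
    \<comment> \<open>A common exponent for the finitely many divisions of the \<open>a i\<close> by
      \<open>h\<close>.\<close>
    define M where "M = sum n I"
    define q' r' where "q' i = Polynomial.smult (l ^ (M - n i)) (q i)"
      and "r' i = Polynomial.smult (l ^ (M - n i)) (r i)" for i
    have q'A: "q' i \<in> polys_over A" and r'A: "r' i \<in> polys_over A"
      and r'_deg: "degree (r' i) < degree h" if "i \<in> I" for i
      using qr that smult_inA degree_smult_le[of "l ^ (M - n i)" "r i"]
      by (auto simp: q'_def r'_def intro: le_less_trans)
    have a_eq: "Polynomial.smult (l ^ M) (a i) = q' i * h + r' i" if "i \<in> I" for i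
    proof -
      have "n i \<le> M" using that \<open>finite I\<close> by (auto simp: M_def intro: member_le_sum)
      then have "l ^ M = l ^ (M - n i) * l ^ n i" by (simp flip: power_add)
      then have "Polynomial.smult (l ^ M) (a i) = Polynomial.smult (l ^ (M - n i)) (Polynomial.smult (l ^ n i) (a i))"
        by simp
      then show ?thesis by (simp add: qr(3)[OF that] q'_def r'_def smult_add_right)
    qed
    \<comment> \<open>Substituting the divisions sorts the relation into \<open>z * h + y\<close>,
      with \<open>y\<close> of degree less than \<open>h\<close> because the \<open>g i\<close> are
      constants. The sum has coefficients in the square of \<open>p\<close>, hence so have
      \<open>z\<close> and \<open>y\<close> up to powers of \<open>l\<close>.\<close>
    define z where "z = (\<Sum>i\<in>I. Polynomial.smult (l ^ N) (q' i) * [:g i:]) +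
      Polynomial.smult (l ^ (M + N)) b - Polynomial.smult (l ^ M) (t + w * h)"
    define y where "y = (\<Sum>i\<in>I. Polynomial.smult (l ^ N) (r' i) * [:g i:])"
    have zA: "z \<in> polys_over A"
      unfolding z_def using q'A gA b tA stw hA by (intro P.closed smult_inA) auto
    have yA: "y \<in> polys_over A"
      unfolding y_def using r'A gA by (intro P.closed smult_inA) auto
    have y_deg: "degree y < degree h"
    proof -
      have "degree (Polynomial.smult (l ^ N) (r' i) * [:g i:]) < degree h" if "i \<in> I" for i
      proof -
        have "degree (Polynomial.smult (l ^ N) (r' i) * [:g i:]) \<le> degree (r' i)"
          by (simp add: mult.commute[of _ "[:g i:]"]) (metis degree_smult_le order_trans smult_smult)
        then show ?thesis using r'_deg[OF that] by linarith
      qed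
      then show ?thesis unfolding y_def by (intro degree_sum_less) (use deg in auto)
    qed
    have "z * h + y = Polynomial.smult (l ^ M) s"
    proof -
      have "z * h + y = (\<Sum>i\<in>I. Polynomial.smult (l ^ N) (q' i * h + r' i) * [:g i:]) +
          Polynomial.smult (l ^ (M + N)) b * h - Polynomial.smult (l ^ M) (t + w * h) * h"
        by (simp add: z_def y_def algebra_simps sum_distrib_left sum.distrib smult_add_right
             del: mult_pCons_right)
      also have "(\<Sum>i\<in>I. Polynomial.smult (l ^ N) (q' i * h + r' i) * [:g i:]) =
          (\<Sum>i\<in>I. Polynomial.smult (l ^ N) (Polynomial.smult (l ^ M) (a i)) * [:g i:])"
        by (simp add: a_eq)
      also have "\<dots> + Polynomial.smult (l ^ (M + N)) b * h =
         Polynomial.smult (l ^ M) ((\<Sum>i\<in>I. Polynomial.smult (l ^ N) (a i) * [:g i:]) +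
           Polynomial.smult (l ^ N) b * h)"
        by (simp add: smult_add_right smult_sum_right power_add mult_ac)
      finally show ?thesis unfolding stw' by (simp add: algebra_simps smult_add_right)
    qed
    then have y_eq: "y = Polynomial.smult (l ^ M) s - z * h" by (simp add: algebra_simps)
    have "z * h + y \<in> polys_over (ideal_square p)"
      unfolding y_eq using smult_in[OF sp.ideal_in_axioms stw(1)] by simp
    then obtain K where K: "Polynomial.smult (l ^ K) z \<in> polys_over (ideal_square p)"
      using sp.cancel_leading_coeff[OF hA zA yA y_deg] unfolding l_def by blast
    have "Polynomial.smult (l ^ K) y =
        Polynomial.smult (l ^ (K + M)) s - Polynomial.smult (l ^ K) z * h"
      using y_eq by (simp add: power_add smult_diff_right)
    also have "\<dots> \<in> polys_over (ideal_square p)"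
      by (rule sp1.diff[OF smult_in[OF sp.ideal_in_axioms stw(1)] sp1.absorb2[OF hA K]])
    finally have y_sq: "Polynomial.smult (l ^ K) y \<in> polys_over (ideal_square p)" .
    \<comment> \<open>Each coefficient of \<open>y\<close> is a linear combination of the
      \<open>g i\<close>, so \<open>indep\<close> applies to one degree at a time.\<close>
    have r'p: "r' i \<in> polys_over p" if "i \<in> I" for i
    proof -
      have "Polynomial.coeff (r' i) j \<in> p" for j
      proof -
        have "Polynomial.coeff (Polynomial.smult (l ^ K) y) j =
           (\<Sum>i\<in>I. (l ^ (K + N) * Polynomial.coeff (r' i) j) * g i)"
          by (simp add: y_def Polynomial.coeff_sum sum_distrib_left power_add mult_ac)
        then have "(\<Sum>i\<in>I. (l ^ (K + N) * Polynomial.coeff (r' i) j) * g i) \<in> ideal_square p"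
          using y_sq by (auto simp: polys_over_def) metis
        then have "l ^ (K + N) * Polynomial.coeff (r' i) j \<in> p"
          using indep[of "\<lambda>i. l ^ (K + N) * Polynomial.coeff (r' i) j"] r'A p.mult_in p.power_in[OF l] that
          by (auto simp: polys_over_def)
        then show ?thesis
          using p.prime[of "l ^ (K + N)" "Polynomial.coeff (r' i) j"] p.power_in[OF l] r'A[OF that]
            p.power_notin[OF l lp] by (auto simp: polys_over_def)
      qed
      then show ?thesis by (simp add: polys_over_def)
    qed
    have "a i \<in> P" if "i \<in> I" for i
    proof (rule smult_P)
      show "Polynomial.smult (l ^ M) (a i) \<in> P"
        unfolding a_eq[OF that] using q'A r'p that h p1_P by (intro P.add P.absorb) auto
    qed (rule a[OF that])
    then show "(\<forall>i\<in>I. a i \<in> P) \<and> b \<in> P" using bP by blast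
  qed
qed

section \<open>Polynomial rings as subrings\<close>

definition mpolys :: "'x set \<Rightarrow> ('x, 'k::field) mpol set" where
  "mpolys X = {f. \<forall>m\<in>Poly_Mapping.keys f. Poly_Mapping.keys m \<subseteq> X}"

lemma mpoly_ring_simps [simp]:
  "carrier (mpoly_ring X) = mpolys X" "mult (mpoly_ring X) = (*)" "one (mpoly_ring X) = 1"
  "zero (mpoly_ring X) = 0" "add (mpoly_ring X) = (+)"
  by (simp_all add: mpoly_ring_def mpolys_def)

lemma subring_in_mpolys: "subring_in (mpolys X :: ('x, 'k::field) mpol set)"
proof
  fix f g :: "('x, 'k) mpol"
  assume "f \<in> mpolys X" "g \<in> mpolys X"
  then show "f + g \<in> mpolys X" "f * g \<in> mpolys X" "- f \<in> mpolys X"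
    using Poly_Mapping.keys_add[of f g] keys_mult_mpoly[of f X g]
    by (auto simp: mpolys_def in_keys_iff)
qed (auto simp: mpolys_def)

interpretation mpolys: subring_in "mpolys X" for X
  by (rule subring_in_mpolys)

lemma mpolys_mono: "X \<subseteq> Y \<Longrightarrow> mpolys X \<subseteq> mpolys Y"
  by (auto simp: mpolys_def)

lemma single_in_mpolys: "Poly_Mapping.keys m \<subseteq> X \<Longrightarrow> Poly_Mapping.single m a \<in> mpolys X"
  by (auto simp: mpolys_def split: if_splits)

lemma mconst_in_mpolys: "mconst a \<in> mpolys X"
  by (simp add: mconst_def single_in_mpolys)

lemma mvar_in_mpolys [simp]: "mvar x \<in> mpolys X \<longleftrightarrow> x \<in> X"
  by (auto simp: mpolys_def mvar_def)

lemma mvar_power: "mvar x ^ n = Poly_Mapping.single (Poly_Mapping.single x n) 1"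
  by (induction n) (simp_all add: mvar_def mult_single flip: single_add)

lemma a_inv_mpoly_ring:
  assumes "f \<in> mpolys X" shows "\<ominus>\<^bsub>mpoly_ring X\<^esub> f = - f"
proof -
  interpret cring "mpoly_ring X" by (rule cring_mpoly_ring)
  show ?thesis by (rule minus_equality) (use assms mpolys.uminus_in in auto)
qed

lemma ideal_mpoly_ring: "ideal I (mpoly_ring X) \<longleftrightarrow> ideal_in (mpolys X) I"
proof
  assume "ideal I (mpoly_ring X)"
  then interpret ideal I "mpoly_ring X" .
  show "ideal_in (mpolys X) I"
    using a_subset additive_subgroup.zero_closed[OF is_additive_subgroup]
      additive_subgroup.a_closed[OF is_additive_subgroup] I_l_closed by unfold_locales auto
next
  assume "ideal_in (mpolys X) I"
  then interpret ideal_in "mpolys X" I .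
  interpret R: cring "mpoly_ring X" by (rule cring_mpoly_ring)
  show "ideal I (mpoly_ring X)"
  proof (rule idealI)
    show "subgroup I (add_monoid (mpoly_ring X))"
    proof
      show "inv\<^bsub>add_monoid (mpoly_ring X)\<^esub> f \<in> I" if "f \<in> I" for f
        using uminus[OF that] a_inv_mpoly_ring[OF in_ring[OF that]] by (simp add: a_inv_def)
    qed (use sub zero add in auto)
  qed (auto intro: absorb absorb2 R.ring_axioms)
qed

lemma primeideal_mpoly_ring: "primeideal P (mpoly_ring X) \<longleftrightarrow> prime_in (mpolys X) P"
proof
  assume "primeideal P (mpoly_ring X)"
  then interpret primeideal P "mpoly_ring X" .
  interpret P: ideal_in "mpolys X" P using is_ideal by (simp add: ideal_mpoly_ring)
  show "prime_in (mpolys X) P"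
    using I_notcarr one_imp_carrier I_prime by unfold_locales auto
next
  assume "prime_in (mpolys X) P"
  then interpret prime_in "mpolys X" P .
  show "primeideal P (mpoly_ring X)"
  proof (rule primeidealI)
    show "ideal P (mpoly_ring X)" by (simp add: ideal_mpoly_ring ideal_in_axioms)
    show "carrier (mpoly_ring X) \<noteq> P" using one_notin by auto
  qed (use prime in \<open>auto intro: cring_mpoly_ring\<close>)
qed

lemma sum_monomials: "(\<Sum>m\<in>Poly_Mapping.keys f. Poly_Mapping.single m (Poly_Mapping.lookup f m)) = f"
  by (intro poly_mapping_eqI) (auto simp: lookup_sum lookup_single when_def in_keys_iff)

lemma mpolys_induct [consumes 1, case_names single zero add]:
  assumes "f \<in> mpolys X"
    and single: "\<And>m a. Poly_Mapping.keys m \<subseteq> X \<Longrightarrow> Q (Poly_Mapping.single m a)"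
    and zero: "Q 0" and add: "\<And>f g. Q f \<Longrightarrow> Q g \<Longrightarrow> Q (f + g)"
  shows "Q f"
proof -
  have "(\<Sum>m\<in>Poly_Mapping.keys f. Poly_Mapping.single m (Poly_Mapping.lookup f m)) \<in> Collect Q"
    by (rule sum_mem_closed) (use assms in \<open>auto simp: mpolys_def\<close>)
  then show ?thesis by (simp add: sum_monomials)
qed

lemma lookup_mult_sum:
  fixes f g :: "'m::comm_monoid_add \<Rightarrow>\<^sub>0 'k::comm_ring_1"
  shows "Poly_Mapping.lookup (f * g) k =
    (\<Sum>(m, n)\<in>Poly_Mapping.keys f \<times> Poly_Mapping.keys g.
      if m + n = k then Poly_Mapping.lookup f m * Poly_Mapping.lookup g n else 0)"
proof -
  have "f * g = (\<Sum>m\<in>Poly_Mapping.keys f. Poly_Mapping.single m (Poly_Mapping.lookup f m)) *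
      (\<Sum>n\<in>Poly_Mapping.keys g. Poly_Mapping.single n (Poly_Mapping.lookup g n))"
    by (simp add: sum_monomials)
  also have "\<dots> = (\<Sum>(m, n)\<in>Poly_Mapping.keys f \<times> Poly_Mapping.keys g.
      Poly_Mapping.single (m + n) (Poly_Mapping.lookup f m * Poly_Mapping.lookup g n))"
    by (simp add: sum_product sum.cartesian_product mult_single)
  finally show ?thesis
    by (simp add: lookup_sum lookup_single when_def split_def)
qed

lemma lookup_mconst_mult:
  "Poly_Mapping.lookup (mconst a * f) k = a * Poly_Mapping.lookup f k"
  by (cases "a = 0")
    (auto simp: mconst_def lookup_mult_sum sum.cartesian_product[symmetric] in_keys_iff
       if_distrib[of "\<lambda>x. _ * x"] cong: if_cong)

lemma lookup_mult_monomial: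
  fixes f :: "('x, 'k::field) mpol"
  shows "Poly_Mapping.lookup (f * Poly_Mapping.single n 1) (m + n) = Poly_Mapping.lookup f m"
proof -
  have "a + n = m + n \<longleftrightarrow> a = m" for a :: "'x \<Rightarrow>\<^sub>0 nat"
    by (auto simp: poly_mapping_eq_iff fun_eq_iff lookup_add)
  then show ?thesis
    by (simp add: lookup_mult_sum sum.cartesian_product[symmetric] in_keys_iff)
qed

section \<open>Ideals generated by variables\<close>

text \<open>Membership is decided monomial by monomial, which makes primality and intersections
  accessible. For \<open>W\<close> inside \<open>X\<close> this is the ideal generated by the
  variables in \<open>W\<close>, by \<open>genideal_mvar\<close>.\<close>

definition var_ideal :: "'x set \<Rightarrow> 'x set \<Rightarrow> ('x, 'k::field) mpol set" where
  "var_ideal X W = {f \<in> mpolys X. \<forall>m\<in>Poly_Mapping.keys f. Poly_Mapping.keys m \<inter> W \<noteq> {}}"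

lemma keys_add_nat: "Poly_Mapping.keys (m + n) = Poly_Mapping.keys m \<union> Poly_Mapping.keys (n :: 'x \<Rightarrow>\<^sub>0 nat)"
  by (auto simp: in_keys_iff lookup_add)

text \<open>A finite nonempty set of monomials has an extremal element for a lexicographic order. This
  replaces a monomial order, as the variables are not linearly ordered.\<close>
lemma exists_unique_sum:
  fixes M N :: "('x \<Rightarrow>\<^sub>0 nat) set"
  assumes "finite Y" "finite M" "finite N" "M \<noteq> {}" "N \<noteq> {}"
    and "\<And>m m' x. m \<in> M \<Longrightarrow> m' \<in> M \<Longrightarrow> x \<notin> Y \<Longrightarrow> Poly_Mapping.lookup m x = Poly_Mapping.lookup m' x"
    and "\<And>m m' x. m \<in> N \<Longrightarrow> m' \<in> N \<Longrightarrow> x \<notin> Y \<Longrightarrow> Poly_Mapping.lookup m x = Poly_Mapping.lookup m' x"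
  shows "\<exists>m\<in>M. \<exists>n\<in>N. \<forall>m'\<in>M. \<forall>n'\<in>N. m' + n' = m + n \<longrightarrow> m' = m \<and> n' = n"
  using assms
proof (induction Y arbitrary: M N rule: finite_induct)
  case empty
  have "m = m'" if "m \<in> M" "m' \<in> M" for m m'
    by (rule poly_mapping_eqI) (rule empty.prems(5)[OF that], simp)
  moreover have "m = m'" if "m \<in> N" "m' \<in> N" for m m'
    by (rule poly_mapping_eqI) (rule empty.prems(6)[OF that], simp)
  ultimately show ?case using empty.prems(3,4) by blast
next
  case (insert y Y)
  define top where "top M = {m \<in> M. Poly_Mapping.lookup m y = Max ((\<lambda>m. Poly_Mapping.lookup m y) ` M)}"
    for M :: "('x \<Rightarrow>\<^sub>0 nat) set"
  have le: "Poly_Mapping.lookup m' y \<le> Poly_Mapping.lookup m y" if "m \<in> top M" "m' \<in> M" "finite M" for m m' M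
    using that by (auto simp: top_def)
  have mem: "m' \<in> top M" if "m \<in> top M" "m' \<in> M" "Poly_Mapping.lookup m' y = Poly_Mapping.lookup m y" for m m' M
    using that by (auto simp: top_def)
  have ne: "top M \<noteq> {}" if "finite M" "M \<noteq> {}" for M
    using that Max_in[of "(\<lambda>m. Poly_Mapping.lookup m y) ` M"] by (auto simp: top_def image_iff)
  have "\<exists>m\<in>top M. \<exists>n\<in>top N. \<forall>m'\<in>top M. \<forall>n'\<in>top N. m' + n' = m + n \<longrightarrow> m' = m \<and> n' = n"
  proof (rule insert.IH)
    show "Poly_Mapping.lookup m x = Poly_Mapping.lookup m' x" if "m \<in> top M" "m' \<in> top M" "x \<notin> Y" for m m' x
      using that insert.prems(5)[of m m' x] by (cases "x = y") (auto simp: top_def)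
    show "Poly_Mapping.lookup m x = Poly_Mapping.lookup m' x" if "m \<in> top N" "m' \<in> top N" "x \<notin> Y" for m m' x
      using that insert.prems(6)[of m m' x] by (cases "x = y") (auto simp: top_def)
  qed (use insert.prems ne in \<open>auto simp: top_def\<close>)
  then obtain m n where mn: "m \<in> top M" "n \<in> top N"
    "\<And>m' n'. m' \<in> top M \<Longrightarrow> n' \<in> top N \<Longrightarrow> m' + n' = m + n \<Longrightarrow> m' = m \<and> n' = n" by blast
  have "m' = m \<and> n' = n" if "m' \<in> M" "n' \<in> N" "m' + n' = m + n" for m' n'
  proof -
    \<comment> \<open>Neither exponent exceeds its maximum, so equal sums force both to be maximal,
      and the uniqueness inside \<open>top M\<close> and \<open>top N\<close> applies.\<close>
    have "Poly_Mapping.lookup m' y + Poly_Mapping.lookup n' y = Poly_Mapping.lookup m y + Poly_Mapping.lookup n y"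
      using that(3) by (metis lookup_add)
    then have "Poly_Mapping.lookup m' y = Poly_Mapping.lookup m y" "Poly_Mapping.lookup n' y = Poly_Mapping.lookup n y"
      using le[OF mn(1) that(1)] le[OF mn(2) that(2)] insert.prems by auto
    then show ?thesis using mn mem that by blast
  qed
  moreover have "m \<in> M" "n \<in> N" using mn by (auto simp: top_def)
  ultimately show ?case by blast
qed

lemma ideal_in_var_ideal: "ideal_in (mpolys X) (var_ideal X W :: ('x, 'k::field) mpol set)"
proof
  fix f g :: "('x, 'k) mpol"
  show "f + g \<in> var_ideal X W" if "f \<in> var_ideal X W" "g \<in> var_ideal X W"
    using that Poly_Mapping.keys_add[of f g] mpolys.add_in[of f X g] by (auto simp: var_ideal_def)
  show "f * g \<in> var_ideal X W" if "f \<in> mpolys X" "g \<in> var_ideal X W"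
  proof -
    have "Poly_Mapping.keys m \<inter> W \<noteq> {}" if "m \<in> Poly_Mapping.keys (f * g)" for m
      using that Poly_Mapping.keys_mult[of f g] \<open>g \<in> var_ideal X W\<close>
      by (fastforce simp: var_ideal_def keys_add_nat)
    then show ?thesis using that mpolys.mult_in[of f X g] by (auto simp: var_ideal_def)
  qed
qed (auto simp: var_ideal_def)

text \<open>Among the monomials of \<open>f\<close> and of \<open>g\<close> that avoid
  \<open>W\<close> there is a pair whose product arises in only one way. Its coefficient in
  \<open>f * g\<close> is a product of two nonzero scalars, and the monomial avoids
  \<open>W\<close>.\<close>

lemma prime_in_var_ideal: "prime_in (mpolys X) (var_ideal X W :: ('x, 'k::field) mpol set)"
proof -
  interpret ideal_in "mpolys X" "var_ideal X W :: ('x, 'k::field) mpol set"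
    by (rule ideal_in_var_ideal)
  show ?thesis
  proof
    show "1 \<notin> (var_ideal X W :: ('x, 'k) mpol set)" by (simp add: var_ideal_def)
    fix f g :: "('x, 'k) mpol"
    assume fg: "f \<in> mpolys X" "g \<in> mpolys X" "f * g \<in> var_ideal X W"
    show "f \<in> var_ideal X W \<or> g \<in> var_ideal X W"
    proof (rule ccontr)
      assume not: "\<not> (f \<in> var_ideal X W \<or> g \<in> var_ideal X W)"
      define M where "M f = {m \<in> Poly_Mapping.keys f. Poly_Mapping.keys m \<inter> W = {}}" for f :: "('x, 'k) mpol"
      define Y where "Y = \<Union> (Poly_Mapping.keys ` (Poly_Mapping.keys f \<union> Poly_Mapping.keys g))"
      have "\<exists>m\<in>M f. \<exists>n\<in>M g. \<forall>m'\<in>M f. \<forall>n'\<in>M g. m' + n' = m + n \<longrightarrow> m' = m \<and> n' = n"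
      proof (rule exists_unique_sum[of Y])
        show "M f \<noteq> {}" "M g \<noteq> {}" using not fg by (auto simp: M_def var_ideal_def)
        show "Poly_Mapping.lookup m x = Poly_Mapping.lookup m' x" if "m \<in> M f" "m' \<in> M f" "x \<notin> Y" for m m' x
          using that by (auto simp: M_def Y_def in_keys_iff)
        show "Poly_Mapping.lookup m x = Poly_Mapping.lookup m' x" if "m \<in> M g" "m' \<in> M g" "x \<notin> Y" for m m' x
          using that by (auto simp: M_def Y_def in_keys_iff)
      qed (auto simp: M_def Y_def)
      then obtain m n where mn: "m \<in> M f" "n \<in> M g"
        "\<And>m' n'. m' \<in> M f \<Longrightarrow> n' \<in> M g \<Longrightarrow> m' + n' = m + n \<Longrightarrow> m' = m \<and> n' = n" by blast
      have keys_mn: "Poly_Mapping.keys (m + n) \<inter> W = {}"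
        using mn(1,2) by (auto simp: M_def keys_add_nat)
      \<comment> \<open>Exponents are natural numbers, so the factors of a monomial avoiding
        \<open>W\<close> avoid \<open>W\<close> too. Uniqueness thus extends from \<open>M f\<close>
        and \<open>M g\<close> to all monomials of \<open>f\<close> and \<open>g\<close>.\<close>
      have uniq: "m' = m \<and> n' = n"
        if "m' \<in> Poly_Mapping.keys f" "n' \<in> Poly_Mapping.keys g" "m' + n' = m + n" for m' n'
      proof -
        have "Poly_Mapping.keys m' \<inter> W = {}" "Poly_Mapping.keys n' \<inter> W = {}"
          using keys_mn unfolding that(3)[symmetric] by (auto simp: keys_add_nat)
        then show ?thesis using mn(3) that by (auto simp: M_def)
      qed
      have "Poly_Mapping.lookup (f * g) (m + n) =
         (\<Sum>(m', n')\<in>Poly_Mapping.keys f \<times> Poly_Mapping.keys g.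
           if m' + n' = m + n then Poly_Mapping.lookup f m' * Poly_Mapping.lookup g n' else 0)"
        by (rule lookup_mult_sum)
      also have "\<dots> = (\<Sum>(m', n')\<in>Poly_Mapping.keys f \<times> Poly_Mapping.keys g.
           if (m', n') = (m, n) then Poly_Mapping.lookup f m * Poly_Mapping.lookup g n else 0)"
        by (intro sum.cong refl) (use uniq in auto)
      also have "\<dots> = Poly_Mapping.lookup f m * Poly_Mapping.lookup g n"
        using mn(1,2) by (subst sum.remove[of _ "(m, n)"]) (auto simp: M_def intro!: sum.neutral)
      finally have "m + n \<in> Poly_Mapping.keys (f * g)"
        using mn(1,2) by (simp add: M_def in_keys_iff)
      then show False using fg(3) keys_mn by (auto simp: var_ideal_def)
    qed
  qed
qed

lemma single_eq_mult_mvar: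
  assumes "x \<in> Poly_Mapping.keys m"
  shows "Poly_Mapping.single m a = Poly_Mapping.single (m - Poly_Mapping.single x (1::nat)) a * mvar x"
proof -
  have "m = (m - Poly_Mapping.single x 1) + Poly_Mapping.single x 1"
    using assms by (intro poly_mapping_eqI) (auto simp: lookup_add lookup_minus lookup_single when_def in_keys_iff)
  then show ?thesis by (simp add: mvar_def mult_single)
qed

lemma mvar_in_var_ideal: "mvar x \<in> var_ideal X W \<longleftrightarrow> x \<in> X \<and> x \<in> W"
  by (auto simp: var_ideal_def) (auto simp: mvar_def)

lemma genideal_mvar:
  assumes "W \<subseteq> X"
  shows "Idl\<^bsub>mpoly_ring X\<^esub> (mvar ` W) = (var_ideal X W :: ('x, 'k::field) mpol set)"
proof -
  let ?R = "mpoly_ring X :: ('x, 'k) mpol ring"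
  interpret R: cring ?R by (rule cring_mpoly_ring)
  have W: "mvar ` W \<subseteq> carrier ?R" using assms by auto
  interpret I: ideal_in "mpolys X" "Idl\<^bsub>?R\<^esub> (mvar ` W)"
    using R.genideal_ideal[OF W] by (simp add: ideal_mpoly_ring)
  show ?thesis
  proof
    show "Idl\<^bsub>?R\<^esub> (mvar ` W) \<subseteq> var_ideal X W"
      by (rule R.genideal_minimal)
        (use assms in \<open>auto simp: ideal_mpoly_ring ideal_in_var_ideal mvar_in_var_ideal\<close>)
    show "var_ideal X W \<subseteq> Idl\<^bsub>?R\<^esub> (mvar ` W)"
    proof
      fix f :: "('x, 'k) mpol" assume f: "f \<in> var_ideal X W"
      have "Poly_Mapping.single m a \<in> Idl\<^bsub>?R\<^esub> (mvar ` W)" if "m \<in> Poly_Mapping.keys f" for m a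
      proof -
        have m: "Poly_Mapping.keys m \<subseteq> X" and "Poly_Mapping.keys m \<inter> W \<noteq> {}"
          using f that by (auto simp: var_ideal_def mpolys_def)
        then obtain x where x: "x \<in> Poly_Mapping.keys m" "x \<in> W" by blast
        have "Poly_Mapping.single (m - Poly_Mapping.single x 1) a \<in> mpolys X"
          using m by (intro single_in_mpolys) (auto simp: in_keys_iff lookup_minus)
        then show ?thesis unfolding single_eq_mult_mvar[OF x(1)]
          using R.genideal_self[OF W] x(2) by (intro I.absorb) auto
      qed
      then have "(\<Sum>m\<in>Poly_Mapping.keys f. Poly_Mapping.single m (Poly_Mapping.lookup f m)) \<in> Idl\<^bsub>?R\<^esub> (mvar ` W)"
        by (rule I.sum)
      then show "f \<in> Idl\<^bsub>?R\<^esub> (mvar ` W)" by (simp add: sum_monomials)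
    qed
  qed
qed

section \<open>Substitution\<close>

lemma (in subring_in) mpoly_eval_in:
  assumes "f \<in> mpolys X" "\<And>a. c a \<in> A" "\<And>x. x \<in> X \<Longrightarrow> v x \<in> A"
  shows "mpoly_eval c v f \<in> A"
  unfolding mpoly_eval_def
  by (intro sum_in mult_in prod_in power_in) (use assms in \<open>auto simp: mpolys_def\<close>)

lemma (in ideal_in) mpoly_eval_in_ideal:
  assumes "f \<in> mpolys X" "\<And>a. c a \<in> A" "\<And>x. x \<in> X \<Longrightarrow> v x \<in> A"
    and "\<And>m. m \<in> Poly_Mapping.keys f \<Longrightarrow> \<exists>x\<in>Poly_Mapping.keys m. v x \<in> P"
  shows "mpoly_eval c v f \<in> P"
  unfolding mpoly_eval_def
proof (intro sum absorb)
  fix m assume m: "m \<in> Poly_Mapping.keys f"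
  then obtain x where x: "x \<in> Poly_Mapping.keys m" "v x \<in> P" using assms(4) by blast
  then have "v x ^ Poly_Mapping.lookup m x \<in> P"
    using absorb2[of "v x ^ (Poly_Mapping.lookup m x - 1)" "v x"] power_in[OF in_ring]
    by (cases "Poly_Mapping.lookup m x") (auto simp: in_keys_iff)
  then show "(\<Prod>x\<in>Poly_Mapping.keys m. v x ^ Poly_Mapping.lookup m x) \<in> P"
    using x m assms by (intro prod) (auto simp: mpolys_def intro!: power_in)
qed (use assms in auto)

abbreviation subst :: "('x \<Rightarrow> ('z, 'k::field) mpol) \<Rightarrow> ('x, 'k) mpol \<Rightarrow> ('z, 'k) mpol" where
  "subst \<equiv> mpoly_eval mconst"

lemma mconst_hom:
  "mconst (0::'k::field) = 0" "mconst (1::'k) = 1"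
  "mconst (a + b :: 'k) = mconst a + mconst b" "mconst (a * b :: 'k) = mconst a * mconst b"
  by (simp_all add: mconst_def single_add mult_single)

lemma subst_zero: "subst v 0 = 0"
  by (rule mpoly_eval_zero[OF mconst_hom])

lemma subst_add: "subst v (f + g) = subst v f + subst v g"
  by (rule mpoly_eval_add[OF mconst_hom])

lemma subst_mult: "subst v (f * g) = subst v f * subst v g"
  by (rule mpoly_eval_mult[OF mconst_hom])

lemma subst_single:
  "subst v (Poly_Mapping.single m a) =
     mconst a * (\<Prod>x\<in>Poly_Mapping.keys m. v x ^ Poly_Mapping.lookup m x)"
  by (rule mpoly_eval_single[OF mconst_hom])

lemma subst_mconst: "subst v (mconst a) = mconst a"
  by (subst mconst_def, subst subst_single) simp

lemma subst_one: "subst v 1 = 1"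
  using subst_mconst[of v 1] by (simp add: mconst_hom)

lemma subst_mvar: "subst v (mvar x) = v x"
  unfolding mvar_def by (simp add: subst_single mconst_hom)

lemma subst_power: "subst v (f ^ n) = subst v f ^ n"
  by (induction n) (simp_all add: subst_one subst_mult)

lemma subst_prod: "subst v (prod f I) = (\<Prod>i\<in>I. subst v (f i))"
  by (induction I rule: infinite_finite_induct) (simp_all add: subst_one subst_mult)

lemma subst_sum: "subst v (sum f I) = (\<Sum>i\<in>I. subst v (f i))"
  by (induction I rule: infinite_finite_induct) (simp_all add: subst_zero subst_add)

lemma prod_mvar_keys:
  assumes "finite S"
  shows "(\<Prod>x\<in>S. mvar x ^ g x) = Poly_Mapping.single (\<Sum>x\<in>S. Poly_Mapping.single x (g x)) 1"
  using assms by induction (simp_all add: mvar_power mult_single)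

lemma subst_subst_id:
  assumes "f \<in> mpolys X" "\<And>x. x \<in> X \<Longrightarrow> subst w (v x) = mvar x"
  shows "subst w (subst v f) = f"
  using assms(1)
proof (induction rule: mpolys_induct)
  case (single m a)
  have "subst w (subst v (Poly_Mapping.single m a)) =
      mconst a * (\<Prod>x\<in>Poly_Mapping.keys m. mvar x ^ Poly_Mapping.lookup m x)"
    using single assms(2)
    by (auto simp: subst_single subst_mult subst_prod subst_power subst_mconst intro!: arg_cong[of _ _ "(*) _"] prod.cong)
  also have "\<dots> = Poly_Mapping.single m a"
    by (simp add: prod_mvar_keys sum_monomials mconst_def mult_single)
  finally show ?case .
qed (simp_all add: subst_zero subst_add)

section \<open>Splitting off one variable\<close>

lemma (in subring_in) poly_in: "q \<in> polys_over A \<Longrightarrow> x \<in> A \<Longrightarrow> poly q x \<in> A"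
  by (auto simp: poly_altdef polys_over_def intro!: closed)

text \<open>For \<open>y\<close> outside \<open>Y\<close>, this and \<open>poly_mvar_inj\<close>
  identify the polynomials in \<open>insert y Y\<close> with polynomials in one variable over
  \<open>mpolys Y\<close>, which makes one-variable arguments available for a new variable.\<close>

lemma exists_poly_mvar:
  assumes "f \<in> mpolys (insert y Y)"
  obtains q where "q \<in> polys_over (mpolys Y)" "poly q (mvar y) = f"
proof -
  interpret p: subring_in "polys_over (mpolys Y)" by (rule mpolys.subring_in_polys_over)
  from assms have "\<exists>q. q \<in> polys_over (mpolys Y) \<and> poly q (mvar y) = f"
  proof (induction rule: mpolys_induct)
    case (single m a)
    define m' where "m' = m - Poly_Mapping.single y (Poly_Mapping.lookup m y)"
    have "m = m' + Poly_Mapping.single y (Poly_Mapping.lookup m y)"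
      by (intro poly_mapping_eqI) (auto simp: m'_def lookup_add lookup_minus lookup_single when_def)
    then have "poly (Polynomial.monom (Poly_Mapping.single m' a) (Poly_Mapping.lookup m y)) (mvar y) =
        Poly_Mapping.single m a"
      by (simp add: poly_monom mvar_power mult_single)
    moreover have "Poly_Mapping.keys m' \<subseteq> Y"
      using single by (auto simp: m'_def in_keys_iff lookup_minus lookup_single when_def subset_iff split: if_splits)
    ultimately show ?case by (metis mpolys.monom_polys_over single_in_mpolys)
  qed (use p.zero_in p.add_in poly_0 poly_add in metis)+
  then show ?thesis using that by blast
qed

lemma lookup_poly_mvar:
  assumes q: "q \<in> polys_over (mpolys Y)" and "y \<notin> Y" "Poly_Mapping.keys m \<subseteq> Y"
  shows "Poly_Mapping.lookup (poly q (mvar y)) (m + Poly_Mapping.single y j) =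
    Poly_Mapping.lookup (Polynomial.coeff q j) m"
proof -
  have *: "Poly_Mapping.lookup (Polynomial.coeff q i * mvar y ^ i) (m + Poly_Mapping.single y j) =
      (if i = j then Poly_Mapping.lookup (Polynomial.coeff q j) m else 0)" for i
  proof (cases "i = j")
    case True
    then show ?thesis by (simp add: mvar_power lookup_mult_monomial)
  next
    case False
    have "m + Poly_Mapping.single y j \<notin> Poly_Mapping.keys (Polynomial.coeff q i * mvar y ^ i)"
    proof
      assume "m + Poly_Mapping.single y j \<in> Poly_Mapping.keys (Polynomial.coeff q i * mvar y ^ i)"
      then obtain m' where m': "m' \<in> Poly_Mapping.keys (Polynomial.coeff q i)"
        "m + Poly_Mapping.single y j = m' + Poly_Mapping.single y i"
        using Poly_Mapping.keys_mult[of "Polynomial.coeff q i" "mvar y ^ i"]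
        by (auto simp: mvar_power split: if_splits)
      have "Poly_Mapping.keys m' \<subseteq> Y" using m' q by (auto simp: polys_over_def mpolys_def)
      then have "Poly_Mapping.lookup m' y = 0" "Poly_Mapping.lookup m y = 0"
        using assms by (auto simp: in_keys_iff)
      moreover have "Poly_Mapping.lookup m y + j = Poly_Mapping.lookup m' y + i"
        using m'(2) by (metis lookup_add lookup_single_eq)
      ultimately show False using False by simp
    qed
    then show ?thesis using False by (simp add: in_keys_iff)
  qed
  show ?thesis
    by (auto simp: poly_altdef lookup_sum * coeff_eq_0)
qed

lemma poly_mvar_inj:
  assumes q: "q \<in> polys_over (mpolys Y)" "q' \<in> polys_over (mpolys Y)" and y: "y \<notin> Y"
    and eq: "poly q (mvar y) = poly q' (mvar y)"
  shows "q = q'"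
proof (rule poly_eqI, rule poly_mapping_eqI)
  fix j m
  show "Poly_Mapping.lookup (Polynomial.coeff q j) m = Poly_Mapping.lookup (Polynomial.coeff q' j) m"
  proof (cases "Poly_Mapping.keys m \<subseteq> Y")
    case True
    then show ?thesis
      using lookup_poly_mvar[OF q(1) y True, of j] lookup_poly_mvar[OF q(2) y True, of j] eq by simp
  next
    case False
    then have "m \<notin> Poly_Mapping.keys (Polynomial.coeff q j)" "m \<notin> Poly_Mapping.keys (Polynomial.coeff q' j)"
      using q unfolding polys_over_def mpolys_def by blast+
    then show ?thesis by (simp add: in_keys_iff)
  qed
qed

text \<open>Meant for algebraic relations: the power of \<open>y\<close> is cancelled modulo a prime
  that does not contain the value of \<open>y\<close>, and the nonzero part \<open>g\<close> free of
  \<open>y\<close> then gives a relation with one element fewer.\<close>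

lemma split_lowest_power:
  assumes "f \<in> mpolys (insert y Y)" "f \<noteq> 0" "y \<notin> Y"
  obtains n g h where "g \<in> mpolys Y" "g \<noteq> 0" "h \<in> mpolys (insert y Y)"
    "f = mvar y ^ n * (g + mvar y * h)"
proof -
  obtain q where q: "q \<in> polys_over (mpolys Y)" "poly q (mvar y) = f"
    using exists_poly_mvar[OF assms(1)] by blast
  have "q \<noteq> 0" using q assms by auto
  define n where "n = (LEAST i. Polynomial.coeff q i \<noteq> 0)"
  have n: "Polynomial.coeff q n \<noteq> 0" unfolding n_def
    using \<open>q \<noteq> 0\<close> by (metis (mono_tags) LeastI leading_coeff_0_iff)
  have lt: "Polynomial.coeff q i = 0" if "i < n" for i
    using not_less_Least[of i "\<lambda>i. Polynomial.coeff q i \<noteq> 0"] that by (auto simp: n_def)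
  define q' where "q' = poly_shift (Suc n) q"
  have "q = Polynomial.monom 1 n * pCons (Polynomial.coeff q n) q'"
    using lt by (intro poly_eqI)
      (auto simp: coeff_monom_mult q'_def coeff_poly_shift coeff_pCons Suc_diff_Suc split: nat.splits)
  then have "poly q (mvar y) = poly (Polynomial.monom 1 n * pCons (Polynomial.coeff q n) q') (mvar y)"
    by simp
  then have "f = mvar y ^ n * (Polynomial.coeff q n + mvar y * poly q' (mvar y))"
    by (simp add: q poly_monom algebra_simps)
  moreover have "q' \<in> polys_over (mpolys (insert y Y))"
    using q(1) mpolys_mono[of Y "insert y Y"] by (auto simp: polys_over_def q'_def coeff_poly_shift)
  then have "poly q' (mvar y) \<in> mpolys (insert y Y)"
    by (intro mpolys.poly_in) auto
  moreover have "Polynomial.coeff q n \<in> mpolys Y" using q by (auto simp: polys_over_def)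
  ultimately show ?thesis using that n by blast
qed

section \<open>Algebraic dependence\<close>

text \<open>Exponents are bounded one by one, not in total, so that monomials are counted by boxes
  whose sizes are plain powers.\<close>

definition exponents_le :: "nat \<Rightarrow> ('x, 'k::field) mpol set" where
  "exponents_le K = {f. \<forall>m\<in>Poly_Mapping.keys f. \<forall>x. Poly_Mapping.lookup m x \<le> K}"

lemma exponents_le_mono: "f \<in> exponents_le K \<Longrightarrow> K \<le> L \<Longrightarrow> f \<in> exponents_le L"
  by (auto simp: exponents_le_def intro: order_trans)

lemma exponents_le_mult:
  assumes "f \<in> exponents_le K" "g \<in> exponents_le L"
  shows "f * g \<in> exponents_le (K + L)"
proof -
  have "Poly_Mapping.lookup m x \<le> K + L" if "m \<in> Poly_Mapping.keys (f * g)" for m x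
  proof -
    from that obtain a b where ab: "m = a + b" "a \<in> Poly_Mapping.keys f" "b \<in> Poly_Mapping.keys g"
      using Poly_Mapping.keys_mult[of f g] by blast
    then show ?thesis using assms by (auto simp: lookup_add exponents_le_def intro!: add_mono)
  qed
  then show ?thesis by (simp add: exponents_le_def)
qed

lemma exponents_le_one: "1 \<in> exponents_le K"
  by (simp add: exponents_le_def)

lemma exponents_le_power: "f \<in> exponents_le K \<Longrightarrow> f ^ n \<in> exponents_le (n * K)"
  by (induction n) (auto intro: exponents_le_one exponents_le_mult)

lemma exponents_le_prod:
  assumes "\<And>i. i \<in> I \<Longrightarrow> f i \<in> exponents_le K"
  shows "prod f I \<in> exponents_le (card I * K)"
  using assms
proof (induction I rule: infinite_finite_induct)
  case (insert i I)
  then show ?case using exponents_le_mult[of "f i" K "prod f I" "card I * K"] by simp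
qed (auto intro: exponents_le_one)

lemma exists_exponents_le:
  fixes v :: "'z \<Rightarrow> ('x, 'k::field) mpol"
  assumes "finite V"
  obtains K where "\<And>z. z \<in> V \<Longrightarrow> v z \<in> exponents_le K"
proof -
  define S where "S = (\<Union>z\<in>V. \<Union>m\<in>Poly_Mapping.keys (v z). Poly_Mapping.range m)"
  have "finite S" using assms by (auto simp: S_def)
  have "Poly_Mapping.lookup m x \<le> Max (insert 0 S)" if "z \<in> V" "m \<in> Poly_Mapping.keys (v z)" for z m x
  proof (cases "x \<in> Poly_Mapping.keys m")
    case True
    then have "Poly_Mapping.lookup m x \<in> S"
      using that in_keys_lookup_in_range[OF True] unfolding S_def by blast
    then show ?thesis using \<open>finite S\<close> by simp
  qed (simp add: in_keys_iff)
  then show ?thesis by (intro that[of "Max (insert 0 S)"]) (auto simp: exponents_le_def)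
qed

text \<open>A dimension count: the monomials in \<open>V\<close> with exponents at most
  \<open>D\<close> outnumber the monomials in \<open>X\<close> that can occur in their values, so
  the values are linearly dependent over the field.\<close>

lemma exists_algebraic_relation:
  fixes v :: "'z \<Rightarrow> ('x, 'k::field) mpol"
  assumes "finite V" "finite X" "card X < card V" and v: "\<And>z. z \<in> V \<Longrightarrow> v z \<in> mpolys X"
  shows "\<exists>F\<in>mpolys V. F \<noteq> 0 \<and> subst v F = 0"
proof -
  obtain e where e: "\<And>z. z \<in> V \<Longrightarrow> v z \<in> exponents_le e"
    using exists_exponents_le[OF assms(1), of v] by blast
  \<comment> \<open>With this \<open>D\<close>, \<open>(q * (D + 1)) ^ card X\<close> equals
    \<open>D * (D + 1) ^ card X\<close>, which is below \<open>(D + 1) ^ card V\<close>. The bound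
    \<open>K\<close> on the exponents in the values satisfies
    \<open>K + 1 \<le> q * (D + 1)\<close>.\<close>
  define q where "q = card V * e + 1"
  define D where "D = q ^ card X"
  define K where "K = card V * (D * e)"
  define I where "I = PiE V (\<lambda>_. {..D})"
  define S where "S = {m :: 'x \<Rightarrow>\<^sub>0 nat. Poly_Mapping.keys m \<subseteq> X \<and> (\<forall>x. Poly_Mapping.lookup m x \<le> K)}"
  define mon where "mon \<alpha> = (\<Sum>z\<in>V. Poly_Mapping.single z (\<alpha> z :: nat))" for \<alpha>
  have fin: "finite I" unfolding I_def using assms by (intro finite_PiE) auto
  have card_I: "card I = (D + 1) ^ card V"
    unfolding I_def using assms by (simp add: card_PiE)
  define r where "r m = restrict (Poly_Mapping.lookup m) X" for m :: "'x \<Rightarrow>\<^sub>0 nat"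
  have "inj_on r S"
  proof (rule inj_onI, rule poly_mapping_eqI)
    fix m n x assume *: "m \<in> S" "n \<in> S" "r m = r n"
    show "Poly_Mapping.lookup m x = Poly_Mapping.lookup n x"
    proof (cases "x \<in> X")
      case True
      then show ?thesis using fun_cong[OF *(3), of x] by (simp add: r_def)
    next
      case False
      then have "x \<notin> Poly_Mapping.keys m" "x \<notin> Poly_Mapping.keys n" using * by (auto simp: S_def)
      then show ?thesis by (simp add: in_keys_iff)
    qed
  qed
  moreover have "r ` S \<subseteq> PiE X (\<lambda>_. {..K})" by (auto simp: r_def S_def)
  moreover have "finite (PiE X (\<lambda>_. {..K}))" using assms by (intro finite_PiE) auto
  ultimately have fin_S: "finite S" and card_S: "card S \<le> (K + 1) ^ card X"
    using finite_imageD[of r S] finite_subset card_inj_on_le[of r S "PiE X (\<lambda>_. {..K})"] assms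
    by (auto simp: card_PiE)
  have "K + 1 \<le> q * (D + 1)"
    by (simp add: K_def q_def algebra_simps)
  then have "card S \<le> (q * (D + 1)) ^ card X"
    using card_S power_mono by (meson le0 order_trans)
  also have "\<dots> = D * (D + 1) ^ card X" by (simp only: power_mult_distrib) (simp only: D_def)
  also have "\<dots> < (D + 1) ^ Suc (card X)" by simp
  also have "\<dots> \<le> card I" unfolding card_I using assms(3) by (intro power_increasing) auto
  finally have less: "card S < card I" .
  \<comment> \<open>Elimination modulo the zero ideal of the field is ordinary linear algebra. The
    equations are the coefficients at the monomials in \<open>S\<close>.\<close>
  interpret k: prime_in "UNIV :: 'k set" "{0}" by unfold_locales auto
  define w where "w \<alpha> = (\<Prod>z\<in>V. v z ^ \<alpha> z)" for \<alpha>
  obtain a where a: "\<exists>\<alpha>\<in>I. a \<alpha> \<noteq> 0"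
    "\<And>m. m \<in> S \<Longrightarrow> (\<Sum>\<alpha>\<in>I. a \<alpha> * Poly_Mapping.lookup (w \<alpha>) m) = 0"
    using k.elimination[OF fin_S fin less, of "\<lambda>\<alpha> m. Poly_Mapping.lookup (w \<alpha>) m"] by auto
  have lookup_mon: "Poly_Mapping.lookup (mon \<alpha>) z = (if z \<in> V then \<alpha> z else 0)" for \<alpha> z
    using assms(1) by (auto simp: mon_def lookup_sum lookup_single when_def)
  have inj: "inj_on mon I"
  proof (rule inj_onI)
    fix \<alpha> \<beta> assume *: "\<alpha> \<in> I" "\<beta> \<in> I" "mon \<alpha> = mon \<beta>"
    have "\<alpha> z = \<beta> z" if "z \<in> V" for z
      using lookup_mon[of \<alpha> z] lookup_mon[of \<beta> z] *(3) that by simp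
    then show "\<alpha> = \<beta>" using * unfolding I_def by (intro PiE_ext)
  qed
  have keys_mon: "Poly_Mapping.keys (mon \<alpha>) \<subseteq> V" for \<alpha>
    by (auto simp: in_keys_iff lookup_mon split: if_splits)
  define F where "F = (\<Sum>\<alpha>\<in>I. Poly_Mapping.single (mon \<alpha>) (a \<alpha>))"
  have "F \<in> mpolys V"
    unfolding F_def by (intro mpolys.sum_in single_in_mpolys keys_mon)
  moreover have "F \<noteq> 0"
  proof -
    obtain \<alpha> where \<alpha>: "\<alpha> \<in> I" "a \<alpha> \<noteq> 0" using a(1) by blast
    have "Poly_Mapping.lookup F (mon \<alpha>) = (\<Sum>\<beta>\<in>I. if \<beta> = \<alpha> then a \<beta> else 0)"
      unfolding F_def lookup_sum
      by (intro sum.cong) (use inj \<alpha> in \<open>auto simp: lookup_single when_def inj_on_def\<close>)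
    then show ?thesis using \<alpha> fin by auto
  qed
  moreover have "subst v F = 0"
  proof (rule poly_mapping_eqI)
    fix m
    have single: "subst v (Poly_Mapping.single (mon \<alpha>) (a \<alpha>)) = mconst (a \<alpha>) * w \<alpha>" for \<alpha>
    proof -
      have "(\<Prod>x\<in>Poly_Mapping.keys (mon \<alpha>). v x ^ Poly_Mapping.lookup (mon \<alpha>) x) =
          (\<Prod>x\<in>V. v x ^ Poly_Mapping.lookup (mon \<alpha>) x)"
        using assms(1) keys_mon by (intro prod.mono_neutral_left) (auto simp: in_keys_iff)
      then show ?thesis by (simp add: subst_single w_def lookup_mon)
    qed
    have lookup: "Poly_Mapping.lookup (subst v F) m = (\<Sum>\<alpha>\<in>I. a \<alpha> * Poly_Mapping.lookup (w \<alpha>) m)"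
      by (simp add: F_def subst_sum single lookup_sum lookup_mconst_mult)
    \<comment> \<open>No equation is lost by restricting to \<open>S\<close>: every monomial of a
      value \<open>w \<alpha>\<close> lies there.\<close>
    have "Poly_Mapping.lookup (w \<alpha>) m = 0" if "m \<notin> S" "\<alpha> \<in> I" for \<alpha>
    proof -
      have "v z ^ \<alpha> z \<in> exponents_le (D * e)" if "z \<in> V" for z
        using exponents_le_power[OF e[OF that], of "\<alpha> z"] \<open>\<alpha> \<in> I\<close> that
        by (auto simp: I_def PiE_def Pi_def intro: exponents_le_mono)
      then have "w \<alpha> \<in> exponents_le K"
        unfolding w_def K_def by (intro exponents_le_prod)
      moreover have "w \<alpha> \<in> mpolys X"
        unfolding w_def using v by (intro mpolys.prod_in mpolys.power_in)
      ultimately have "Poly_Mapping.keys (w \<alpha>) \<subseteq> S"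
        by (auto simp: exponents_le_def mpolys_def S_def)
      then show ?thesis using that by (auto simp: in_keys_iff)
    qed
    then show "Poly_Mapping.lookup (subst v F) m = Poly_Mapping.lookup 0 m"
      unfolding lookup using a(2) by (cases "m \<in> S") auto
  qed
  ultimately show ?thesis by blast
qed

section \<open>Chains of primes\<close>

text \<open>Elements \<open>y\<^sub>i\<close> of \<open>c (i + 1) - c i\<close> together with variables independent modulo \<open>c N\<close> are
  algebraically independent: a relation of lowest order in \<open>y\<^sub>0\<close> modulo \<open>c 0\<close> yields one between
  the remaining elements modulo \<open>c 1\<close>, and so on.\<close>
lemma prime_chain_length:
  fixes c :: "nat \<Rightarrow> ('x, 'k::field) mpol set"
  assumes "finite X" "B \<subseteq> X"
    and prime: "\<And>i. i \<le> N \<Longrightarrow> prime_in (mpolys X) (c i)"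
    and chain: "\<And>i. i < N \<Longrightarrow> c i \<subset> c (Suc i)"
    and indep: "c N \<inter> mpolys B = {0}"
  shows "N + card B \<le> card X"
proof (rule ccontr)
  assume less: "\<not> N + card B \<le> card X"
  have "\<forall>i. \<exists>z. i < N \<longrightarrow> z \<in> c (Suc i) \<and> z \<notin> c i" using chain by blast
  then obtain y where y: "\<And>i. i < N \<Longrightarrow> y i \<in> c (Suc i)" "\<And>i. i < N \<Longrightarrow> y i \<notin> c i" by metis
  \<comment> \<open>\<open>Inl\<close> indexes the variables in \<open>B\<close> and
    \<open>Inr\<close> the elements \<open>y i\<close>. The set \<open>V j\<close> keeps those
    \<open>y i\<close> that are still in play modulo \<open>c j\<close>.\<close>
  define v :: "'x + nat \<Rightarrow> ('x, 'k) mpol" where "v = case_sum mvar y"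
  define V where "V j = Inl ` B \<union> Inr ` {j..<N}" for j :: nat
  have finite_B: "finite B" using assms finite_subset by blast
  have yX: "y i \<in> mpolys X" if "i < N" for i
    using y(1)[OF that] prime[of "Suc i"] that prime_in.axioms(1) ideal_in.in_ring by (metis Suc_leI)
  have v_in: "v z \<in> mpolys X" if "z \<in> V j" for z j
    using that assms(2) yX by (auto simp: V_def v_def)
  \<comment> \<open>Downward induction from \<open>N\<close>, where only the variables in
    \<open>B\<close> remain. At \<open>j = 0\<close> the claim contradicts
    \<open>exists_algebraic_relation\<close>.\<close>
  have claim: "\<forall>F\<in>mpolys (V j). F \<noteq> 0 \<longrightarrow> subst v F \<notin> c j" if "j \<le> N" for j
    using that
  proof (induction j rule: inc_induct)
    case base
    show ?case
    proof (intro ballI impI notI)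
      fix F assume F: "F \<in> mpolys (V N)" "F \<noteq> 0" "subst v F \<in> c N"
      have "subst v F \<in> mpolys B"
        by (rule mpolys.mpoly_eval_in[OF F(1)]) (auto simp: V_def v_def mconst_in_mpolys)
      then have "subst v F = 0" using F(3) indep by blast
      moreover have "subst (\<lambda>x. mvar (Inl x)) (subst v F) = F"
        by (rule subst_subst_id[OF F(1)]) (auto simp: V_def v_def subst_mvar)
      ultimately show False using F(2) by (simp add: subst_zero)
    qed
  next
    case (step j)
    interpret c0: prime_in "mpolys X" "c j" using step by (intro prime) auto
    interpret c1: prime_in "mpolys X" "c (Suc j)" using step by (intro prime) auto
    have V_j: "V j = insert (Inr j) (V (Suc j))" and "Inr j \<notin> V (Suc j)"
      using step.hyps by (auto simp: V_def image_iff)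
    show ?case
    proof (intro ballI impI notI)
      fix F assume F: "F \<in> mpolys (V j)" "F \<noteq> 0" "subst v F \<in> c j"
      obtain n g h where g: "g \<in> mpolys (V (Suc j))" "g \<noteq> 0" "h \<in> mpolys (V j)"
        "F = mvar (Inr j) ^ n * (g + mvar (Inr j) * h)"
        using split_lowest_power[of F "Inr j" "V (Suc j)"] F(1,2) V_j \<open>Inr j \<notin> V (Suc j)\<close> by metis
      have gX: "subst v g \<in> mpolys X"
        by (rule mpolys.mpoly_eval_in[OF g(1)]) (auto simp: mconst_in_mpolys intro: v_in)
      have hX: "subst v h \<in> mpolys X"
        by (rule mpolys.mpoly_eval_in[OF g(3)]) (auto simp: mconst_in_mpolys intro: v_in)
      have yj: "y j \<in> mpolys X" "y j \<notin> c j" "y j \<in> c (Suc j)" using yX y step by auto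
      have "subst v F = y j ^ n * (subst v g + y j * subst v h)"
        by (simp add: g(4) subst_mult subst_add subst_power subst_mvar v_def)
      \<comment> \<open>The power of \<open>y j\<close> is cancelled because \<open>y j\<close> is
        not in \<open>c j\<close>; one prime further up \<open>y j\<close> vanishes and only
        \<open>g\<close> is left.\<close>
      then have "subst v g + y j * subst v h \<in> c j"
        using F(3) c0.prime c0.power_notin yj gX hX by (metis mpolys.add_in mpolys.mult_in mpolys.power_in)
      then have "subst v g + y j * subst v h \<in> c (Suc j)" using chain step.hyps by blast
      then have "subst v g + y j * subst v h - y j * subst v h \<in> c (Suc j)"
        using yj(3) hX by (intro c1.diff c1.absorb2)
      then show False using step.IH g(1,2) by simp
    qed
  qed
  have "card (V 0) = card B + N"
    unfolding V_def using finite_B by (subst card_Un_disjoint) (auto simp: card_image)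
  then have "\<exists>F\<in>mpolys (V 0). F \<noteq> 0 \<and> subst v F = 0"
    using less assms(1) finite_B v_in by (intro exists_algebraic_relation) (auto simp: V_def)
  moreover have "0 \<in> c 0" using prime[of 0] prime_in.axioms(1) ideal_in.zero by blast
  ultimately show False using claim[of 0] by auto
qed

section \<open>The cotangent space of a prime\<close>

lemma prime_in_contract:
  assumes "prime_in A P" "subring_in A'" "A' \<subseteq> A"
  shows "prime_in A' (P \<inter> A')"
proof -
  interpret prime_in A P by fact
  interpret A': subring_in A' by fact
  show ?thesis
    by unfold_locales (use assms(3) one_notin prime in \<open>auto intro: zero add absorb A'.add_in A'.mult_in\<close>)
qed

lemma prime_in_poly_vimage:
  assumes "prime_in A' P" "subring_in A" "A \<subseteq> A'" "x \<in> A'"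
  shows "prime_in (polys_over A) {q \<in> polys_over A. poly q x \<in> P}"
proof -
  interpret prime_in A' P by fact
  interpret A: subring_in A by fact
  interpret p: subring_in "polys_over A" by (rule A.subring_in_polys_over)
  have "poly q x \<in> A'" if "q \<in> polys_over A" for q
    using that assms(3,4) by (intro poly_in) (auto simp: polys_over_def)
  then show ?thesis
    by unfold_locales (use one_notin prime in \<open>auto intro: zero add absorb p.add_in p.mult_in\<close>)
qed

text \<open>The variables outside \<open>B\<close> are adjoined one at a time, each contributing one
  element. For a new \<open>y\<close>, maximality of \<open>B\<close> gives a nonzero element of
  \<open>P\<close> in \<open>B\<close> and \<open>y\<close>. Its coefficients lie in
  \<open>mpolys B\<close>, which meets \<open>P\<close> only in 0, so the larger prime is not
  extended from the smaller one.\<close>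

lemma exists_independent_in_prime:
  fixes P :: "('x, 'k::field) mpol set"
  assumes "finite X" "B \<subseteq> X" "prime_in (mpolys X) P" and indep: "P \<inter> mpolys B = {0}"
    and maximal: "\<And>x. x \<in> X - B \<Longrightarrow> P \<inter> mpolys (insert x B) \<noteq> {0}"
  obtains g where "\<And>i. i \<in> X - B \<Longrightarrow> g i \<in> P"
    and "\<And>a. (\<And>i. i \<in> X - B \<Longrightarrow> a i \<in> mpolys X) \<Longrightarrow> (\<Sum>i\<in>X-B. a i * g i) \<in> ideal_square P \<Longrightarrow>
      \<forall>i\<in>X-B. a i \<in> P"
proof -
  interpret P: prime_in "mpolys X" P by fact
  have "\<exists>g. (\<forall>i\<in>Z. g i \<in> P \<inter> mpolys (B \<union> Z)) \<and>
      (\<forall>a. (\<forall>i\<in>Z. a i \<in> mpolys (B \<union> Z)) \<longrightarrow> (\<Sum>i\<in>Z. a i * g i) \<in> ideal_square (P \<inter> mpolys (B \<union> Z)) \<longrightarrow>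
        (\<forall>i\<in>Z. a i \<in> P \<inter> mpolys (B \<union> Z)))" if "finite Z" "Z \<subseteq> X - B" for Z
    using that
  proof (induction Z rule: finite_induct)
    case empty
    show ?case by simp
  next
    case (insert y Z)
    define Y where "Y = B \<union> Z"
    define p where "p = P \<inter> mpolys Y"
    define P' where "P' = P \<inter> mpolys (insert y Y)"
    \<comment> \<open>This is \<open>P'\<close> written in one variable over
      \<open>mpolys Y\<close>, so that degrees in \<open>y\<close> are available.\<close>
    define Ph where "Ph = {q \<in> polys_over (mpolys Y). poly q (mvar y) \<in> P}"
    have y: "y \<notin> Y" "y \<in> X" "Y \<subseteq> X" and yB: "y \<in> X - B"
      using insert.prems insert.hyps assms(2) by (auto simp: Y_def)
    have "prime_in (mpolys Y) p"
      unfolding p_def using y by (intro prime_in_contract[OF assms(3)] subring_in_mpolys mpolys_mono)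
    then interpret p: prime_in "mpolys Y" p .
    have "prime_in (polys_over (mpolys Y)) Ph"
      unfolding Ph_def using y by (intro prime_in_poly_vimage[OF assms(3)] subring_in_mpolys mpolys_mono) auto
    then interpret Ph: prime_in "polys_over (mpolys Y)" Ph .
    interpret sPh: ideal_in "polys_over (mpolys Y)" "ideal_square Ph" by (rule Ph.ideal_in_ideal_square)
    have yY: "poly q (mvar y) \<in> mpolys (insert y Y)" if "q \<in> polys_over (mpolys Y)" for q
      using that mpolys_mono[of Y "insert y Y"] by (intro mpolys.poly_in) (auto simp: polys_over_def)
    have "0 \<in> P \<inter> mpolys (insert y B)" by (simp add: P.zero)
    then obtain f where f: "f \<in> P" "f \<in> mpolys (insert y B)" "f \<noteq> 0"
      using maximal[OF yB] by blast
    obtain f0 where f0: "f0 \<in> polys_over (mpolys B)" "poly f0 (mvar y) = f"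
      using exists_poly_mvar[OF f(2)] by blast
    have "f0 \<noteq> 0" using f0 f(3) by auto
    then obtain j where "Polynomial.coeff f0 j \<noteq> 0" by (auto simp: poly_eq_iff)
    moreover have "Polynomial.coeff f0 j \<in> mpolys B" using f0 by (auto simp: polys_over_def)
    ultimately have "Polynomial.coeff f0 j \<notin> p" using indep by (auto simp: p_def)
    then have f0_p: "f0 \<notin> polys_over p" by (auto simp: polys_over_def)
    have f0_P: "f0 \<in> Ph"
      using f0 f(1) mpolys_mono[of B Y] by (auto simp: Ph_def Y_def polys_over_def)
    obtain g where g: "\<And>i. i \<in> Z \<Longrightarrow> g i \<in> p"
      "\<And>a. (\<And>i. i \<in> Z \<Longrightarrow> a i \<in> mpolys Y) \<Longrightarrow> (\<Sum>i\<in>Z. a i * g i) \<in> ideal_square p \<Longrightarrow> \<forall>i\<in>Z. a i \<in> p"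
    proof -
      have "\<exists>g. (\<forall>i\<in>Z. g i \<in> p) \<and> (\<forall>a. (\<forall>i\<in>Z. a i \<in> mpolys Y) \<longrightarrow>
          (\<Sum>i\<in>Z. a i * g i) \<in> ideal_square p \<longrightarrow> (\<forall>i\<in>Z. a i \<in> p))"
        using insert.IH insert.prems unfolding Y_def p_def by blast
      then obtain g where g1: "\<forall>i\<in>Z. g i \<in> p" and g2: "\<forall>a. (\<forall>i\<in>Z. a i \<in> mpolys Y) \<longrightarrow>
          (\<Sum>i\<in>Z. a i * g i) \<in> ideal_square p \<longrightarrow> (\<forall>i\<in>Z. a i \<in> p)" by (elim exE conjE)
      show ?thesis
      proof (rule that[of g])
        fix a i
        show "i \<in> Z \<Longrightarrow> g i \<in> p" using g1 by (rule bspec)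
        show "(\<And>i. i \<in> Z \<Longrightarrow> a i \<in> mpolys Y) \<Longrightarrow> (\<Sum>i\<in>Z. a i * g i) \<in> ideal_square p \<Longrightarrow> \<forall>i\<in>Z. a i \<in> p"
          using g2[rule_format, of a] by blast
      qed
    qed
    obtain h where h: "h \<in> Ph"
      "\<And>a b. (\<And>i. i \<in> Z \<Longrightarrow> a i \<in> polys_over (mpolys Y)) \<Longrightarrow> b \<in> polys_over (mpolys Y) \<Longrightarrow>
        (\<Sum>i\<in>Z. a i * [:g i:]) + b * h \<in> ideal_square Ph \<Longrightarrow> (\<forall>i\<in>Z. a i \<in> Ph) \<and> b \<in> Ph"
    proof (rule exists_independent_extension[where A = "mpolys Y" and p = p and P = Ph and I = Z and g = g and ?f0.0 = f0])
      show "[:a:] \<in> Ph \<longleftrightarrow> a \<in> p" if "a \<in> mpolys Y" for a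
        using that by (simp add: Ph_def p_def mpolys.const_polys_over)
    qed (use g f0_p f0_P insert.hyps p.prime_in_axioms Ph.prime_in_axioms in auto)
    define g' where "g' = g(y := poly h (mvar y))"
    have Z_eq: "B \<union> insert y Z = insert y Y" by (auto simp: Y_def)
    have g'_in: "g' i \<in> P'" if "i \<in> insert y Z" for i
      using that g(1) h(1) yY[of h] mpolys_mono[of Y "insert y Y"]
      by (auto simp: g'_def P'_def p_def Ph_def)
    have lift_P: "\<exists>q\<in>Ph. poly q (mvar y) = u" if "u \<in> P'" for u
      using that exists_poly_mvar[of u y Y] by (auto simp: P'_def Ph_def)
    have lift: "\<exists>q\<in>ideal_square Ph. poly q (mvar y) = u" if "u \<in> ideal_square P'" for u
      using that
    proof induction
      case zero
      show ?case by (rule bexI[OF _ ideal_square.zero]) simp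
    next
      case (step u v f)
      then obtain q1 q2 q3 where "q1 \<in> Ph" "poly q1 (mvar y) = u" "q2 \<in> Ph" "poly q2 (mvar y) = v"
        "q3 \<in> ideal_square Ph" "poly q3 (mvar y) = f" using lift_P by metis
      then show ?case by (intro bexI[OF _ ideal_square.step[of q1 Ph q2 q3]]) auto
    qed
    have "a i \<in> P'" if a: "\<And>i. i \<in> insert y Z \<Longrightarrow> a i \<in> mpolys (insert y Y)"
      and sq: "(\<Sum>i\<in>insert y Z. a i * g' i) \<in> ideal_square P'" and i: "i \<in> insert y Z" for a i
    proof -
      have "\<forall>i\<in>insert y Z. \<exists>q. q \<in> polys_over (mpolys Y) \<and> poly q (mvar y) = a i"
        using a exists_poly_mvar by metis
      then obtain q where q: "\<And>i. i \<in> insert y Z \<Longrightarrow> q i \<in> polys_over (mpolys Y)"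
        "\<And>i. i \<in> insert y Z \<Longrightarrow> poly (q i) (mvar y) = a i" by metis
      define t where "t = (\<Sum>i\<in>Z. q i * [:g i:]) + q y * h"
      have tA: "t \<in> polys_over (mpolys Y)"
        unfolding t_def using q(1) g(1) h(1) p.sub Ph.sub
        by (intro Ph.add_in Ph.sum_in Ph.mult_in) (auto simp: mpolys.const_polys_over)
      have "poly t (mvar y) = (\<Sum>i\<in>Z. a i * g i) + a y * poly h (mvar y)"
        using q(2) by (simp add: t_def poly_sum mult.commute)
      also have "\<dots> = (\<Sum>i\<in>insert y Z. a i * g' i)"
      proof -
        have "(\<Sum>i\<in>Z. a i * g i) = (\<Sum>i\<in>Z. a i * g' i)"
          using insert.hyps by (intro sum.cong) (auto simp: g'_def)
        then show ?thesis using insert.hyps by (simp add: g'_def add.commute)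
      qed
      finally obtain t' where t': "t' \<in> ideal_square Ph" "poly t' (mvar y) = poly t (mvar y)"
        using lift[OF sq] by auto
      \<comment> \<open>Evaluation at \<open>mvar y\<close> is injective as \<open>y\<close> is not
        in \<open>Y\<close>, so the relation already holds modulo the square of
        \<open>Ph\<close>.\<close>
      have "t' = t" using poly_mvar_inj[OF _ tA y(1) t'(2)] t'(1) sPh.sub by blast
      then have "(\<forall>i\<in>Z. q i \<in> Ph) \<and> q y \<in> Ph"
        using h(2)[of q "q y"] q(1) t'(1) by (auto simp: t_def)
      then have "q i \<in> Ph" using i by auto
      then have "poly (q i) (mvar y) \<in> P'" using yY by (auto simp: Ph_def P'_def)
      then show ?thesis using q(2)[OF i] by simp
    qed
    then show ?case using g'_in unfolding Z_eq P'_def[symmetric] by (intro exI[of _ g']) blast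
  qed
  from this[of "X - B"] assms(1) obtain g where
    "\<forall>i\<in>X - B. g i \<in> P"
    "\<forall>a. (\<forall>i\<in>X - B. a i \<in> mpolys X) \<longrightarrow> (\<Sum>i\<in>X - B. a i * g i) \<in> ideal_square P \<longrightarrow>
        (\<forall>i\<in>X - B. a i \<in> P)"
    using Un_absorb1[OF assms(2)] inf.absorb1[OF P.sub] by auto
  then show ?thesis by (intro that[of g]) blast+
qed

text \<open>Krull's height theorem for a prime of a polynomial ring whose extension to the local ring at
  it is generated by \<open>\<Gamma>\<close> modulo its square.\<close>
theorem prime_chain_le_card_generators:
  fixes P :: "('x, 'k::field) mpol set" and c :: "nat \<Rightarrow> ('x, 'k) mpol set"
  assumes "finite X"
    and prime: "\<And>i. i \<le> N \<Longrightarrow> prime_in (mpolys X) (c i)"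
    and chain: "\<And>i. i < N \<Longrightarrow> c i \<subset> c (Suc i)"
    and P: "prime_in (mpolys X) P" "c N \<subseteq> P"
    and "finite \<Gamma>" "\<Gamma> \<subseteq> P"
    and gen: "\<And>p. p \<in> P \<Longrightarrow> \<exists>u\<in>mpolys X - P. \<exists>b. (\<forall>g\<in>\<Gamma>. b g \<in> mpolys X) \<and>
      u * p - (\<Sum>g\<in>\<Gamma>. b g * g) \<in> ideal_square P"
  shows "N \<le> card \<Gamma>"
proof -
  interpret P: prime_in "mpolys X" P by fact
  interpret sP: ideal_in "mpolys X" "ideal_square P" by (rule P.ideal_in_ideal_square)
  define \<B> where "\<B> = {B. B \<subseteq> X \<and> P \<inter> mpolys B = {0}}"
  have "{} \<in> \<B>"
  proof -
    have "f = 0" if "f \<in> P" "f \<in> mpolys {}" for f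
    proof (rule ccontr)
      assume "f \<noteq> 0"
      define a where "a = Poly_Mapping.lookup f 0"
      have f: "f = mconst a"
        unfolding a_def using that(2) by (intro poly_mapping_eqI)
          (auto simp: mpolys_def mconst_def lookup_single when_def in_keys_iff)
      then have "a \<noteq> 0" using \<open>f \<noteq> 0\<close> by (auto simp: mconst_hom)
      have "mconst (inverse a) * f \<in> P" using that(1) by (intro P.absorb mconst_in_mpolys)
      then show False using f \<open>a \<noteq> 0\<close> P.one_notin by (simp flip: mconst_hom(4)) (simp add: mconst_hom)
    qed
    then show ?thesis by (auto simp: \<B>_def P.zero)
  qed
  moreover have "finite \<B>" using assms(1) by (auto simp: \<B>_def intro: finite_subset[of _ "Pow X"])
  ultimately obtain B where B: "B \<in> \<B>" and max: "\<And>B'. B' \<in> \<B> \<Longrightarrow> B \<subseteq> B' \<Longrightarrow> B' = B"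
    using finite_has_maximal2[of \<B> "{}"] by metis
  have BX: "B \<subseteq> X" "P \<inter> mpolys B = {0}" using B by (auto simp: \<B>_def)
  obtain g where g: "\<And>i. i \<in> X - B \<Longrightarrow> g i \<in> P"
    "\<And>a. (\<And>i. i \<in> X - B \<Longrightarrow> a i \<in> mpolys X) \<Longrightarrow> (\<Sum>i\<in>X-B. a i * g i) \<in> ideal_square P \<Longrightarrow>
      \<forall>i\<in>X-B. a i \<in> P"
  proof (rule exists_independent_in_prime[OF assms(1) BX(1) P(1) BX(2)])
    fix x assume "x \<in> X - B"
    then have "insert x B \<notin> \<B>" using max[of "insert x B"] by blast
    then show "P \<inter> mpolys (insert x B) \<noteq> {0}" using \<open>x \<in> X - B\<close> BX by (auto simp: \<B>_def)
  qed blast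
  \<comment> \<open>With fewer generators than \<open>g i\<close>, elimination gives a combination
    of the \<open>u i * g i\<close>, with coefficients not all in \<open>P\<close>, whose expansion
    in \<open>\<Gamma>\<close> modulo the square of \<open>P\<close> has all coefficients in
    \<open>P\<close>. It then lies in that square, against the independence of the
    \<open>g i\<close>.\<close>
  have "card (X - B) \<le> card \<Gamma>"
  proof (rule ccontr)
    assume less: "\<not> card (X - B) \<le> card \<Gamma>"
    have "\<forall>i\<in>X-B. \<exists>u b. u \<in> mpolys X - P \<and> (\<forall>h\<in>\<Gamma>. b h \<in> mpolys X) \<and>
      u * g i - (\<Sum>h\<in>\<Gamma>. b h * h) \<in> ideal_square P"
      using gen g(1) by blast
    from bchoice[OF this] obtain u where "\<forall>i\<in>X-B. \<exists>b. u i \<in> mpolys X - P \<and> (\<forall>h\<in>\<Gamma>. b h \<in> mpolys X) \<and>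
      u i * g i - (\<Sum>h\<in>\<Gamma>. b h * h) \<in> ideal_square P" by blast
    from bchoice[OF this] obtain b where ub: "\<And>i. i \<in> X - B \<Longrightarrow> u i \<in> mpolys X - P"
      "\<And>i h. i \<in> X - B \<Longrightarrow> h \<in> \<Gamma> \<Longrightarrow> b i h \<in> mpolys X"
      "\<And>i. i \<in> X - B \<Longrightarrow> u i * g i - (\<Sum>h\<in>\<Gamma>. b i h * h) \<in> ideal_square P" by blast
    obtain a where a: "\<forall>i\<in>X-B. a i \<in> mpolys X" "\<exists>i\<in>X-B. a i \<notin> P"
      "\<forall>h\<in>\<Gamma>. (\<Sum>i\<in>X-B. a i * b i h) \<in> P"
      using P.elimination[of \<Gamma> "X - B" b] ub(2) assms(1,6) less by auto
    have "(\<Sum>i\<in>X-B. (a i * u i) * g i) =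
        (\<Sum>i\<in>X-B. a i * (u i * g i - (\<Sum>h\<in>\<Gamma>. b i h * h))) + (\<Sum>i\<in>X-B. a i * (\<Sum>h\<in>\<Gamma>. b i h * h))"
      by (simp add: sum.distrib[symmetric] algebra_simps)
    also have "(\<Sum>i\<in>X-B. a i * (\<Sum>h\<in>\<Gamma>. b i h * h)) = (\<Sum>h\<in>\<Gamma>. (\<Sum>i\<in>X-B. a i * b i h) * h)"
      unfolding sum_distrib_left sum_distrib_right by (subst sum.swap) (simp add: mult.assoc)
    also have "(\<Sum>i\<in>X-B. a i * (u i * g i - (\<Sum>h\<in>\<Gamma>. b i h * h))) + \<dots> \<in> ideal_square P"
      using a ub(3) assms(7)
      by (intro sP.add sP.sum sP.absorb mult_in_ideal_square) auto
    finally have "\<forall>i\<in>X-B. a i * u i \<in> P"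
      using a(1) ub(1) by (intro g(2)) (auto intro: mpolys.mult_in)
    moreover obtain i where "i \<in> X - B" "a i \<notin> P" using a(2) by blast
    ultimately show False using a(1) ub(1)[of i] P.prime[of "a i" "u i"] by blast
  qed
  \<comment> \<open>The variables in \<open>B\<close> are independent modulo \<open>c N\<close> as
    well, because \<open>c N\<close> is contained in \<open>P\<close>.\<close>
  moreover have "N + card B \<le> card X"
  proof (rule prime_chain_length[where c = c, OF assms(1) BX(1) prime chain])
    show "c N \<inter> mpolys B = {0}"
      using BX(2) P(2) prime[of N] prime_in.axioms(1) ideal_in.zero by blast
  qed auto
  moreover have "card (X - B) = card X - card B"
    using assms(1) BX(1) by (meson card_Diff_subset finite_subset)
  moreover have "card B \<le> card X" using assms(1) BX(1) by (intro card_mono)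
  ultimately show ?thesis by linarith
qed

section \<open>Localizations\<close>

context primeideal
begin

lemma frac_eqI:
  assumes "a \<in> carrier R" "s \<in> carrier R - I" "b \<in> carrier R" "t \<in> carrier R - I"
    and "a \<otimes> t = b \<otimes> s"
  shows "frac R I a s = frac R I b t"
  using assms one_compl by (subst frac_eq_iff) (auto intro!: bexI[of _ \<one>] simp: r_right_minus_eq)

lemma localization_one: "\<one>\<^bsub>localization R I\<^esub> = frac R I \<one> \<one>"
  and localization_zero: "\<zero>\<^bsub>localization R I\<^esub> = frac R I \<zero> \<one>"
  by (simp_all add: localization_def)

lemma cring_localization: "cring (localization R I)"
proof (rule cringI)
  note compl = compl_mult_closed one_compl
  show "abelian_group (localization R I)"
  proof (rule abelian_groupI)
    fix x y assume "x \<in> carrier (localization R I)" "y \<in> carrier (localization R I)"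
    then obtain a s b t where *: "a \<in> carrier R" "s \<in> carrier R - I" "x = frac R I a s"
      "b \<in> carrier R" "t \<in> carrier R - I" "y = frac R I b t" by (metis localization_cases)
    then show "x \<oplus>\<^bsub>localization R I\<^esub> y \<in> carrier (localization R I)"
      using compl by (auto simp: frac_add intro!: frac_closed)
    show "x \<oplus>\<^bsub>localization R I\<^esub> y = y \<oplus>\<^bsub>localization R I\<^esub> x"
      using * by (simp add: frac_add a_comm m_comm)
    fix z assume "z \<in> carrier (localization R I)"
    then obtain c w where z: "c \<in> carrier R" "w \<in> carrier R - I" "z = frac R I c w"
      by (metis localization_cases)
    have "(a \<otimes> t \<oplus> b \<otimes> s) \<otimes> w \<oplus> c \<otimes> (s \<otimes> t) = a \<otimes> (t \<otimes> w) \<oplus> (b \<otimes> w \<oplus> c \<otimes> t) \<otimes> s"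
      "s \<otimes> t \<otimes> w = s \<otimes> (t \<otimes> w)"
      using * z by (simp_all, algebra+)
    then show "x \<oplus>\<^bsub>localization R I\<^esub> y \<oplus>\<^bsub>localization R I\<^esub> z = x \<oplus>\<^bsub>localization R I\<^esub> (y \<oplus>\<^bsub>localization R I\<^esub> z)"
      using * z compl by (simp add: frac_add)
  next
    fix x assume "x \<in> carrier (localization R I)"
    then obtain a s where *: "a \<in> carrier R" "s \<in> carrier R - I" "x = frac R I a s"
      by (metis localization_cases)
    then show "\<zero>\<^bsub>localization R I\<^esub> \<oplus>\<^bsub>localization R I\<^esub> x = x"
      using one_compl by (simp add: localization_zero frac_add)
    have "frac R I (\<ominus> a \<otimes> s \<oplus> a \<otimes> s) (s \<otimes> s) = frac R I \<zero> \<one>"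
      using * compl by (intro frac_eqI) (auto simp: l_minus l_neg)
    then show "\<exists>y\<in>carrier (localization R I). y \<oplus>\<^bsub>localization R I\<^esub> x = \<zero>\<^bsub>localization R I\<^esub>"
      using * by (intro bexI[of _ "frac R I (\<ominus> a) s"]) (auto simp: localization_zero frac_add intro: frac_closed)
  qed (use one_compl in \<open>auto simp: localization_zero intro: frac_closed\<close>)
  show "comm_monoid (localization R I)"
  proof (rule comm_monoidI)
    fix x y assume "x \<in> carrier (localization R I)" "y \<in> carrier (localization R I)"
    then obtain a s b t where *: "a \<in> carrier R" "s \<in> carrier R - I" "x = frac R I a s"
      "b \<in> carrier R" "t \<in> carrier R - I" "y = frac R I b t" by (metis localization_cases)
    then show "x \<otimes>\<^bsub>localization R I\<^esub> y \<in> carrier (localization R I)"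
      using compl by (auto simp: frac_mult intro!: frac_closed)
    show "x \<otimes>\<^bsub>localization R I\<^esub> y = y \<otimes>\<^bsub>localization R I\<^esub> x"
      using * by (simp add: frac_mult m_comm)
    fix z assume "z \<in> carrier (localization R I)"
    then obtain c w where z: "c \<in> carrier R" "w \<in> carrier R - I" "z = frac R I c w"
      by (metis localization_cases)
    then show "x \<otimes>\<^bsub>localization R I\<^esub> y \<otimes>\<^bsub>localization R I\<^esub> z = x \<otimes>\<^bsub>localization R I\<^esub> (y \<otimes>\<^bsub>localization R I\<^esub> z)"
      using * z compl by (simp add: frac_mult m_assoc)
  next
    fix x assume "x \<in> carrier (localization R I)"
    then obtain a s where "a \<in> carrier R" "s \<in> carrier R - I" "x = frac R I a s"
      by (metis localization_cases)
    then show "\<one>\<^bsub>localization R I\<^esub> \<otimes>\<^bsub>localization R I\<^esub> x = x"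
      using one_compl by (simp add: localization_one frac_mult)
  qed (use one_compl in \<open>auto simp: localization_one intro: frac_closed\<close>)
  fix x y z
  assume "x \<in> carrier (localization R I)" "y \<in> carrier (localization R I)" "z \<in> carrier (localization R I)"
  then obtain a s b t c w where *: "a \<in> carrier R" "s \<in> carrier R - I" "x = frac R I a s"
    "b \<in> carrier R" "t \<in> carrier R - I" "y = frac R I b t"
    "c \<in> carrier R" "w \<in> carrier R - I" "z = frac R I c w" by (metis localization_cases)
  have "frac R I ((a \<otimes> t \<oplus> b \<otimes> s) \<otimes> c) ((s \<otimes> t) \<otimes> w) =
      frac R I ((a \<otimes> c) \<otimes> (t \<otimes> w) \<oplus> (b \<otimes> c) \<otimes> (s \<otimes> w)) ((s \<otimes> w) \<otimes> (t \<otimes> w))"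
  proof (rule frac_eqI)
    have "a \<in> carrier R" "s \<in> carrier R" "b \<in> carrier R" "t \<in> carrier R" "c \<in> carrier R" "w \<in> carrier R"
      using * by auto
    then show "(a \<otimes> t \<oplus> b \<otimes> s) \<otimes> c \<otimes> (s \<otimes> w \<otimes> (t \<otimes> w)) =
        ((a \<otimes> c) \<otimes> (t \<otimes> w) \<oplus> (b \<otimes> c) \<otimes> (s \<otimes> w)) \<otimes> (s \<otimes> t \<otimes> w)" by algebra
  qed (use * compl in auto)
  then show "(x \<oplus>\<^bsub>localization R I\<^esub> y) \<otimes>\<^bsub>localization R I\<^esub> z =
      x \<otimes>\<^bsub>localization R I\<^esub> z \<oplus>\<^bsub>localization R I\<^esub> y \<otimes>\<^bsub>localization R I\<^esub> z"
    using * compl by (simp add: frac_mult frac_add)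
qed

end

text \<open>The maximal ideal is zero, hence generated by the empty set, which matches dimension
  0.\<close>

lemma (in cring) regular_local_ring_field:
  assumes "\<one> \<noteq> \<zero>" and inv: "\<And>x. x \<in> carrier R \<Longrightarrow> x \<noteq> \<zero> \<Longrightarrow> \<exists>y\<in>carrier R. x \<otimes> y = \<one>"
  shows "regular_local_ring R"
proof -
  have ideals: "I = {\<zero>} \<or> I = carrier R" if I: "ideal I R" for I
  proof (cases "I \<subseteq> {\<zero>}")
    case True
    then show ?thesis using additive_subgroup.zero_closed[OF ideal.axioms(1)[OF I]] by auto
  next
    case False
    then obtain x where x: "x \<in> I" "x \<noteq> \<zero>" by blast
    then obtain y where "y \<in> carrier R" "x \<otimes> y = \<one>" using inv ideal.Icarr[OF I] by blast
    then have "\<one> \<in> I" using ideal.I_r_closed[OF I x(1)] by metis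
    then show ?thesis using ideal.one_imp_carrier[OF I] by blast
  qed
  have Idl_empty: "Idl {} = {\<zero>}"
  proof
    show "Idl {} \<subseteq> {\<zero>}" using genideal_minimal[OF zeroideal] by simp
    show "{\<zero>} \<subseteq> Idl {}"
      using additive_subgroup.zero_closed[OF ideal.axioms(1)[OF genideal_ideal[of "{}"]]] by simp
  qed
  have Idl_one: "Idl {\<one>} = carrier R" by (rule genideal_one)
  have noeth: "noetherian_ring R"
  proof (unfold_locales)
    fix I assume "ideal I R"
    from ideals[OF this] show "\<exists>A\<subseteq>carrier R. finite A \<and> I = Idl A"
      using Idl_empty Idl_one by (metis empty_subsetI finite.emptyI finite.insertI insert_subset one_closed)
  qed
  have max: "maximalideal {\<zero>} R"
    by (rule maximalidealI[OF zeroideal]) (use assms(1) ideals one_closed in auto)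
  have uniq: "m = {\<zero>}" if "maximalideal m R" for m
    using ideals maximalideal.I_notcarr[OF that] maximalideal.axioms(1)[OF that] by blast
  have prime_iff: "primeideal I R \<Longrightarrow> I = {\<zero>}" for I
    using ideals primeideal.I_notcarr primeideal.axioms(1) by metis
  have "primeideal {\<zero>} R" using maximalideal_prime max by blast
  then have "{enat n | n. \<exists>c :: nat \<Rightarrow> 'a set. (\<forall>i\<le>n. primeideal (c i) R) \<and> (\<forall>i<n. c i \<subset> c (Suc i))} = {0}"
  proof (intro equalityI subsetI)
    fix e assume "e \<in> {enat n | n. \<exists>c :: nat \<Rightarrow> 'a set. (\<forall>i\<le>n. primeideal (c i) R) \<and> (\<forall>i<n. c i \<subset> c (Suc i))}"
    then obtain n c where e: "e = enat n" and c: "\<forall>i\<le>n. primeideal (c i :: 'a set) R" "\<forall>i<n. c i \<subset> c (Suc i)" by blast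
    have "n = 0"
    proof (rule ccontr)
      assume "n \<noteq> 0"
      then have "c 0 = {\<zero>}" "c (Suc 0) = {\<zero>}" "c 0 \<subset> c (Suc 0)" using c prime_iff by auto
      then show False by simp
    qed
    then show "e \<in> {0}" using e by (simp add: zero_enat_def)
  qed (auto simp: zero_enat_def intro!: exI[of _ "\<lambda>_. {\<zero>}"])
  then have "krull_dim R = 0" by (simp add: krull_dim_def)
  then have "\<exists>G\<subseteq>carrier R. finite G \<and> enat (card G) = krull_dim R \<and> {\<zero>} = Idl G"
    by (intro exI[of _ "{}"]) (simp add: Idl_empty zero_enat_def)
  then have "\<exists>m. maximalideal m R \<and> (\<forall>m'. maximalideal m' R \<longrightarrow> m' = m) \<and>
      (\<exists>G\<subseteq>carrier R. finite G \<and> enat (card G) = krull_dim R \<and> m = Idl G)"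
    using max uniq by metis
  then show ?thesis unfolding regular_local_ring_def using is_cring noeth by blast
qed

text \<open>A finite supremum is reached by a chain that can be cut off after \<open>d\<close>
  steps. The supremum of the empty set is 0 too, so in dimension 0 the chain comes from
  \<open>m\<close>.\<close>

lemma krull_dim_chain:
  assumes "krull_dim R = enat d" "primeideal m R"
  obtains c :: "nat \<Rightarrow> 'a set" where "\<And>i. i \<le> d \<Longrightarrow> primeideal (c i) R" "\<And>i. i < d \<Longrightarrow> c i \<subset> c (Suc i)"
proof (cases "d = 0")
  case True
  then show ?thesis using that[of "\<lambda>_. m"] assms(2) by simp
next
  case False
  let ?S = "{enat n | n. \<exists>c :: nat \<Rightarrow> 'a set. (\<forall>i\<le>n. primeideal (c i) R) \<and> (\<forall>i<n. c i \<subset> c (Suc i))}"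
  have "enat (d - 1) < Sup ?S" using assms(1) False by (simp add: krull_dim_def)
  then obtain e where e: "e \<in> ?S" "enat (d - 1) < e" by (auto simp: less_Sup_iff)
  then obtain n c where c: "e = enat n" "\<forall>i\<le>n. primeideal (c i :: 'a set) R" "\<forall>i<n. c i \<subset> c (Suc i)" by blast
  have "d \<le> n" using e(2) c(1) by simp
  then show ?thesis using that[of c] c by simp
qed

text \<open>The local ring of \<open>R / J\<close> at \<open>P / J\<close>, with its elements written as fractions of elements
  of \<open>R\<close>.\<close>
locale quotient_localization = cring R + J: ideal J R + P: primeideal P R
  for R (structure) and J P +
  assumes J_subset: "J \<subseteq> P"
begin

abbreviation "S \<equiv> R Quot J"
abbreviation "PS \<equiv> (\<lambda>a. J +> a) ` P"
abbreviation "L \<equiv> localization S PS"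

definition fr where "fr a s = frac S PS (J +> a) (J +> s)"

lemma coset_eq_iff: "a \<in> carrier R \<Longrightarrow> b \<in> carrier R \<Longrightarrow> J +> a = J +> b \<longleftrightarrow> a \<ominus> b \<in> J"
  using quotient_eq_iff_same_a_r_cos[OF J.is_ideal] by auto

lemma coset_in_carrier: "a \<in> carrier R \<Longrightarrow> J +> a \<in> carrier S"
  by (auto simp: FactRing_def A_RCOSETS_def' )

lemma S_cases: assumes "x \<in> carrier S" obtains a where "a \<in> carrier R" "x = J +> a"
  using assms by (auto simp: FactRing_def A_RCOSETS_def')

lemma S_simps:
  assumes "a \<in> carrier R" "b \<in> carrier R"
  shows "(J +> a) \<otimes>\<^bsub>S\<^esub> (J +> b) = J +> (a \<otimes> b)" "(J +> a) \<oplus>\<^bsub>S\<^esub> (J +> b) = J +> (a \<oplus> b)"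
  using assms by (simp_all add: FactRing_def J.rcoset_mult_add J.a_rcos_sum)

lemma S_one: "\<one>\<^bsub>S\<^esub> = J +> \<one>" and S_zero: "\<zero>\<^bsub>S\<^esub> = J +> \<zero>"
  by (simp_all add: FactRing_def a_coset_add_zero J.a_subset)

lemma S_minus:
  assumes "a \<in> carrier R" "b \<in> carrier R"
  shows "(J +> a) \<ominus>\<^bsub>S\<^esub> (J +> b) = J +> (a \<ominus> b)"
proof -
  interpret S: cring S by (rule J.quotient_is_cring[OF is_cring])
  have "\<ominus>\<^bsub>S\<^esub> (J +> b) = J +> (\<ominus> b)"
    by (rule S.minus_equality) (use assms in \<open>auto simp: S_simps S_zero l_neg coset_in_carrier\<close>)
  then show ?thesis using assms by (simp add: a_minus_def S_simps)
qed

lemma coset_in_PS: "a \<in> carrier R \<Longrightarrow> J +> a \<in> PS \<longleftrightarrow> a \<in> P"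
proof
  assume a: "a \<in> carrier R" "J +> a \<in> PS"
  then obtain p where p: "p \<in> P" "J +> a = J +> p" by blast
  then have "a \<ominus> p \<in> P" using coset_eq_iff a J_subset P.Icarr by blast
  then have "(a \<ominus> p) \<oplus> p \<in> P" using p by (intro P.a_closed)
  moreover have "(a \<ominus> p) \<oplus> p = a" using a P.Icarr[OF p(1)] by algebra
  ultimately show "a \<in> P" by simp
qed blast

lemma primeideal_PS: "primeideal PS S"
proof (rule primeidealI)
  interpret S: cring S by (rule J.quotient_is_cring[OF is_cring])
  have PR: "a \<in> carrier R" if "a \<in> P" for a using that by (rule P.Icarr)
  show "ideal PS S"
  proof (rule idealI)
    show "subgroup PS (add_monoid S)"
    proof
      show "PS \<subseteq> carrier (add_monoid S)" using coset_in_carrier PR by auto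
      show "\<one>\<^bsub>add_monoid S\<^esub> \<in> PS" using P.zero_closed by (auto simp: S_zero)
      show "x \<otimes>\<^bsub>add_monoid S\<^esub> y \<in> PS" if "x \<in> PS" "y \<in> PS" for x y
        using that PR P.a_closed by (auto simp: S_simps)
      show "inv\<^bsub>add_monoid S\<^esub> x \<in> PS" if x: "x \<in> PS" for x
      proof -
        obtain p where p: "p \<in> P" "x = J +> p" using x by blast
        have "\<ominus>\<^bsub>S\<^esub> (J +> p) = J +> (\<ominus> p)"
          by (rule S.minus_equality) (use p PR in \<open>auto simp: S_simps S_zero l_neg coset_in_carrier\<close>)
        then show ?thesis using p P.a_inv_closed by (auto simp: a_inv_def)
      qed
    qed
    show "x \<otimes>\<^bsub>S\<^esub> a \<in> PS" "a \<otimes>\<^bsub>S\<^esub> x \<in> PS" if "a \<in> PS" "x \<in> carrier S" for a x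
      using that PR P.I_l_closed P.I_r_closed by (auto elim!: S_cases simp: S_simps)
  qed (rule S.ring_axioms)
  show "carrier S \<noteq> PS"
    using coset_in_PS[of \<one>] coset_in_carrier[of \<one>] P.one_compl by auto
  show "x \<in> PS \<or> y \<in> PS" if x: "x \<in> carrier S" and y: "y \<in> carrier S" and xy: "x \<otimes>\<^bsub>S\<^esub> y \<in> PS" for x y
  proof -
    obtain a where a: "a \<in> carrier R" "x = J +> a" using x by (rule S_cases)
    obtain b where b: "b \<in> carrier R" "y = J +> b" using y by (rule S_cases)
    have "J +> (a \<otimes> b) \<in> PS" using xy S_simps(1)[OF a(1) b(1)] a(2) b(2) by simp
    then have "a \<otimes> b \<in> P" using coset_in_PS[OF m_closed[OF a(1) b(1)]] by blast
    then show ?thesis using P.I_prime[OF a(1) b(1)] a(2) b(2) by blast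
  qed
qed (rule J.quotient_is_cring[OF is_cring])

sublocale PS: primeideal PS S by (rule primeideal_PS)
sublocale L: cring L by (rule PS.cring_localization)

lemma S_compl: "s \<in> carrier R - P \<Longrightarrow> J +> s \<in> carrier S - PS"
  using coset_in_PS[of s] coset_in_carrier[of s] by blast

lemma S_compl_cases:
  assumes "x \<in> carrier S - PS" obtains s where "s \<in> carrier R - P" "x = J +> s"
  using assms by (auto elim!: S_cases)

lemma fr_closed: "a \<in> carrier R \<Longrightarrow> s \<in> carrier R - P \<Longrightarrow> fr a s \<in> carrier L"
  unfolding fr_def by (intro PS.frac_closed coset_in_carrier S_compl)

lemma fr_cases:
  assumes "x \<in> carrier L" obtains a s where "a \<in> carrier R" "s \<in> carrier R - P" "x = fr a s"
  using PS.localization_cases[OF assms] S_cases S_compl_cases unfolding fr_def by metis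

lemma fr_eq_iff:
  assumes "a \<in> carrier R" "s \<in> carrier R - P" "b \<in> carrier R" "t \<in> carrier R - P"
  shows "fr a s = fr b t \<longleftrightarrow> (\<exists>u\<in>carrier R - P. u \<otimes> (a \<otimes> t \<ominus> b \<otimes> s) \<in> J)"
proof -
  have *: "(J +> u) \<otimes>\<^bsub>S\<^esub> ((J +> a) \<otimes>\<^bsub>S\<^esub> (J +> t) \<ominus>\<^bsub>S\<^esub> (J +> b) \<otimes>\<^bsub>S\<^esub> (J +> s)) = \<zero>\<^bsub>S\<^esub> \<longleftrightarrow>
      u \<otimes> (a \<otimes> t \<ominus> b \<otimes> s) \<in> J" if "u \<in> carrier R" for u
  proof -
    have c: "u \<otimes> (a \<otimes> t \<ominus> b \<otimes> s) \<in> carrier R" using assms that by simp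
    then have "u \<otimes> (a \<otimes> t \<ominus> b \<otimes> s) \<ominus> \<zero> = u \<otimes> (a \<otimes> t \<ominus> b \<otimes> s)" by algebra
    then show ?thesis using assms that c by (simp add: S_simps S_minus S_zero coset_eq_iff)
  qed
  have "fr a s = fr b t \<longleftrightarrow> (\<exists>v\<in>carrier S - PS.
      v \<otimes>\<^bsub>S\<^esub> ((J +> a) \<otimes>\<^bsub>S\<^esub> (J +> t) \<ominus>\<^bsub>S\<^esub> (J +> b) \<otimes>\<^bsub>S\<^esub> (J +> s)) = \<zero>\<^bsub>S\<^esub>)"
    unfolding fr_def using assms by (intro PS.frac_eq_iff coset_in_carrier S_compl) auto
  also have "\<dots> \<longleftrightarrow> (\<exists>u\<in>carrier R - P. u \<otimes> (a \<otimes> t \<ominus> b \<otimes> s) \<in> J)"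
    using * S_compl S_compl_cases by (metis DiffD1)
  finally show ?thesis .
qed

lemma fr_eqI:
  assumes "a \<in> carrier R" "s \<in> carrier R - P" "b \<in> carrier R" "t \<in> carrier R - P" "a \<otimes> t = b \<otimes> s"
  shows "fr a s = fr b t"
proof -
  have "a \<otimes> t \<ominus> b \<otimes> s = \<zero>" using assms by (subst r_right_minus_eq) auto
  then have "\<one> \<otimes> (a \<otimes> t \<ominus> b \<otimes> s) \<in> J" using J.zero_closed by (metis l_one zero_closed)
  then show ?thesis
    using P.one_compl unfolding fr_eq_iff[OF assms(1-4)] by blast
qed

lemma fr_mult:
  assumes "a \<in> carrier R" "s \<in> carrier R - P" "b \<in> carrier R" "t \<in> carrier R - P"
  shows "fr a s \<otimes>\<^bsub>L\<^esub> fr b t = fr (a \<otimes> b) (s \<otimes> t)"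
  unfolding fr_def using assms S_compl
  by (subst PS.frac_mult) (auto simp: coset_in_carrier S_simps)

lemma fr_add:
  assumes "a \<in> carrier R" "s \<in> carrier R - P" "b \<in> carrier R" "t \<in> carrier R - P"
  shows "fr a s \<oplus>\<^bsub>L\<^esub> fr b t = fr (a \<otimes> t \<oplus> b \<otimes> s) (s \<otimes> t)"
  unfolding fr_def using assms S_compl
  by (subst PS.frac_add) (auto simp: coset_in_carrier S_simps)

lemma L_one: "\<one>\<^bsub>L\<^esub> = fr \<one> \<one>" and L_zero: "\<zero>\<^bsub>L\<^esub> = fr \<zero> \<one>"
  by (simp_all add: fr_def PS.localization_one PS.localization_zero S_one S_zero)

lemma fr_eq_zero_iff:
  assumes "a \<in> carrier R" "s \<in> carrier R - P"
  shows "fr a s = \<zero>\<^bsub>L\<^esub> \<longleftrightarrow> (\<exists>u\<in>carrier R - P. u \<otimes> a \<in> J)"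
  unfolding L_zero using assms P.one_compl by (subst fr_eq_iff) (auto simp: a_minus_def)

lemma fr_inverse:
  assumes "a \<in> carrier R - P" "s \<in> carrier R - P"
  shows "fr a s \<otimes>\<^bsub>L\<^esub> fr s a = \<one>\<^bsub>L\<^esub>"
proof -
  have "fr a s \<otimes>\<^bsub>L\<^esub> fr s a = fr (a \<otimes> s) (s \<otimes> a)" using assms by (intro fr_mult) auto
  also have "\<dots> = fr \<one> \<one>"
    using assms P.one_compl P.compl_mult_closed[OF assms(2,1)] by (intro fr_eqI) (simp_all add: m_comm)
  finally show ?thesis by (simp add: L_one)
qed

text \<open>The assumption says that \<open>P\<close> maps to zero in the local ring, which is
  therefore a field.\<close>

lemma regular_at_minimal_prime:
  assumes "\<And>a. a \<in> P \<Longrightarrow> \<exists>u\<in>carrier R - P. u \<otimes> a \<in> J"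
  shows "regular_local_ring L"
proof (rule L.regular_local_ring_field)
  have "\<not> (\<exists>u\<in>carrier R - P. u \<otimes> \<one> \<in> J)" using J_subset by auto
  then show "\<one>\<^bsub>L\<^esub> \<noteq> \<zero>\<^bsub>L\<^esub>" using fr_eq_zero_iff[of \<one> \<one>] P.one_compl by (simp add: L_one)
  fix x assume x: "x \<in> carrier L" "x \<noteq> \<zero>\<^bsub>L\<^esub>"
  then obtain a s where *: "a \<in> carrier R" "s \<in> carrier R - P" "x = fr a s" by (metis fr_cases)
  have "x = \<zero>\<^bsub>L\<^esub>" if "a \<in> P" using fr_eq_zero_iff[OF *(1,2)] assms[OF that] *(3) by simp
  then have "a \<in> carrier R - P" using x(2) * by blast
  then show "\<exists>y\<in>carrier L. x \<otimes>\<^bsub>L\<^esub> y = \<one>\<^bsub>L\<^esub>"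
    using * fr_inverse fr_closed by (intro bexI[of _ "fr s a"]) auto
qed

text \<open>The extended ideal in saturated form: a numerator need only lie in \<open>H\<close> up
  to a factor outside \<open>P\<close>. Elements are thus single fractions, and no sums of
  generators appear.\<close>

definition extension where
  "extension H = {fr a s | a s. a \<in> carrier R \<and> s \<in> carrier R - P \<and> (\<exists>u\<in>carrier R - P. u \<otimes> a \<in> H)}"

lemma extensionI:
  "a \<in> carrier R \<Longrightarrow> s \<in> carrier R - P \<Longrightarrow> u \<in> carrier R - P \<Longrightarrow> u \<otimes> a \<in> H \<Longrightarrow> fr a s \<in> extension H"
  unfolding extension_def by blast

lemma extensionE:
  assumes "x \<in> extension H"
  obtains a s u where "a \<in> carrier R" "s \<in> carrier R - P" "u \<in> carrier R - P" "u \<otimes> a \<in> H" "x = fr a s"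
  using assms unfolding extension_def by blast

lemma ideal_extension:
  assumes "ideal H R"
  shows "ideal (extension H) L"
proof (rule idealI)
  interpret H: ideal H R by fact
  have absorb: "y \<otimes>\<^bsub>L\<^esub> x \<in> extension H" if x: "x \<in> extension H" and y: "y \<in> carrier L" for x y
  proof -
    obtain a s u where a: "a \<in> carrier R" "s \<in> carrier R - P" "u \<in> carrier R - P" "u \<otimes> a \<in> H" "x = fr a s"
      using x by (rule extensionE)
    obtain b t where b: "b \<in> carrier R" "t \<in> carrier R - P" "y = fr b t"
      using y by (rule fr_cases)
    have "u \<otimes> (b \<otimes> a) = b \<otimes> (u \<otimes> a)" using a b by (auto intro: m_lcomm)
    also have "\<dots> \<in> H" by (rule H.I_l_closed[OF a(4) b(1)])
    finally have "fr (b \<otimes> a) (t \<otimes> s) \<in> extension H"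
      using a b P.compl_mult_closed by (intro extensionI[where u = u]) auto
    then show ?thesis using a b by (simp add: fr_mult)
  qed
  show "subgroup (extension H) (add_monoid L)"
  proof
    show "extension H \<subseteq> carrier (add_monoid L)" using fr_closed by (auto elim!: extensionE)
    show "\<one>\<^bsub>add_monoid L\<^esub> \<in> extension H"
      using H.zero_closed P.one_compl by (auto simp: L_zero intro!: extensionI[where u = \<one>])
    show "inv\<^bsub>add_monoid L\<^esub> x \<in> extension H" if "x \<in> extension H" for x
    proof -
      have x: "x \<in> carrier L" using that fr_closed by (auto elim!: extensionE)
      have "\<ominus>\<^bsub>L\<^esub> x = (\<ominus>\<^bsub>L\<^esub> \<one>\<^bsub>L\<^esub>) \<otimes>\<^bsub>L\<^esub> x" using x by (simp add: L.l_minus)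
      moreover have "(\<ominus>\<^bsub>L\<^esub> \<one>\<^bsub>L\<^esub>) \<otimes>\<^bsub>L\<^esub> x \<in> extension H" by (intro absorb that) simp
      ultimately show ?thesis unfolding a_inv_def by metis
    qed
    show "x \<otimes>\<^bsub>add_monoid L\<^esub> y \<in> extension H" if x: "x \<in> extension H" and y: "y \<in> extension H" for x y
    proof -
      obtain a s u where a: "a \<in> carrier R" "s \<in> carrier R - P" "u \<in> carrier R - P" "u \<otimes> a \<in> H" "x = fr a s"
        using x by (rule extensionE)
      obtain b t v where b: "b \<in> carrier R" "t \<in> carrier R - P" "v \<in> carrier R - P" "v \<otimes> b \<in> H" "y = fr b t"
        using y by (rule extensionE)
      have c: "a \<in> carrier R" "b \<in> carrier R" "s \<in> carrier R" "t \<in> carrier R" "u \<in> carrier R" "v \<in> carrier R"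
        using a b by auto
      have "(u \<otimes> v) \<otimes> (a \<otimes> t \<oplus> b \<otimes> s) = (v \<otimes> t) \<otimes> (u \<otimes> a) \<oplus> (u \<otimes> s) \<otimes> (v \<otimes> b)"
        using c by algebra
      also have "\<dots> \<in> H" using c by (intro H.a_closed H.I_l_closed[OF a(4)] H.I_l_closed[OF b(4)]) auto
      finally have "fr (a \<otimes> t \<oplus> b \<otimes> s) (s \<otimes> t) \<in> extension H"
        using a b P.compl_mult_closed by (intro extensionI[where u = "u \<otimes> v"]) auto
      then show ?thesis using a b by (simp add: fr_add)
    qed
  qed
  show "y \<otimes>\<^bsub>L\<^esub> x \<in> extension H" if "x \<in> extension H" "y \<in> carrier L" for x y
    using absorb[OF that] .
  show "x \<otimes>\<^bsub>L\<^esub> y \<in> extension H" if "x \<in> extension H" "y \<in> carrier L" for x y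
    using absorb[OF that] that fr_closed by (subst L.m_comm) (auto elim!: extensionE)
qed (rule L.ring_axioms)

text \<open>Regularity is brought back from the local ring to \<open>R\<close>: generators become
  their numerators and primes are contracted. Local generation is phrased through an arbitrary ideal
  \<open>H\<close>, so that it can later be tested on linear combinations modulo the square of
  \<open>P\<close>.\<close>

lemma regular_imp_chain_and_generators:
  assumes "regular_local_ring L"
  obtains d \<Gamma> and c :: "nat \<Rightarrow> 'a set" where "finite \<Gamma>" "\<Gamma> \<subseteq> P" "card \<Gamma> \<le> d"
    and "\<And>i. i \<le> d \<Longrightarrow> primeideal (c i) R" "\<And>i. i < d \<Longrightarrow> c i \<subset> c (Suc i)"
    and "J \<subseteq> c 0" "c d \<subseteq> P"
    and "\<And>H p. ideal H R \<Longrightarrow> J \<subseteq> H \<Longrightarrow> \<Gamma> \<subseteq> H \<Longrightarrow> p \<in> P \<Longrightarrow> \<exists>u\<in>carrier R - P. u \<otimes> p \<in> H"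
proof -
  obtain m G where m: "maximalideal m L" "\<And>m'. maximalideal m' L \<Longrightarrow> m' = m"
    and G: "G \<subseteq> carrier L" "finite G" "enat (card G) = krull_dim L" "m = Idl\<^bsub>L\<^esub> G"
    using assms unfolding regular_local_ring_def by metis
  define d where "d = card G"
  have ext_P: "x \<in> extension P \<longleftrightarrow> (\<exists>a\<in>P. \<exists>s\<in>carrier R - P. x = fr a s)" for x
  proof
    assume "x \<in> extension P"
    then obtain a s u where "a \<in> carrier R" "s \<in> carrier R - P" "u \<in> carrier R - P" "u \<otimes> a \<in> P" "x = fr a s"
      by (rule extensionE)
    then show "\<exists>a\<in>P. \<exists>s\<in>carrier R - P. x = fr a s" using P.I_prime by blast
  next
    assume "\<exists>a\<in>P. \<exists>s\<in>carrier R - P. x = fr a s"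
    then show "x \<in> extension P"
      using P.one_compl P.Icarr by (auto intro!: extensionI[where u = \<one>])
  qed
  have unit: "I = carrier L" if I: "ideal I L" and "fr a s \<in> I" "a \<in> carrier R - P" "s \<in> carrier R - P" for I a s
  proof -
    have "fr a s \<otimes>\<^bsub>L\<^esub> fr s a \<in> I" using that fr_closed by (intro ideal.I_r_closed[OF I]) auto
    then show ?thesis using that fr_inverse ideal.one_imp_carrier[OF I] by simp
  qed
  have not_ext: "fr a s \<notin> extension P" if as: "a \<in> carrier R - P" "s \<in> carrier R - P" for a s
  proof
    assume "fr a s \<in> extension P"
    then obtain b t where bt: "b \<in> P" "t \<in> carrier R - P" "fr a s = fr b t" using ext_P by blast
    then obtain u where u: "u \<in> carrier R - P" "u \<otimes> (a \<otimes> t \<ominus> b \<otimes> s) \<in> J"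
      using fr_eq_iff[of a s b t] as P.Icarr by auto
    have c: "a \<in> carrier R" "s \<in> carrier R" "b \<in> carrier R" "t \<in> carrier R" "u \<in> carrier R"
      using that bt u P.Icarr by auto
    have "u \<otimes> (a \<otimes> t) = u \<otimes> (a \<otimes> t \<ominus> b \<otimes> s) \<oplus> (u \<otimes> s) \<otimes> b" using c by algebra
    also have "\<dots> \<in> P"
      using u(2) J_subset P.I_l_closed[OF bt(1), of "u \<otimes> s"] c by (intro P.a_closed) auto
    finally show False using that bt u P.compl_mult_closed by (metis DiffD2)
  qed
  \<comment> \<open>Fractions with numerator outside \<open>P\<close> are units, so this ideal is
    maximal, and by uniqueness it is \<open>m\<close>.\<close>
  have "maximalideal (extension P) L"
  proof (rule maximalidealI[OF ideal_extension[OF P.is_ideal]])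
    show "carrier L \<noteq> extension P"
      using not_ext[OF P.one_compl P.one_compl] fr_closed[of \<one> \<one>] P.one_compl by auto
    fix I assume I: "ideal I L" "extension P \<subseteq> I" "I \<subseteq> carrier L"
    show "I = extension P \<or> I = carrier L"
    proof (rule disjCI)
      assume "I \<noteq> carrier L"
      have "x \<in> extension P" if x: "x \<in> I" for x
      proof -
        obtain a s where as: "a \<in> carrier R" "s \<in> carrier R - P" "x = fr a s"
          using fr_cases I(3) x by blast
        then have "a \<in> P" using unit[OF I(1), of a s] x \<open>I \<noteq> carrier L\<close> by auto
        then show ?thesis using as ext_P by blast
      qed
      then show "I = extension P" using I(2) by blast
    qed
  qed
  then have m_eq: "m = extension P" using m(2) by simp
  have "G \<subseteq> m" unfolding G(4) by (rule L.genideal_self[OF G(1)])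
  then have "\<forall>g\<in>G. \<exists>a. a \<in> P \<and> (\<exists>s\<in>carrier R - P. g = fr a s)"
    unfolding m_eq using ext_P by blast
  from bchoice[OF this] obtain num where num: "\<And>g. g \<in> G \<Longrightarrow> num g \<in> P"
    "\<And>g. g \<in> G \<Longrightarrow> \<exists>s\<in>carrier R - P. g = fr (num g) s" by blast
  \<comment> \<open>Different generators may share a numerator, so only an upper bound for the
    cardinality survives.\<close>
  define \<Gamma> where "\<Gamma> = num ` G"
  have \<Gamma>: "finite \<Gamma>" "\<Gamma> \<subseteq> P" "card \<Gamma> \<le> d"
    using G(2) num(1) by (auto simp: \<Gamma>_def d_def card_image_le)
  have gen: "\<exists>u\<in>carrier R - P. u \<otimes> p \<in> H"
    if H: "ideal H R" "J \<subseteq> H" "\<Gamma> \<subseteq> H" and p: "p \<in> P" for H p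
  proof -
    interpret H: ideal H R by fact
    have pR: "p \<in> carrier R" using p by (rule P.Icarr)
    have "g \<in> extension H" if g: "g \<in> G" for g
    proof -
      obtain s where s: "s \<in> carrier R - P" "g = fr (num g) s" using num(2)[OF g] by blast
      have "num g \<in> H" using H(3) g by (auto simp: \<Gamma>_def)
      then have "fr (num g) s \<in> extension H"
        using s P.one_compl H.Icarr by (intro extensionI[where u = \<one>]) auto
      then show ?thesis using s by simp
    qed
    then have "m \<subseteq> extension H"
      unfolding G(4) by (intro L.genideal_minimal ideal_extension H(1)) blast
    moreover have "fr p \<one> \<in> m" unfolding m_eq using p P.one_compl ext_P by blast
    ultimately have "fr p \<one> \<in> extension H" by blast
    then obtain a s u where a: "a \<in> carrier R" "s \<in> carrier R - P" "u \<in> carrier R - P"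
      "u \<otimes> a \<in> H" "fr p \<one> = fr a s" by (rule extensionE)
    then obtain v where v: "v \<in> carrier R - P" "v \<otimes> (p \<otimes> s \<ominus> a \<otimes> \<one>) \<in> J"
      using fr_eq_iff[OF pR P.one_compl a(1,2)] by blast
    have c: "a \<in> carrier R" "s \<in> carrier R" "u \<in> carrier R" "v \<in> carrier R" using a v by auto
    have "(u \<otimes> v \<otimes> s) \<otimes> p = u \<otimes> (v \<otimes> (p \<otimes> s \<ominus> a \<otimes> \<one>)) \<oplus> v \<otimes> (u \<otimes> a)"
      using c pR by algebra
    also have "\<dots> \<in> H"
      using v(2) H(2) c by (intro H.a_closed H.I_l_closed[OF a(4)] H.I_l_closed[of _ u]) auto
    finally show ?thesis using a v P.compl_mult_closed by blast
  qed
  have "primeideal m L" using L.maximalideal_prime m(1) by blast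
  moreover have "krull_dim L = enat d" using G(3) by (simp add: d_def)
  ultimately obtain c where c: "\<And>i. i \<le> d \<Longrightarrow> primeideal (c i) L" "\<And>i. i < d \<Longrightarrow> c i \<subset> c (Suc i)"
    using krull_dim_chain[of L d m] by blast
  define c' where "c' i = {a \<in> carrier R. fr a \<one> \<in> c i}" for i
  \<comment> \<open>Denominators are units, so membership in \<open>c i\<close> depends on the
    numerator alone. This keeps the contracted chain strict.\<close>
  have fr_c: "fr a s \<in> c i \<longleftrightarrow> a \<in> c' i" if "i \<le> d" "a \<in> carrier R" "s \<in> carrier R - P" for a s i
  proof -
    interpret ci: primeideal "c i" L using c(1) that by simp
    have "fr (a \<otimes> s) (s \<otimes> \<one>) = fr a \<one>"
      using that P.one_compl by (intro fr_eqI) auto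
    then have "fr a s \<otimes>\<^bsub>L\<^esub> fr s \<one> = fr a \<one>" "fr a \<one> \<otimes>\<^bsub>L\<^esub> fr \<one> s = fr a s"
      using that P.one_compl by (simp_all add: fr_mult)
    moreover have "fr s \<one> \<in> carrier L" "fr \<one> s \<in> carrier L"
      using that P.one_compl by (auto intro: fr_closed)
    ultimately show ?thesis using ci.I_r_closed that(2) by (metis (lifting) c'_def mem_Collect_eq)
  qed
  have fr_one_add: "fr (a \<oplus> b) \<one> = fr a \<one> \<oplus>\<^bsub>L\<^esub> fr b \<one>" and fr_one_mult: "fr (a \<otimes> b) \<one> = fr a \<one> \<otimes>\<^bsub>L\<^esub> fr b \<one>"
    if "a \<in> carrier R" "b \<in> carrier R" for a b
    using that P.one_compl by (auto simp: fr_add fr_mult)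
  have one_L: "fr a \<one> \<in> carrier L" if "a \<in> carrier R" for a
    using that P.one_compl by (intro fr_closed)
  have prime: "primeideal (c' i) R" if "i \<le> d" for i
  proof (rule primeidealI)
    interpret ci: primeideal "c i" L using c(1) that by simp
    show "ideal (c' i) R"
    proof (rule idealI)
      show "subgroup (c' i) (add_monoid R)"
      proof
        show "\<one>\<^bsub>add_monoid R\<^esub> \<in> c' i" using ci.zero_closed by (simp add: c'_def L_zero)
        show "x \<otimes>\<^bsub>add_monoid R\<^esub> y \<in> c' i" if "x \<in> c' i" "y \<in> c' i" for x y
          using that by (auto simp: c'_def fr_one_add)
        show "inv\<^bsub>add_monoid R\<^esub> x \<in> c' i" if "x \<in> c' i" for x
        proof -
          have x: "x \<in> carrier R" "fr x \<one> \<in> c i" using that by (auto simp: c'_def)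
          have "\<ominus> x = (\<ominus> \<one>) \<otimes> x" using x by (simp add: l_minus)
          then have "fr (\<ominus> x) \<one> = fr (\<ominus> \<one>) \<one> \<otimes>\<^bsub>L\<^esub> fr x \<one>" using x by (simp add: fr_one_mult)
          then show ?thesis using x ci.I_l_closed[OF x(2) one_L] by (simp add: c'_def a_inv_def[symmetric])
        qed
      qed (auto simp: c'_def)
      show "x \<otimes> a \<in> c' i" "a \<otimes> x \<in> c' i" if "a \<in> c' i" "x \<in> carrier R" for a x
        using that ci.I_l_closed ci.I_r_closed one_L by (auto simp: c'_def fr_one_mult)
    qed (rule ring_axioms)
    show "carrier R \<noteq> c' i"
      using ci.I_notcarr ci.one_imp_carrier one_closed by (auto simp: c'_def L_one)
    show "a \<in> c' i \<or> b \<in> c' i" if "a \<in> carrier R" "b \<in> carrier R" "a \<otimes> b \<in> c' i" for a b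
      using that ci.I_prime[OF one_L one_L, of a b] by (auto simp: c'_def fr_one_mult)
  qed (rule is_cring)
  have chain: "c' i \<subset> c' (Suc i)" if i: "i < d" for i
  proof
    show "c' i \<subseteq> c' (Suc i)" using c(2)[OF i] by (auto simp: c'_def)
    obtain x where x: "x \<in> c (Suc i)" "x \<notin> c i" using c(2)[OF i] by blast
    moreover have "x \<in> carrier L" using x(1) c(1)[of "Suc i"] that
      by (meson Suc_leI ideal.Icarr primeideal.axioms(1))
    then obtain a s where "a \<in> carrier R" "s \<in> carrier R - P" "x = fr a s" by (rule fr_cases)
    ultimately show "c' i \<noteq> c' (Suc i)" using fr_c[of i a s] fr_c[of "Suc i" a s] that by auto
  qed
  have J_c: "J \<subseteq> c' 0"
  proof
    fix a assume a: "a \<in> J"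
    then have aR: "a \<in> carrier R" by (rule J.Icarr)
    have "fr a \<one> = \<zero>\<^bsub>L\<^esub>" using a aR P.one_compl by (subst fr_eq_zero_iff) (auto intro!: bexI[of _ \<one>])
    moreover have "\<zero>\<^bsub>L\<^esub> \<in> c 0"
      using c(1)[of 0] by (meson additive_subgroup.zero_closed ideal.axioms(1) le0 primeideal.axioms(1))
    ultimately show "a \<in> c' 0" using aR by (simp add: c'_def)
  qed
  have c_P: "c' d \<subseteq> P"
  proof (rule ccontr)
    assume "\<not> c' d \<subseteq> P"
    then obtain a where a: "a \<in> carrier R - P" "fr a \<one> \<in> c d" by (auto simp: c'_def)
    have "primeideal (c d) L" using c(1) by simp
    then show False using unit[OF _ a(2,1)] P.one_compl primeideal.axioms(1) primeideal.I_notcarr by metis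
  qed
  show ?thesis using that[OF \<Gamma> prime chain J_c c_P gen] .
qed

end

section \<open>Irredundant intersections of primes\<close>

lemma (in primeideal) nat_pow_mem_iff:
  assumes "a \<in> carrier R"
  shows "a [^] n \<in> I \<longleftrightarrow> a \<in> I \<and> n \<noteq> (0::nat)"
proof (induction n)
  case 0
  show ?case using one_compl by simp
next
  case (Suc n)
  have "a [^] Suc n \<in> I \<longleftrightarrow> a [^] n \<in> I \<or> a \<in> I"
    using assms I_prime[of "a [^] n" a] I_l_closed[of a "a [^] n"] I_r_closed[of "a [^] n" a] by auto
  then show ?case using Suc by auto
qed

lemma (in primeideal) radical_eq: "radical R I = I"
  unfolding radical_def using Icarr nat_pow_mem_iff by (auto intro!: exI[of _ 1])

lemma (in primeideal) primary: "primary_ideal I R"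
  unfolding primary_ideal_def radical_eq using is_ideal I_notcarr I_prime by auto

text \<open>Irredundancy is given by elements that lie in all of the primes but one; the same
  elements serve as multipliers in the uniqueness proof.\<close>

locale irredundant_primes = cring R for R :: "('a, 'b) ring_scheme" (structure) +
  fixes K :: "'i set" and Q :: "'i \<Rightarrow> 'a set"
  assumes finite_K: "finite K"
    and prime: "k \<in> K \<Longrightarrow> primeideal (Q k) R"
    and separating: "k \<in> K \<Longrightarrow> \<exists>u\<in>carrier R. u \<notin> Q k \<and> (\<forall>l\<in>K - {k}. u \<in> Q l)"
begin

definition meet where "meet = carrier R \<inter> (\<Inter>k\<in>K. Q k)"

lemma irredundant_primary_decomposition: "irredundant_primary_decomposition R meet K Q"
  unfolding irredundant_primary_decomposition_def
proof (intro conjI ballI)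
  show "primary_ideal (Q k) R" if "k \<in> K" for k
    using prime[OF that] by (rule primeideal.primary)
  show "inj_on (\<lambda>k. radical R (Q k)) K"
  proof (rule inj_onI)
    fix k l assume kl: "k \<in> K" "l \<in> K" "radical R (Q k) = radical R (Q l)"
    then have "Q k = Q l" using prime primeideal.radical_eq by metis
    then show "k = l" using separating[OF kl(1)] kl by blast
  qed
  show "carrier R \<inter> (\<Inter>l\<in>K - {k}. Q l) \<noteq> meet" if k: "k \<in> K" for k
    using separating[OF k] k by (auto simp: meet_def)
qed (simp_all add: finite_K meet_def)

text \<open>Components are isolated by multipliers: a suitable \<open>b\<close> lies in every
  component of both decompositions except \<open>Q' i\<close> and one \<open>Q k\<close>, which
  forces these two to coincide.\<close>

lemma primary_decomposition_unique:
  assumes "irredundant_primary_decomposition R meet K' Q'"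
  shows "Q' ` K' = Q ` K"
proof -
  from assms have fin: "finite K'" and primary: "\<And>i. i \<in> K' \<Longrightarrow> primary_ideal (Q' i) R"
    and eq: "meet = carrier R \<inter> (\<Inter>i\<in>K'. Q' i)"
    and irred: "\<And>i. i \<in> K' \<Longrightarrow> carrier R \<inter> (\<Inter>j\<in>K' - {i}. Q' j) \<noteq> meet"
    by (auto simp: irredundant_primary_decomposition_def)
  have "Q' i \<in> Q ` K" if i: "i \<in> K'" for i
  proof -
    have "ideal (Q' i) R"
      and prim: "\<And>a b. a \<in> carrier R \<Longrightarrow> b \<in> carrier R \<Longrightarrow> a \<otimes> b \<in> Q' i \<Longrightarrow> a \<in> Q' i \<or> b \<in> radical R (Q' i)"
      using primary[OF i] by (auto simp: primary_ideal_def)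
    then interpret Q': ideal "Q' i" R by simp
    have ideal_j: "ideal (Q' j) R" if "j \<in> K'" for j using primary[OF that] by (simp add: primary_ideal_def)
    obtain a where a: "a \<in> carrier R" "\<And>j. j \<in> K' - {i} \<Longrightarrow> a \<in> Q' j" "a \<notin> meet"
      using irred[OF i] eq by blast
    then obtain k where k: "k \<in> K" "a \<notin> Q k" by (auto simp: meet_def)
    interpret Qk: primeideal "Q k" R by (rule prime[OF k(1)])
    obtain u where u: "u \<in> carrier R" "u \<notin> Q k" "\<And>l. l \<in> K - {k} \<Longrightarrow> u \<in> Q l"
      using separating[OF k(1)] by blast
    define b where "b = u \<otimes> a"
    have b: "b \<in> carrier R" "b \<notin> Q k" using a u k Qk.I_prime by (auto simp: b_def)
    have mult_meet: "f \<otimes> v \<in> meet" if "f \<in> Q k" "v \<in> carrier R" "\<And>l. l \<in> K - {k} \<Longrightarrow> v \<in> Q l" for f v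
    proof -
      have "f \<in> carrier R" using that by (intro Qk.Icarr)
      moreover have "f \<otimes> v \<in> Q l" if "l \<in> K" for l
        using that \<open>f \<in> Q k\<close> \<open>v \<in> carrier R\<close> \<open>f \<in> carrier R\<close> \<open>\<And>l. l \<in> K - {k} \<Longrightarrow> v \<in> Q l\<close>
          Qk.I_r_closed ideal.I_l_closed[OF primeideal.axioms(1)[OF prime[OF that]]]
        by (cases "l = k") auto
      ultimately show ?thesis using that by (simp add: meet_def)
    qed
    have bQ: "b \<in> Q l" if "l \<in> K - {k}" for l
      unfolding b_def using u(3)[OF that] a(1) that prime
      by (intro ideal.I_r_closed) (auto intro: primeideal.axioms(1))
    have bQ': "b \<in> Q' j" if "j \<in> K' - {i}" for j
      unfolding b_def using a(2)[OF that] u(1) that ideal_j by (intro ideal.I_l_closed) auto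
    have "b \<notin> meet" using b(2) k(1) by (auto simp: meet_def)
    then have "b \<notin> Q' i" using b(1) bQ' eq by blast
    \<comment> \<open>Multiplication by \<open>b\<close> carries \<open>Q k\<close> into the
      intersection and hence into \<open>Q' i\<close>, which does not contain \<open>b\<close>.
      Conversely, if a power of \<open>f\<close> lies in \<open>Q' i\<close>, its product with
      \<open>b\<close> lies in the intersection, hence in \<open>Q k\<close>, which does not contain
      \<open>b\<close> either.\<close>
    have rad: "radical R (Q' i) = Q k"
    proof
      show "Q k \<subseteq> radical R (Q' i)"
      proof
        fix f assume f: "f \<in> Q k"
        then have "b \<otimes> f \<in> meet" using mult_meet[OF f b(1) bQ] Qk.Icarr[OF f] b(1) by (simp add: m_comm)
        then have "b \<otimes> f \<in> Q' i" using eq i by blast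
        then show "f \<in> radical R (Q' i)" using prim[OF b(1) Qk.Icarr[OF f]] \<open>b \<notin> Q' i\<close> by blast
      qed
      show "radical R (Q' i) \<subseteq> Q k"
      proof
        fix f assume "f \<in> radical R (Q' i)"
        then obtain n :: nat where f: "f \<in> carrier R" "f [^] n \<in> Q' i" by (auto simp: radical_def)
        have "f [^] n \<otimes> b \<in> Q' j" if "j \<in> K'" for j
        proof (cases "j = i")
          case True
          then show ?thesis using f b Q'.I_r_closed by simp
        next
          case False
          then show ?thesis using that bQ'[of j] f ideal.I_l_closed[OF ideal_j[OF that]] by auto
        qed
        then have "f [^] n \<otimes> b \<in> meet" using f b eq by auto
        then have "f [^] n \<otimes> b \<in> Q k" using k(1) by (auto simp: meet_def)
        then show "f \<in> Q k" using f b Qk.I_prime Qk.nat_pow_mem_iff by (metis nat_pow_closed)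
      qed
    qed
    \<comment> \<open>The multiplier \<open>u\<close> avoids the radical, so primariness sharpens
      the inclusion from the radical to \<open>Q' i\<close> itself.\<close>
    have "Q k \<subseteq> Q' i"
    proof
      fix f assume f: "f \<in> Q k"
      have "f \<otimes> u \<in> Q' i" using mult_meet[OF f u(1) u(3)] eq i by blast
      then show "f \<in> Q' i" using prim[OF Qk.Icarr[OF f] u(1)] rad u(2) by blast
    qed
    moreover have "Q' i \<subseteq> radical R (Q' i)"
      using Q'.Icarr by (auto simp: radical_def intro!: exI[of _ "1::nat"])
    ultimately show ?thesis using rad k(1) by blast
  qed
  \<comment> \<open>If \<open>Q k\<close> were missing, its multiplier \<open>u\<close> would lie in
    all components and thus in the intersection.\<close>
  moreover have "Q k \<in> Q' ` K'" if k: "k \<in> K" for k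
  proof (rule ccontr)
    assume "Q k \<notin> Q' ` K'"
    then have sub: "Q' ` K' \<subseteq> Q ` (K - {k})" using \<open>\<And>i. i \<in> K' \<Longrightarrow> Q' i \<in> Q ` K\<close> by force
    obtain u where u: "u \<in> carrier R" "u \<notin> Q k" "\<And>l. l \<in> K - {k} \<Longrightarrow> u \<in> Q l"
      using separating[OF k] by blast
    have "u \<in> Q' i" if "i \<in> K'" for i using sub that u(3) by blast
    then have "u \<in> meet" using u(1) eq by blast
    then show False using u(2) k by (auto simp: meet_def)
  qed
  ultimately show ?thesis by blast
qed

end

section \<open>Minimal vertex covers\<close>

lemma minimal_vertex_cover_subset:
  assumes "finite X" "vertex_cover X E U"
  obtains V where "minimal_vertex_cover X E V" "V \<subseteq> U"
proof -
  have "finite U" using assms by (auto simp: vertex_cover_def intro: finite_subset)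
  then have "vertex_cover X E U \<Longrightarrow> \<exists>V. minimal_vertex_cover X E V \<and> V \<subseteq> U"
  proof (induction U rule: finite_psubset_induct)
    case (psubset U)
    show ?case
    proof (cases "minimal_vertex_cover X E U")
      case False
      then obtain V where "V \<subset> U" "vertex_cover X E V"
        using psubset.prems by (auto simp: minimal_vertex_cover_def)
      then show ?thesis using psubset.IH[of V] by blast
    qed blast
  qed
  then show ?thesis using assms that by blast
qed

text \<open>One variable outside \<open>P\<close> is taken from each \<open>V\<close>; their product
  stays outside \<open>P\<close> because \<open>P\<close> is prime.\<close>

lemma exists_separating_monomial:
  fixes P :: "('x, 'k::field) mpol set"
  assumes "prime_in (mpolys X) P" "finite \<V>"
    and "\<And>V. V \<in> \<V> \<Longrightarrow> \<exists>x\<in>V. x \<in> X \<and> mvar x \<notin> P"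
  obtains u where "u \<in> mpolys X" "u \<notin> P" "\<And>V. V \<in> \<V> \<Longrightarrow> u \<in> var_ideal X V"
proof -
  interpret P: prime_in "mpolys X" P by fact
  from assms(3) obtain x where x: "\<And>V. V \<in> \<V> \<Longrightarrow> x V \<in> V \<and> x V \<in> X \<and> mvar (x V) \<notin> P" by metis
  show ?thesis
  proof (rule that[of "\<Prod>V\<in>\<V>. mvar (x V)"])
    show "(\<Prod>V\<in>\<V>. mvar (x V)) \<in> mpolys X" by (intro mpolys.prod_in) (use x in auto)
    show "(\<Prod>V\<in>\<V>. mvar (x V)) \<notin> P" by (intro P.prod_notin) (use x in auto)
    fix V assume V: "V \<in> \<V>"
    interpret V: ideal_in "mpolys X" "var_ideal X V :: ('x, 'k) mpol set" by (rule ideal_in_var_ideal)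
    show "(\<Prod>V\<in>\<V>. mvar (x V) :: ('x, 'k) mpol) \<in> var_ideal X V"
      by (rule V.prod[OF assms(2) V])
        (use x V in \<open>auto simp: mvar_in_var_ideal\<close>)
  qed
qed

lemma var_ideal_subset:
  fixes P :: "('x, 'k::field) mpol set"
  assumes "ideal_in (mpolys X) P" "V \<subseteq> X"
  shows "var_ideal X V \<subseteq> P \<longleftrightarrow> mvar ` V \<subseteq> P"
proof -
  interpret R: cring "mpoly_ring X :: ('x, 'k) mpol ring" by (rule cring_mpoly_ring)
  have "mvar ` V \<subseteq> carrier (mpoly_ring X :: ('x, 'k) mpol ring)" using assms(2) by auto
  moreover have "ideal P (mpoly_ring X)" using assms(1) by (simp add: ideal_mpoly_ring)
  ultimately show ?thesis using R.Idl_subset_ideal genideal_mvar[OF assms(2)] by metis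
qed

text \<open>The parameter \<open>field_type\<close> only serves to fix the coefficient field.\<close>
locale finite_hypergraph =
  fixes X :: "'x set" and E :: "'x set set" and field_type :: "'k::field itself"
  assumes finite_X: "finite X" and edges: "E \<subseteq> Pow X"
begin

definition covers where "covers = {V. minimal_vertex_cover X E V}"

lemma covers_subset: "V \<in> covers \<Longrightarrow> V \<subseteq> X"
  by (auto simp: covers_def minimal_vertex_cover_def vertex_cover_def)

lemma finite_cover: "V \<in> covers \<Longrightarrow> finite V"
  using covers_subset finite_X finite_subset by blast

lemma finite_covers: "finite covers"
  using covers_subset finite_X by (intro finite_subset[of covers "Pow X"]) auto

lemma covers_antichain: "V \<in> covers \<Longrightarrow> V' \<in> covers \<Longrightarrow> V \<subseteq> V' \<Longrightarrow> V = V'"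
  by (auto simp: covers_def minimal_vertex_cover_def)

abbreviation "R \<equiv> mpoly_ring X :: ('x, 'k) mpol ring"
abbreviation "edge_id \<equiv> edge_ideal X E :: ('x, 'k) mpol set"

lemma edges_closed: "(\<lambda>e. \<Prod>x\<in>e. mvar x) ` E \<subseteq> carrier R"
  using edges by (auto intro!: mpolys.prod_in) blast

lemma edge_ideal_subset_var_ideal:
  assumes "V \<in> covers" shows "edge_id \<subseteq> var_ideal X V"
proof -
  interpret R: cring R by (rule cring_mpoly_ring)
  interpret V: ideal_in "mpolys X" "var_ideal X V :: ('x, 'k) mpol set" by (rule ideal_in_var_ideal)
  have "(\<Prod>x\<in>e. mvar x :: ('x, 'k) mpol) \<in> var_ideal X V" if e: "e \<in> E" for e
  proof -
    have eX: "e \<subseteq> X" using e edges by blast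
    have "finite e" using eX finite_X by (rule finite_subset)
    have "V \<inter> e \<noteq> {}"
      using e assms by (simp add: covers_def minimal_vertex_cover_def vertex_cover_def)
    then obtain x where x: "x \<in> V" "x \<in> e" by blast
    show ?thesis
      by (rule V.prod[OF \<open>finite e\<close> x(2)]) (use x eX in \<open>auto simp: mvar_in_var_ideal\<close>)
  qed
  then show ?thesis unfolding edge_ideal_def
    by (intro R.genideal_minimal) (auto simp: ideal_mpoly_ring ideal_in_var_ideal)
qed

text \<open>A prime containing the product over an edge contains one of its variables, so the
  variables in \<open>P\<close> form a vertex cover.\<close>

lemma exists_cover_in_prime:
  assumes P: "prime_in (mpolys X) P" and "edge_id \<subseteq> P"
  obtains V where "V \<in> covers" "mvar ` V \<subseteq> P"
proof -
  interpret R: cring R by (rule cring_mpoly_ring)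
  interpret P: prime_in "mpolys X" P by fact
  have "vertex_cover X E {x \<in> X. mvar x \<in> P}"
    unfolding vertex_cover_def
  proof (intro conjI ballI)
    fix e assume e: "e \<in> E"
    have "(\<Prod>x\<in>e. mvar x) \<in> P"
      using R.genideal_self[OF edges_closed] e assms(2) unfolding edge_ideal_def by blast
    then have "\<exists>x\<in>e. mvar x \<in> P" using P.prod_notin[of e mvar] e edges by auto
    then show "{x \<in> X. mvar x \<in> P} \<inter> e \<noteq> {}" using e edges by blast
  qed auto
  then obtain V where "minimal_vertex_cover X E V" "V \<subseteq> {x \<in> X. mvar x \<in> P}"
    using minimal_vertex_cover_subset[OF finite_X] by blast
  then show ?thesis by (intro that[of V]) (auto simp: covers_def)
qed

section \<open>The zero locus of the edge ideal and its nonsingular points\<close>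

definition cover_meet :: "('x, 'k) mpol set" where
  "cover_meet = {f \<in> mpolys X. \<forall>V\<in>covers. f \<in> var_ideal X V}"

abbreviation "Z \<equiv> vanishing_locus R edge_id"

lemma in_Z: "P \<in> Z \<longleftrightarrow> prime_in (mpolys X) P \<and> edge_id \<subseteq> P"
  by (simp add: vanishing_locus_def Spec_def primeideal_mpoly_ring)

lemma var_ideal_in_Z: "V \<in> covers \<Longrightarrow> var_ideal X V \<in> Z"
  by (simp add: in_Z prime_in_var_ideal edge_ideal_subset_var_ideal)

text \<open>The ideals of the covers are themselves points of \<open>Z\<close>, and every point
  contains one of them. So vanishing on \<open>Z\<close> is tested at these finitely many points,
  without computing a radical.\<close>

lemma vanishing_ideal_Z: "vanishing_ideal R Z = cover_meet"
proof
  show "vanishing_ideal R Z \<subseteq> cover_meet"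
    using var_ideal_in_Z by (auto simp: vanishing_ideal_def cover_meet_def)
  show "cover_meet \<subseteq> vanishing_ideal R Z"
  proof
    fix f assume f: "f \<in> cover_meet"
    have "f \<in> P" if "P \<in> Z" for P
    proof -
      have P: "prime_in (mpolys X) P" "edge_id \<subseteq> P" using that in_Z by auto
      obtain V where V: "V \<in> covers" "mvar ` V \<subseteq> P" using exists_cover_in_prime[OF P] by blast
      then have "var_ideal X V \<subseteq> P"
        using var_ideal_subset[OF prime_in.axioms(1)[OF P(1)] covers_subset] by blast
      then show ?thesis using f V by (auto simp: cover_meet_def)
    qed
    then show "f \<in> vanishing_ideal R Z" using f by (auto simp: vanishing_ideal_def cover_meet_def)
  qed
qed

lemma edge_ideal_subset_cover_meet: "edge_id \<subseteq> cover_meet"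
proof -
  interpret R: cring R by (rule cring_mpoly_ring)
  have "edge_id \<subseteq> mpolys X" unfolding edge_ideal_def
    using ideal.Icarr[OF R.genideal_ideal[OF edges_closed]] by auto
  then show ?thesis using edge_ideal_subset_var_ideal by (auto simp: cover_meet_def)
qed

lemma cover_meet_subset: "P \<in> Z \<Longrightarrow> cover_meet \<subseteq> P"
  using vanishing_ideal_Z by (auto simp: vanishing_ideal_def)

lemma ideal_in_cover_meet: "ideal_in (mpolys X) cover_meet"
proof -
  have *: "ideal_in (mpolys X) (var_ideal X V :: ('x, 'k) mpol set)" for V by (rule ideal_in_var_ideal)
  show ?thesis
    by unfold_locales
      (auto simp: cover_meet_def intro: mpolys.add_in mpolys.mult_in ideal_in.zero[OF *]
        ideal_in.add[OF *] ideal_in.absorb[OF *])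
qed

lemma quotient_localization:
  assumes "P \<in> Z" shows "quotient_localization R cover_meet P"
proof -
  have "ideal cover_meet R" by (simp add: ideal_mpoly_ring ideal_in_cover_meet)
  moreover have "primeideal P R" using assms in_Z by (simp add: primeideal_mpoly_ring)
  ultimately show ?thesis
    using cover_meet_subset[OF assms] cring_mpoly_ring
    by (auto simp: quotient_localization_def quotient_localization_axioms_def)
qed

lemma reduced_local_ring_Z:
  "reduced_local_ring R Z P = localization (R Quot cover_meet) ((\<lambda>a. cover_meet +>\<^bsub>R\<^esub> a) ` P)"
  by (simp add: reduced_local_ring_def vanishing_ideal_Z Let_def)

text \<open>Locally at a prime that contains no cover other than \<open>V\<close>, the intersection
  agrees with the ideal of \<open>V\<close>. The element \<open>u\<close> is a product of variables
  from the other covers.\<close>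

lemma exists_separating_element:
  assumes P: "prime_in (mpolys X) P" and V: "V \<in> covers"
    and other: "\<And>V'. V' \<in> covers \<Longrightarrow> mvar ` V' \<subseteq> P \<Longrightarrow> V' = V"
  obtains u where "u \<in> mpolys X" "u \<notin> P" "\<And>f. f \<in> var_ideal X V \<Longrightarrow> u * f \<in> cover_meet"
proof -
  have "\<exists>x\<in>V'. x \<in> X \<and> mvar x \<notin> P" if "V' \<in> covers - {V}" for V'
    using that other[of V'] covers_subset by blast
  with exists_separating_monomial[OF P, of "covers - {V}"] finite_covers
  obtain u where u: "u \<in> mpolys X" "u \<notin> P" "\<And>V'. V' \<in> covers - {V} \<Longrightarrow> u \<in> var_ideal X V'" by blast
  have "u * f \<in> cover_meet" if f: "f \<in> var_ideal X V" for f
  proof -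
    have fX: "f \<in> mpolys X" using f by (simp add: var_ideal_def)
    have "u * f \<in> var_ideal X V'" if V': "V' \<in> covers" for V'
    proof (cases "V' = V")
      case True
      then show ?thesis using ideal_in.absorb[OF ideal_in_var_ideal u(1) f] by simp
    next
      case False
      then show ?thesis using ideal_in.absorb2[OF ideal_in_var_ideal fX u(3)[of V']] V' by simp
    qed
    then show ?thesis using u fX by (simp add: cover_meet_def mpolys.mult_in)
  qed
  then show ?thesis using that u by blast
qed

text \<open>Covers form an antichain, so this prime contains no second one; by
  \<open>exists_separating_element\<close> it becomes zero in the local ring.\<close>

lemma var_ideal_nonsingular:
  assumes V: "V \<in> covers" shows "var_ideal X V \<notin> singular_locus R Z"
proof -
  let ?P = "var_ideal X V :: ('x, 'k) mpol set"
  interpret q: quotient_localization R cover_meet ?P by (rule quotient_localization[OF var_ideal_in_Z[OF V]])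
  have "V' = V" if "V' \<in> covers" "mvar ` V' \<subseteq> ?P" for V'
  proof -
    have "V' \<subseteq> V" using that(2) by (auto simp: mvar_in_var_ideal)
    then show ?thesis using covers_antichain that(1) V by blast
  qed
  from exists_separating_element[OF prime_in_var_ideal V this]
  obtain u where u: "u \<in> mpolys X" "u \<notin> ?P" "\<And>f. f \<in> ?P \<Longrightarrow> u * f \<in> cover_meet" by blast
  have "regular_local_ring q.L"
    by (rule q.regular_at_minimal_prime) (use u in auto)
  then show ?thesis by (simp add: singular_locus_def reduced_local_ring_Z)
qed

text \<open>Let \<open>T\<close> be the intersection of the covers in \<open>P\<close>. Modulo the square of \<open>P\<close> the ideal
  of the covers is generated by \<open>T\<close>. So if the local ring of dimension \<open>d\<close> is regular, then \<open>P\<close>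
  is locally generated by \<open>d + card T\<close> elements, while prepending the ideals generated by the
  initial segments of a cover \<open>U\<close> to a chain of length \<open>d\<close> shows that its height is at least
  \<open>card U + d\<close>.\<close>
lemma nonsingular_unique_cover:
  assumes P: "P \<in> Z" "P \<notin> singular_locus R Z"
    and V: "V \<in> covers" "mvar ` V \<subseteq> P" and V': "V' \<in> covers" "mvar ` V' \<subseteq> P"
  shows "V = V'"
proof -
  interpret q: quotient_localization R cover_meet P by (rule quotient_localization[OF P(1)])
  have primeP: "prime_in (mpolys X) P" using P in_Z by blast
  interpret P: prime_in "mpolys X" P by fact
  interpret sP: ideal_in "mpolys X" "ideal_square P" by (rule P.ideal_in_ideal_square)
  have "regular_local_ring q.L" using P by (simp add: singular_locus_def reduced_local_ring_Z)
  then obtain d \<Gamma> c where \<Gamma>: "finite \<Gamma>" "\<Gamma> \<subseteq> P" "card \<Gamma> \<le> d"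
    and c: "\<And>i. i \<le> d \<Longrightarrow> primeideal (c i) R" "\<And>i. i < d \<Longrightarrow> c i \<subset> c (Suc i)"
      "cover_meet \<subseteq> c 0" "c d \<subseteq> P"
    and gen: "\<And>H p. ideal H R \<Longrightarrow> cover_meet \<subseteq> H \<Longrightarrow> \<Gamma> \<subseteq> H \<Longrightarrow> p \<in> P \<Longrightarrow>
      \<exists>u\<in>carrier R - P. u \<otimes>\<^bsub>R\<^esub> p \<in> H"
    using q.regular_imp_chain_and_generators[of thesis] by blast
  have prime_c: "prime_in (mpolys X) (c i)" if "i \<le> d" for i
    using c(1)[OF that] by (simp add: primeideal_mpoly_ring)
  have "edge_id \<subseteq> c 0" using edge_ideal_subset_cover_meet c(3) by blast
  \<comment> \<open>\<open>U\<close> is taken inside the bottom of the chain, not merely inside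
    \<open>P\<close>, so that the chain can be prolonged downwards through ideals generated by parts
    of \<open>U\<close>.\<close>
  then obtain U where U: "U \<in> covers" "mvar ` U \<subseteq> c 0"
    using exists_cover_in_prime[of "c 0"] prime_c[of 0] by auto
  have "c 0 \<subseteq> c i" if "i \<le> d" for i
    using that
  proof (induction i)
    case (Suc i)
    then show ?case using c(2)[of i] by auto
  qed simp
  then have c0_P: "c 0 \<subseteq> P" using c(4) by blast
  define CP where "CP = {V \<in> covers. mvar ` V \<subseteq> P}"
  have U_CP: "U \<in> CP" using U c0_P by (auto simp: CP_def)
  define T where "T = \<Inter>CP"
  have TU: "T \<subseteq> U" using U_CP by (auto simp: T_def)
  have finite_U: "finite U" and UX: "U \<subseteq> X" using U finite_cover covers_subset by auto
  have finite_T: "finite T" using TU finite_U by (rule finite_subset)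
  define \<Delta> where "\<Delta> = \<Gamma> \<union> mvar ` T"
  have "mvar ` T \<subseteq> P" using TU U c0_P by blast
  then have \<Delta>: "finite \<Delta>" "\<Delta> \<subseteq> P" using \<Gamma> finite_T by (auto simp: \<Delta>_def)
  have "card \<Delta> \<le> card \<Gamma> + card (mvar ` T :: ('x, 'k) mpol set)"
    unfolding \<Delta>_def by (rule card_Un_le)
  also have "\<dots> \<le> d + card T" using \<Gamma>(3) finite_T by (intro add_mono card_image_le)
  finally have card_\<Delta>: "card \<Delta> \<le> d + card T" .
  \<comment> \<open>The linear combinations of \<open>\<Delta>\<close> modulo the square of
    \<open>P\<close>: the ideal to which \<open>gen\<close> will be applied.\<close>
  define H where "H = {f \<in> mpolys X. \<exists>b. (\<forall>g\<in>\<Delta>. b g \<in> mpolys X) \<and> f - (\<Sum>g\<in>\<Delta>. b g * g) \<in> ideal_square P}"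
  have "ideal_in (mpolys X) H"
  proof
    show "0 \<in> H" unfolding H_def by (auto intro!: exI[of _ "\<lambda>_. 0"] simp: sP.zero)
  next
    fix f g :: "('x, 'k) mpol"
    assume "f \<in> H" "g \<in> H"
    then obtain b b' where b: "\<forall>g\<in>\<Delta>. b g \<in> mpolys X" "f - (\<Sum>g\<in>\<Delta>. b g * g) \<in> ideal_square P"
      and b': "\<forall>g\<in>\<Delta>. b' g \<in> mpolys X" "g - (\<Sum>g\<in>\<Delta>. b' g * g) \<in> ideal_square P"
      and fg: "f \<in> mpolys X" "g \<in> mpolys X" by (auto simp: H_def)
    have "(f + g) - (\<Sum>g\<in>\<Delta>. (b g + b' g) * g) = (f - (\<Sum>g\<in>\<Delta>. b g * g)) + (g - (\<Sum>g\<in>\<Delta>. b' g * g))"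
      by (simp add: distrib_right sum.distrib)
    then have "(f + g) - (\<Sum>g\<in>\<Delta>. (b g + b' g) * g) \<in> ideal_square P" using sP.add[OF b(2) b'(2)] by (simp only:)
    then show "f + g \<in> H"
      using b(1) b'(1) fg unfolding H_def by (auto intro!: exI[of _ "\<lambda>g. b g + b' g"] mpolys.add_in)
  next
    fix a f :: "('x, 'k) mpol"
    assume a: "a \<in> mpolys X" and "f \<in> H"
    then obtain b where b: "\<forall>g\<in>\<Delta>. b g \<in> mpolys X" "f - (\<Sum>g\<in>\<Delta>. b g * g) \<in> ideal_square P"
      and f: "f \<in> mpolys X" by (auto simp: H_def)
    have "a * f - (\<Sum>g\<in>\<Delta>. (a * b g) * g) = a * (f - (\<Sum>g\<in>\<Delta>. b g * g))"
      by (simp add: right_diff_distrib sum_distrib_left mult.assoc)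
    then have "a * f - (\<Sum>g\<in>\<Delta>. (a * b g) * g) \<in> ideal_square P" using sP.absorb[OF a b(2)] by (simp only:)
    then show "a * f \<in> H"
      using a b(1) f unfolding H_def by (auto intro!: exI[of _ "\<lambda>g. a * b g"] mpolys.mult_in)
  qed (auto simp: H_def)
  then interpret H: ideal_in "mpolys X" H .
  have \<Delta>H: "\<Delta> \<subseteq> H"
  proof
    fix g assume g: "g \<in> \<Delta>"
    have "(\<Sum>h\<in>\<Delta>. (if h = g then 1 else 0) * h) = (\<Sum>h\<in>\<Delta>. if h = g then g else 0)"
      by (intro sum.cong) auto
    also have "\<dots> = g" using g \<Delta>(1) by simp
    finally have "g - (\<Sum>h\<in>\<Delta>. (if h = g then 1 else 0) * h) \<in> ideal_square P" using sP.zero by simp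
    moreover have "g \<in> mpolys X" using g \<Delta>(2) P.sub by blast
    ultimately show "g \<in> H"
      unfolding H_def by (intro CollectI conjI exI[of _ "\<lambda>h. if h = g then 1 else 0"]) auto
  qed
  have sqH: "ideal_square P \<subseteq> H"
    using sP.sub unfolding H_def by (auto intro!: exI[of _ "\<lambda>_. 0"])
  have JH: "cover_meet \<subseteq> H"
  proof
    fix f assume f: "f \<in> cover_meet"
    \<comment> \<open>The monomial contains a variable \<open>y\<close> of \<open>U\<close>. If some
      cover in \<open>P\<close> misses \<open>y\<close>, the monomial contains a second variable of
      \<open>P\<close> from that cover, hence lies in the square of \<open>P\<close>.\<close>
    have "Poly_Mapping.single m a \<in> H" if m: "m \<in> Poly_Mapping.keys f" for m a
    proof -
      have mX: "Poly_Mapping.keys m \<subseteq> X" and meets: "\<And>V. V \<in> covers \<Longrightarrow> Poly_Mapping.keys m \<inter> V \<noteq> {}"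
        using f m by (auto simp: cover_meet_def var_ideal_def mpolys_def)
      have sub: "Poly_Mapping.keys (m' - n) \<subseteq> X" if "Poly_Mapping.keys m' \<subseteq> X" for m' n :: "'x \<Rightarrow>\<^sub>0 nat"
        using that by (auto simp: in_keys_iff lookup_minus subset_iff)
      obtain y where y: "y \<in> Poly_Mapping.keys m" "y \<in> U" using meets[OF U(1)] by blast
      show ?thesis
      proof (cases "y \<in> T")
        case True
        then have "mvar y \<in> H" using \<Delta>H by (auto simp: \<Delta>_def)
        then show ?thesis unfolding single_eq_mult_mvar[OF y(1)]
          by (intro H.absorb single_in_mpolys sub mX)
      next
        case False
        then obtain V2 where V2: "V2 \<in> CP" "y \<notin> V2" by (auto simp: T_def)
        then obtain z where z: "z \<in> Poly_Mapping.keys m" "z \<in> V2" using meets[of V2] by (auto simp: CP_def)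
        have z': "z \<in> Poly_Mapping.keys (m - Poly_Mapping.single y 1)"
          using z V2 by (auto simp: in_keys_iff lookup_minus lookup_single when_def)
        have "mvar z \<in> P" "mvar y \<in> P" using z V2 y U c0_P by (auto simp: CP_def)
        then have "Poly_Mapping.single (m - Poly_Mapping.single y 1 - Poly_Mapping.single z 1) a * (mvar z * mvar y)
            \<in> ideal_square P"
          by (intro sP.absorb single_in_mpolys sub mX mult_in_ideal_square)
        then show ?thesis
          unfolding single_eq_mult_mvar[OF y(1)] single_eq_mult_mvar[OF z'] mult.assoc using sqH by blast
      qed
    qed
    then have "(\<Sum>m\<in>Poly_Mapping.keys f. Poly_Mapping.single m (Poly_Mapping.lookup f m)) \<in> H"
      by (rule H.sum)
    then show "f \<in> H" by (simp add: sum_monomials)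
  qed
  have idealH: "ideal H R" by (simp add: ideal_mpoly_ring H.ideal_in_axioms)
  obtain ws where ws: "set ws = U" "distinct ws" using finite_distinct_list[OF finite_U] by blast
  have len: "length ws = card U" using ws distinct_card by fastforce
  \<comment> \<open>\<open>c 0\<close> stands where the ideal of the whole of \<open>U\<close>
    would, as the two may coincide. So exactly \<open>card U\<close> steps are added, one for each
    proper initial segment.\<close>
  define C where "C i = (if i < card U then var_ideal X (set (take i ws)) else c (i - card U))" for i
  have "card U + d \<le> card \<Delta>"
  proof (rule prime_chain_le_card_generators[OF finite_X, where c = C and P = P])
    show "prime_in (mpolys X) (C i)" if "i \<le> card U + d" for i
      using that prime_c by (auto simp: C_def prime_in_var_ideal)
    show "C (card U + d) \<subseteq> P" using c(4) by (simp add: C_def)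
    show "C i \<subset> C (Suc i)" if i: "i < card U + d" for i
    proof (cases "i < card U")
      case False
      then show ?thesis using c(2)[of "i - card U"] i by (simp add: C_def Suc_diff_le)
    next
      case True
      have wi: "ws ! i \<in> U" "ws ! i \<notin> set (take i ws)"
        using True ws len by (auto simp: in_set_conv_nth nth_eq_iff_index_eq)
      have "mvar (ws ! i) \<notin> (var_ideal X (set (take i ws)) :: ('x, 'k) mpol set)"
        using wi by (simp add: mvar_in_var_ideal)
      moreover have "mvar (ws ! i) \<in> C (Suc i) \<and> var_ideal X (set (take i ws)) \<subseteq> C (Suc i)"
      proof (cases "Suc i < card U")
        case True
        have "set (take (Suc i) ws) = insert (ws ! i) (set (take i ws))"
          using \<open>i < card U\<close> len by (simp add: take_Suc_conv_app_nth)
        then show ?thesis using True wi UX by (auto simp: C_def mvar_in_var_ideal) (auto simp: var_ideal_def)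
      next
        \<comment> \<open>At the joint, the last variable of \<open>U\<close> distinguishes the
          preceding ideal from \<open>c 0\<close>.\<close>
        case False
        have "set (take i ws) \<subseteq> U" using ws(1) set_take_subset[of i ws] by blast
        then have "var_ideal X (set (take i ws)) \<subseteq> c 0"
          using U(2) UX prime_c[of 0] by (subst var_ideal_subset) (auto intro: prime_in.axioms(1))
        then show ?thesis using False True wi U(2) by (auto simp: C_def)
      qed
      ultimately show ?thesis using True by (auto simp: C_def)
    qed
    fix p assume "p \<in> P"
    then obtain u where "u \<in> mpolys X - P" "u * p \<in> H"
      using gen[OF idealH JH, of p] \<Delta>H by (auto simp: \<Delta>_def)
    then show "\<exists>u\<in>mpolys X - P. \<exists>b. (\<forall>g\<in>\<Delta>. b g \<in> mpolys X) \<and> u * p - (\<Sum>g\<in>\<Delta>. b g * g) \<in> ideal_square P"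
      by (auto simp: H_def)
  qed (use \<Delta> primeP in auto)
  \<comment> \<open>Cancelling \<open>d\<close> shows that all of \<open>U\<close> is common to the
    covers in \<open>P\<close>; as covers form an antichain, there is only one.\<close>
  then have "card U \<le> card T" using card_\<Delta> by linarith
  then have "T = U" using TU finite_U by (meson card_seteq)
  have "U = W" if W: "W \<in> CP" for W
  proof -
    have "U \<subseteq> W" using W \<open>T = U\<close> by (auto simp: T_def)
    then show ?thesis using W covers_antichain[OF U(1), of W] by (auto simp: CP_def)
  qed
  then show ?thesis using V V' unfolding CP_def by blast
qed

end

section \<open>Jets\<close>

text \<open>Evaluation at \<open>t = 0\<close>. This links coefficients of order 0 to the projection
  of jets.\<close>

lemma jet_coeff_0:
  fixes f :: "('x, 'k::field) mpol"
  shows "jet_coeff s f 0 = subst (\<lambda>x. mvar (x, 0)) f"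
proof -
  have "poly (\<Sum>j\<le>s. Polynomial.monom (mvar (x, j)) j :: ('x \<times> nat, 'k) mpol poly) 0 = mvar (x, 0)" for x :: 'x
    by (simp add: poly_sum poly_monom power_0_left if_distrib cong: if_cong)
  then show ?thesis
    by (simp add: jet_coeff_def jet_hom_def mpoly_eval_def poly_sum poly_prod flip: poly_0_coeff_0)
qed

lemma jet_coeff_mvar: "j \<le> s \<Longrightarrow> jet_coeff s (mvar x) j = mvar (x, j)"
  by (simp add: jet_coeff_def jet_hom_mvar Polynomial.coeff_sum if_distrib cong: if_cong)

lemma jet_vars_mono: "Y \<subseteq> X \<Longrightarrow> jet_vars s Y \<subseteq> jet_vars s X"
  by (auto simp: jet_vars_def)

lemma mem_jet_vars: "(x, j) \<in> jet_vars s X \<longleftrightarrow> x \<in> X \<and> j \<le> s"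
  by (simp add: jet_vars_def)

lemma subst_jet_closed:
  "f \<in> mpolys X \<Longrightarrow> subst (\<lambda>x. mvar (x, 0)) f \<in> mpolys (jet_vars s X)"
  by (rule mpolys.mpoly_eval_in) (auto simp: mconst_in_mpolys mem_jet_vars)

lemma prime_in_jet_proj:
  fixes Q :: "('x \<times> nat, 'k::field) mpol set"
  assumes "prime_in (mpolys (jet_vars s X)) Q"
  shows "prime_in (mpolys X) (jet_proj X Q)"
proof -
  interpret Q: prime_in "mpolys (jet_vars s X)" Q by fact
  note closed = subst_jet_closed[of _ X s]
  show ?thesis
    by unfold_locales
      (use Q.one_notin Q.prime closed in \<open>auto simp: jet_proj_def subst_zero subst_one subst_add subst_mult
        intro: Q.zero Q.add Q.absorb mpolys.add_in mpolys.mult_in\<close>)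
qed

text \<open>Every monomial of \<open>f\<close> has a factor \<open>x\<close> in \<open>W\<close>,
  and each coefficient of the image of \<open>x\<close> is a variable in \<open>jet_vars s W\<close>
  or 0.\<close>

lemma jet_coeff_var_ideal:
  assumes "f \<in> var_ideal X W"
  shows "jet_coeff s f j \<in> (var_ideal (jet_vars s X) (jet_vars s W) :: ('x \<times> nat, 'k::field) mpol set)"
proof -
  interpret Q: ideal_in "mpolys (jet_vars s X)" "var_ideal (jet_vars s X) (jet_vars s W) :: ('x \<times> nat, 'k) mpol set"
    by (rule ideal_in_var_ideal)
  interpret p: ideal_in "polys_over (mpolys (jet_vars s X))"
    "polys_over (var_ideal (jet_vars s X) (jet_vars s W) :: ('x \<times> nat, 'k) mpol set)"
    by (rule Q.ideal_in_polys_over)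
  have "jet_hom s f \<in> polys_over (var_ideal (jet_vars s X) (jet_vars s W))"
    unfolding jet_hom_def
  proof (rule p.mpoly_eval_in_ideal)
    show "f \<in> mpolys X" using assms by (simp add: var_ideal_def)
    show "[:mconst a:] \<in> polys_over (mpolys (jet_vars s X))" for a :: 'k
      by (simp add: mpolys.const_polys_over mconst_in_mpolys)
    show "(\<Sum>j\<le>s. Polynomial.monom (mvar (x, j)) j) \<in> polys_over (mpolys (jet_vars s X) :: ('x \<times> nat, 'k) mpol set)"
      if "x \<in> X" for x
      using that by (intro p.sum_in mpolys.monom_polys_over) (auto simp: mem_jet_vars)
    fix m assume "m \<in> Poly_Mapping.keys f"
    then obtain x where x: "x \<in> Poly_Mapping.keys m" "x \<in> W" "x \<in> X"
      using assms by (fastforce simp: var_ideal_def mpolys_def)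
    have "(\<Sum>j\<le>s. Polynomial.monom (mvar (x, j)) j) \<in>
        polys_over (var_ideal (jet_vars s X) (jet_vars s W) :: ('x \<times> nat, 'k) mpol set)"
      by (intro p.sum) (use x in \<open>auto simp: polys_over_def Q.zero mvar_in_var_ideal mem_jet_vars\<close>)
    then show "\<exists>x\<in>Poly_Mapping.keys m. (\<Sum>j\<le>s. Polynomial.monom (mvar (x, j)) j) \<in>
        polys_over (var_ideal (jet_vars s X) (jet_vars s W) :: ('x \<times> nat, 'k) mpol set)"
      using x(1) by blast
  qed
  then show ?thesis by (simp add: polys_over_def jet_coeff_def)
qed

lemma jet_proj_var_ideal:
  assumes "W \<subseteq> X"
  shows "jet_proj X (var_ideal (jet_vars s X) (jet_vars s W)) = (var_ideal X W :: ('x, 'k::field) mpol set)"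
proof
  show "var_ideal X W \<subseteq> jet_proj X (var_ideal (jet_vars s X) (jet_vars s W) :: ('x \<times> nat, 'k) mpol set)"
    using jet_coeff_var_ideal[of _ X W s 0] by (auto simp: jet_proj_def jet_coeff_0 var_ideal_def[of X])
  \<comment> \<open>Setting the variables of positive order to 0 is a left inverse of the inclusion
    of the variables of order 0, and it carries one variable ideal into the other.\<close>
  define \<theta> :: "'x \<times> nat \<Rightarrow> ('x, 'k) mpol" where "\<theta> = (\<lambda>(x, j). if j = 0 then mvar x else 0)"
  interpret W: ideal_in "mpolys X" "var_ideal X W :: ('x, 'k) mpol set" by (rule ideal_in_var_ideal)
  show "jet_proj X (var_ideal (jet_vars s X) (jet_vars s W)) \<subseteq> (var_ideal X W :: ('x, 'k) mpol set)"
  proof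
    fix f :: "('x, 'k) mpol"
    assume "f \<in> jet_proj X (var_ideal (jet_vars s X) (jet_vars s W))"
    then have f: "f \<in> mpolys X"
      and g: "subst (\<lambda>x. mvar (x, 0)) f \<in> (var_ideal (jet_vars s X) (jet_vars s W) :: ('x \<times> nat, 'k) mpol set)"
      by (auto simp: jet_proj_def)
    have "subst \<theta> (subst (\<lambda>x. mvar (x, 0)) f) \<in> var_ideal X W"
    proof (rule W.mpoly_eval_in_ideal)
      show "subst (\<lambda>x. mvar (x, 0)) f \<in> mpolys (jet_vars s X)" by (rule subst_jet_closed[OF f])
      show "\<theta> z \<in> mpolys X" if "z \<in> jet_vars s X" for z
        using that by (auto simp: \<theta>_def jet_vars_def)
      fix m assume "m \<in> Poly_Mapping.keys (subst (\<lambda>x. mvar (x, 0)) f :: ('x \<times> nat, 'k) mpol)"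
      then have "Poly_Mapping.keys m \<inter> jet_vars s W \<noteq> {}"
        using g by (auto simp: var_ideal_def)
      then obtain z where z: "z \<in> Poly_Mapping.keys m" "z \<in> jet_vars s W" by blast
      then have "\<theta> z \<in> var_ideal X W"
        using assms W.zero by (auto simp: \<theta>_def jet_vars_def mvar_in_var_ideal)
      then show "\<exists>z\<in>Poly_Mapping.keys m. \<theta> z \<in> var_ideal X W" using z by blast
    qed (rule mconst_in_mpolys)
    moreover have "subst \<theta> (subst (\<lambda>x. mvar (x, 0)) f) = f"
      by (rule subst_subst_id[OF f]) (simp add: subst_mvar \<theta>_def)
    ultimately show "f \<in> var_ideal X W" by simp
  qed
qed

section \<open>Closure in the Zariski topology\<close>

lemma topspace_zariski: "topspace (zariski R) = Spec R"
proof -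
  have "openin (zariski R) U \<Longrightarrow> U \<subseteq> Spec R" for U by (auto simp: openin_zariski)
  moreover have "openin (zariski R) (Spec R)"
  proof -
    show ?thesis
      unfolding openin_zariski
    \<comment> \<open>\<open>R\<close> is an arbitrary record here. A prime ideal certifies that it
      is a ring, so that its unit lies in the carrier and cuts out the empty locus.\<close>
    proof (cases "Spec R = {}")
      case True
      then show "\<exists>A\<subseteq>carrier R. Spec R = Spec R - vanishing_locus R A" by auto
    next
      case False
      then obtain P where "primeideal P R" by (auto simp: Spec_def)
      then interpret primeideal P R .
      have "Spec R = Spec R - vanishing_locus R {\<one>\<^bsub>R\<^esub>}"
        using primeideal.one_compl by (auto simp: vanishing_locus_def Spec_def)
      then show "\<exists>A\<subseteq>carrier R. Spec R = Spec R - vanishing_locus R A"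
        by (intro exI[of _ "{\<one>\<^bsub>R\<^esub>}"]) auto
    qed
  qed
  ultimately show ?thesis by (auto simp: topspace_def)
qed

text \<open>The zero locus of a single element is closed, so an element vanishing on
  \<open>S\<close> vanishes on the closure.\<close>

lemma vanishing_ideal_closure:
  assumes "S \<subseteq> Spec R"
  shows "vanishing_ideal R (zariski R closure_of S) = vanishing_ideal R S"
proof
  show "vanishing_ideal R (zariski R closure_of S) \<subseteq> vanishing_ideal R S"
    using closure_of_subset[of S "zariski R"] assms by (auto simp: topspace_zariski vanishing_ideal_def)
  show "vanishing_ideal R S \<subseteq> vanishing_ideal R (zariski R closure_of S)"
  proof
    fix f assume f: "f \<in> vanishing_ideal R S"
    then have fR: "f \<in> carrier R" by (simp add: vanishing_ideal_def)
    have "openin (zariski R) (Spec R - vanishing_locus R {f})"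
      using fR by (auto simp: openin_zariski)
    moreover have "vanishing_locus R {f} \<subseteq> Spec R" by (auto simp: vanishing_locus_def)
    ultimately have "closedin (zariski R) (vanishing_locus R {f})"
      by (simp add: closedin_def topspace_zariski)
    moreover have "S \<subseteq> vanishing_locus R {f}"
      using f assms by (auto simp: vanishing_ideal_def vanishing_locus_def)
    ultimately have "zariski R closure_of S \<subseteq> vanishing_locus R {f}" by (rule closure_of_minimal[rotated])
    then show "f \<in> vanishing_ideal R (zariski R closure_of S)"
      using fR by (auto simp: vanishing_ideal_def vanishing_locus_def)
  qed
qed

section \<open>Jets over nonsingular points and the principal jet ideal\<close>

context finite_hypergraph
begin

abbreviation "R_jets s \<equiv> mpoly_ring (jet_vars s X) :: ('x \<times> nat, 'k) mpol ring"
abbreviation "cover_jets s V \<equiv> var_ideal (jet_vars s X) (jet_vars s V) :: ('x \<times> nat, 'k) mpol set"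

definition nonsingular_jets :: "nat \<Rightarrow> ('x \<times> nat, 'k) mpol set set" where
  "nonsingular_jets s = vanishing_locus (R_jets s) (jet_ideal X s cover_meet) -
     {Q \<in> Spec (R_jets s). jet_proj X Q \<in> singular_locus R Z}"

lemma jet_coeffs_closed:
  "{jet_coeff s f j | f j. f \<in> cover_meet \<and> j \<le> s} \<subseteq> carrier (R_jets s)"
  using jet_coeff_closed[of _ X s] by (auto simp: cover_meet_def)

lemma cover_jets_nonsingular:
  assumes V: "V \<in> covers"
  shows "cover_jets s V \<in> nonsingular_jets s"
proof -
  interpret Rs: cring "R_jets s" by (rule cring_mpoly_ring)
  have "jet_ideal X s cover_meet \<subseteq> cover_jets s V"
    unfolding jet_ideal_def
    by (rule Rs.genideal_minimal)
      (use V jet_coeff_var_ideal[of _ X V s] in \<open>auto simp: ideal_mpoly_ring ideal_in_var_ideal cover_meet_def\<close>)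
  moreover have "jet_proj X (cover_jets s V) \<notin> singular_locus R Z"
    using var_ideal_nonsingular[OF V] jet_proj_var_ideal[OF covers_subset[OF V]] by metis
  ultimately show ?thesis
    by (simp add: nonsingular_jets_def vanishing_locus_def Spec_def primeideal_mpoly_ring prime_in_var_ideal)
qed

lemma nonsingular_jets_contain_cover:
  assumes "Q \<in> nonsingular_jets s"
  shows "\<exists>V\<in>covers. cover_jets s V \<subseteq> Q"
proof -
  interpret Rs: cring "R_jets s" by (rule cring_mpoly_ring)
  have primeQ: "prime_in (mpolys (jet_vars s X)) Q" and jets: "jet_ideal X s cover_meet \<subseteq> Q"
    and nonsing: "jet_proj X Q \<notin> singular_locus R Z"
    using assms by (auto simp: nonsingular_jets_def vanishing_locus_def Spec_def primeideal_mpoly_ring)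
  interpret Q: prime_in "mpolys (jet_vars s X)" Q by fact
  have jetQ: "jet_coeff s f j \<in> Q" if "f \<in> cover_meet" "j \<le> s" for f j
    using that jets Rs.genideal_self[OF jet_coeffs_closed] unfolding jet_ideal_def by blast
  define P where "P = jet_proj X Q"
  have primeP: "prime_in (mpolys X) P" unfolding P_def by (rule prime_in_jet_proj[OF primeQ])
  have "cover_meet \<subseteq> P"
    using jetQ[of _ 0] by (auto simp: P_def jet_proj_def jet_coeff_0 cover_meet_def)
  then have PZ: "P \<in> Z" using primeP edge_ideal_subset_cover_meet in_Z by blast
  then obtain V where V: "V \<in> covers" "mvar ` V \<subseteq> P" using exists_cover_in_prime primeP in_Z by blast
  have "V' = V" if "V' \<in> covers" "mvar ` V' \<subseteq> P" for V'
    using nonsingular_unique_cover[OF PZ _ that V] nonsing by (simp add: P_def)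
  then obtain u where u: "u \<in> mpolys X" "u \<notin> P" "\<And>f. f \<in> var_ideal X V \<Longrightarrow> u * f \<in> cover_meet"
    using exists_separating_element[OF primeP V(1)] by metis
  \<comment> \<open>The coefficient of order 0 is the pullback of \<open>u\<close> to the jets, so
    this restates that \<open>u\<close> is outside \<open>P\<close>.\<close>
  have u0: "jet_coeff s u 0 \<notin> Q" using u(1,2) by (simp add: P_def jet_proj_def jet_coeff_0)
  have u_in: "jet_coeff s u j \<in> mpolys (jet_vars s X)" for j
    using jet_coeff_closed[of u X s j] u(1) by simp
  have "mvar (x, j) \<in> Q" if x: "x \<in> V" and "j \<le> s" for x j
    using \<open>j \<le> s\<close>
  proof (induction j rule: less_induct)
    case (less j)
    have xX: "x \<in> X" using x V(1) covers_subset by blast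
    \<comment> \<open>In order \<open>j\<close> the variable \<open>x_j\<close> occurs only next to
      \<open>u_0\<close>. The other terms involve \<open>x_i\<close> with \<open>i < j\<close>,
      which lie in \<open>Q\<close> by induction.\<close>
    have "jet_coeff s (u * mvar x) j = (\<Sum>i\<le>j. jet_coeff s u i * mvar (x, j - i))"
      unfolding jet_coeff_mult using less.prems by (intro sum.cong) (auto simp: jet_coeff_mvar)
    also have "\<dots> = jet_coeff s u 0 * mvar (x, j) + (\<Sum>i\<in>{..j} - {0}. jet_coeff s u i * mvar (x, j - i))"
      by (subst sum.remove[of _ 0]) auto
    finally have "jet_coeff s u 0 * mvar (x, j) =
        jet_coeff s (u * mvar x) j - (\<Sum>i\<in>{..j} - {0}. jet_coeff s u i * mvar (x, j - i))"
      by (simp add: algebra_simps)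
    also have "\<dots> \<in> Q"
    proof (intro Q.diff Q.sum Q.absorb)
      show "jet_coeff s (u * mvar x) j \<in> Q"
        using less.prems x xX by (intro jetQ u(3)) (auto simp: mvar_in_var_ideal)
      show "mvar (x, j - i) \<in> Q" if "i \<in> {..j} - {0}" for i
        using that less by (intro less.IH) auto
    qed (rule u_in)
    finally have "jet_coeff s u 0 * mvar (x, j) \<in> Q" .
    then show ?case using u0 Q.prime[OF u_in[of 0], of "mvar (x, j)"] xX less.prems by (auto simp: mem_jet_vars)
  qed
  then have "mvar ` jet_vars s V \<subseteq> Q" by (auto simp: jet_vars_def)
  then have "cover_jets s V \<subseteq> Q"
    using var_ideal_subset[OF Q.ideal_in_axioms jet_vars_mono[OF covers_subset[OF V(1)]]] by blast
  then show ?thesis using V(1) by blast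
qed

text \<open>As in \<open>vanishing_ideal_Z\<close>, the ideals of the cover jets are points of the
  nonsingular locus, and each of its points contains one of them. The carrier is the value if there
  are no covers, that is, if the empty set is an edge.\<close>

lemma principal_jet_ideal_eq:
  "principal_jet_ideal X s edge_id = carrier (R_jets s) \<inter> (\<Inter>V\<in>covers. cover_jets s V)"
proof -
  have "principal_jet_ideal X s edge_id =
      vanishing_ideal (R_jets s) (zariski (R_jets s) closure_of nonsingular_jets s)"
    by (simp add: principal_jet_ideal_def Let_def vanishing_ideal_Z nonsingular_jets_def)
  also have "\<dots> = vanishing_ideal (R_jets s) (nonsingular_jets s)"
    by (rule vanishing_ideal_closure) (auto simp: nonsingular_jets_def vanishing_locus_def)
  also have "\<dots> = carrier (R_jets s) \<inter> (\<Inter>V\<in>covers. cover_jets s V)"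
    using cover_jets_nonsingular[of _ s] nonsingular_jets_contain_cover[of _ s]
    unfolding vanishing_ideal_def by blast
  finally show ?thesis .
qed

text \<open>Variables of order 0 suffice: each other cover has an \<open>x\<close> outside
  \<open>V\<close>, as no cover contains another, and \<open>x_0\<close> exists for every
  \<open>s\<close>.\<close>

lemma separating_cover_jets:
  assumes "V \<in> covers"
  shows "\<exists>u\<in>carrier (R_jets s). u \<notin> cover_jets s V \<and> (\<forall>V'\<in>covers - {V}. u \<in> cover_jets s V')"
proof -
  let ?\<V> = "jet_vars s ` (covers - {V})"
  have "\<exists>z\<in>Y. z \<in> jet_vars s X \<and> mvar z \<notin> cover_jets s V" if Y: "Y \<in> ?\<V>" for Y
  proof -
    obtain V' where V': "V' \<in> covers" "V' \<noteq> V" "Y = jet_vars s V'" using Y by blast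
    then obtain x where "x \<in> V'" "x \<notin> V" using covers_antichain[OF V'(1) assms] by blast
    then show ?thesis using covers_subset[OF V'(1)] V'(3)
      by (intro bexI[of _ "(x, 0)"]) (auto simp: mvar_in_var_ideal jet_vars_def)
  qed
  with exists_separating_monomial[OF prime_in_var_ideal, of ?\<V>] finite_covers
  obtain u where "u \<in> mpolys (jet_vars s X)" "u \<notin> cover_jets s V"
    "\<And>Y. Y \<in> ?\<V> \<Longrightarrow> u \<in> var_ideal (jet_vars s X) Y" by blast
  then show ?thesis by (intro bexI[of _ u]) auto
qed

end

text \<open>The last conjunct accounts for the definite article in "the irredundant primary
  decomposition". Decompositions are finite families, so index sets of natural numbers lose
  nothing.\<close>

theorem theorem6p7:
  fixes X :: "'x set" and E :: "'x set set" and W :: "nat \<Rightarrow> 'x set" and n s :: nat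
  fixes R\<^sub>s :: "('x \<times> nat, 'k::field) mpol ring" and P :: "('x \<times> nat, 'k) mpol set"
    and Q :: "nat \<Rightarrow> ('x \<times> nat, 'k) mpol set"
  defines "R\<^sub>s \<equiv> mpoly_ring (jet_vars s X)"
    and "P \<equiv> principal_jet_ideal X s (edge_ideal X E)"
    and "Q \<equiv> \<lambda>k. Idl\<^bsub>R\<^sub>s\<^esub> (mvar ` jet_vars s (W k))"
  assumes "finite X" and "clutter X E"
    and "bij_betw W {1..n} {U. minimal_vertex_cover X E U}"
  shows "P = carrier R\<^sub>s \<inter> (\<Inter>k\<in>{1..n}. Q k) \<and>
    irredundant_primary_decomposition R\<^sub>s P {1..n} Q \<and>
    (\<forall>(K :: nat set) Q'. irredundant_primary_decomposition R\<^sub>s P K Q' \<longrightarrow> Q' ` K = Q ` {1..n})"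
proof -
  interpret h: finite_hypergraph X E "TYPE('k)"
    using assms(4,5) by unfold_locales (auto simp: clutter_def)
  have W: "bij_betw W {1..n} h.covers" using assms(6) by (simp add: h.covers_def)
  then have W_in: "W k \<in> h.covers" if "k \<in> {1..n}" for k using that by (auto simp: bij_betw_def)
  have Q: "Q k = h.cover_jets s (W k)" if "k \<in> {1..n}" for k
    unfolding Q_def R\<^sub>s_def using h.covers_subset[OF W_in[OF that]] by (intro genideal_mvar jet_vars_mono)
  have "irredundant_primes R\<^sub>s {1..n} Q"
  proof (intro irredundant_primes.intro irredundant_primes_axioms.intro)
    show "cring R\<^sub>s" unfolding R\<^sub>s_def by (rule cring_mpoly_ring)
    show "primeideal (Q k) R\<^sub>s" if "k \<in> {1..n}" for k
      unfolding R\<^sub>s_def primeideal_mpoly_ring Q[OF that] by (rule prime_in_var_ideal)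
    show "\<exists>u\<in>carrier R\<^sub>s. u \<notin> Q k \<and> (\<forall>l\<in>{1..n} - {k}. u \<in> Q l)" if k: "k \<in> {1..n}" for k
    proof -
      obtain u where u: "u \<in> carrier R\<^sub>s" "u \<notin> h.cover_jets s (W k)"
        "\<And>V'. V' \<in> h.covers - {W k} \<Longrightarrow> u \<in> h.cover_jets s V'"
        using h.separating_cover_jets[OF W_in[OF k], of s] unfolding R\<^sub>s_def by blast
      have "u \<in> Q l" if "l \<in> {1..n} - {k}" for l
      proof -
        have l: "l \<in> {1..n}" "l \<noteq> k" using that by auto
        then have "W l \<noteq> W k" using inj_onD[OF bij_betw_imp_inj_on[OF W]] k by blast
        then show ?thesis unfolding Q[OF l(1)] using u(3) W_in[OF l(1)] by blast
      qed
      then show ?thesis using u(1,2) unfolding Q[OF k] by blast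
    qed
  qed simp
  then interpret irredundant_primes R\<^sub>s "{1..n}" Q .
  have "P = carrier R\<^sub>s \<inter> (\<Inter>V\<in>h.covers. h.cover_jets s V)"
    unfolding P_def R\<^sub>s_def by (rule h.principal_jet_ideal_eq)
  also have "(\<Inter>V\<in>h.covers. h.cover_jets s V) = (\<Inter>k\<in>{1..n}. Q k)"
    unfolding bij_betw_imp_surj_on[OF W, symmetric] using Q by simp
  finally have P: "P = meet" unfolding meet_def .
  have "meet = carrier R\<^sub>s \<inter> (\<Inter>k\<in>{1..n}. Q k)" by (rule meet_def)
  then show ?thesis
    unfolding P using irredundant_primary_decomposition primary_decomposition_unique by blast
qed

end
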